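(* Let $\Omega\subset\mathbb{R}^d$ be a connected open set and let $H$ be the RKHS on $\Omega$ of a positive definite kernel $k$ that is continuous on $\Omega\times\Omega$ and such that $k_x$ is real analytic on $\Omega$ for every $x\in\Omega$; $H$ is continuously included in the space of $C^\infty$ functions on $\Omega$. Let $f:\Omega\to\Omega$ be of class $C^\infty$ such that $C_f$ is densely defined on $H$, and let $\Lambda=\{p_1,\dots,p_r\}\subset\Omega$ be a set of fixed points of $f$. Let $r_n:=\dim V_{\Lambda,n}$. Then there exist continuous linear operators $S_f^\times,N_f^\times:\Phi^*\to\Phi^*$ and $S_f,N_f:\Phi\to\Phi$ such that $$C_f^\times=S_f^\times+N_f^\times,\qquad C_f^*|_\Phi=S_f+N_f,$$ with the following properties: (1) there exist a family of complex numbers $\{\gamma_i\}_{i=1}^\infty$ and families of vectors $\{w_i\}_{i=1}^\infty\subset\Phi$ and $\{u_i\}_{i=1}^\infty\subset\Phi^*$ such that $\{w_i\}_{i=1}^{r_n}$ is a basis of $V_{\Lambda,n}$, and $$S_f^\times u_i=\gamma_iu_i,\qquad S_fw_i=\overline{\gamma_i}\,w_i,\qquad\langle w_j,u_i\rangle=\delta_{i,j}$$ for all positive integers $i,j\ge1$, and $$S_f^\times u=\sum_{i=1}^\infty\gamma_i\,\langle w_i,u\rangle\,u_i,\qquad S_fw=\sum_{i=1}^\infty\overline{\gamma_i}\,\langle w,u_i\rangle\,w_i$$ hold for $u\in\Phi^*$ and $w\in\Phi$, where the convergences on the right-hand sides are in the topologies of $\Phi^*$ and $\Phi$, respectively; (2)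 for each $u\in\Phi^*$, $(N_f^\times)^nu\to0$ as $n\to\infty$; (3) for each $w\in\Phi$, there exists $n\ge0$ such that $N_f^nw=0$; (4) $S_fN_f=N_fS_f$ and $S_f^\times N_f^\times=N_f^\times S_f^\times$.
   Context: Conventions: $k_x:=k(x,\cdot)\in H$, $\langle h,k_x\rangle_H=h(x)$, inner product linear in the first variable. $C_fh:=h\circ f$ on $D(C_f)=\{h\in H:h\circ f\in H\}$; $C_f^*$ is its adjoint. $V_{p,n}:=\mathrm{span}\{\partial_x^\alpha k(x,\cdot)|_{x=p}:|\alpha|\le n\}\subset H$, $V_{\Lambda,n}:=\sum_{i=1}^rV_{p_i,n}$. Since the $p_i$ are fixed points, $C_f^*(V_{\Lambda,n})\subset V_{\Lambda,n}$ for all $n$. $\delta_{i,j}$ is the Kronecker delta. $\Phi:=\bigcup_{n\ge0}V_{\Lambda,n}$ with the strongest topology for which all inclusions $V_{\Lambda,n}\hookrightarrow\Phi$ are continuous (inductive limit topology). With $\pi_{n+1,n}:V_{\Lambda,n+1}\to V_{\Lambda,n}$ the orthogonal projection, $\Phi^*:=\{(\mu_n)_n\in\prod_{n\ge0}V_{\Lambda,n}:\pi_{n+1,n}(\mu_{n+1})=\mu_n\}$ with the relative topology of the product topology. The pairing $\langle\cdot,\cdot\rangle:\Phi\times\Phi^*\to\mathbb{C}$ is $\langle h,(g_n)_n\rangle:=\lim_{n\to\infty}\langle h,g_n\rangle_H$; it is linear in the first and conjugate-linear in the second variable. The extended Koopman operator $C_f^\times:\Phi^*\to\Phi^*$ is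 the unique (continuous) linear map with $\langle g,C_f^\times\mu\rangle=\langle C_f^*g,\mu\rangle$ for all $g\in\Phi$, $\mu\in\Phi^*$.
   Formalization: In the expansion of S_f^× u the coefficient ⟨w_i,u⟩ is replaced by its complex conjugate (the printed one is not linear in u), and the families run over 1≤i≤sup r_n, which is all i≥1 when Λ is nonempty and H is infinite-dimensional. *)

theory Defs
  imports "HOL-Analysis.Analysis" "HOL-Library.Function_Algebras"
begin

section \<open>Complex-valued functions as a complex vector space\<close>

text \<open>A function on \<open>\<Omega> \<subseteq> \<real>\<^sup>d\<close> is represented by its extension by zero to the whole type
  \<open>real ^ 'd\<close>. Addition and zero are the pointwise ones of \<open>Function_Algebras\<close>.\<close>

definition cscale :: "complex \<Rightarrow> ('a \<Rightarrow> complex) \<Rightarrow> 'a \<Rightarrow> complex" where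
  "cscale c h = (\<lambda>x. c * h x)"

interpretation cfun: vector_space "cscale :: complex \<Rightarrow> ('a \<Rightarrow> complex) \<Rightarrow> 'a \<Rightarrow> complex"
  by unfold_locales (auto simp: cscale_def fun_eq_iff algebra_simps)

definition cscale_seq :: "complex \<Rightarrow> (nat \<Rightarrow> 'a \<Rightarrow> complex) \<Rightarrow> nat \<Rightarrow> 'a \<Rightarrow> complex" where
  "cscale_seq c \<mu> = (\<lambda>n. cscale c (\<mu> n))"

text \<open>Operators on a subset of a type are total functions whose values off the subset are
  irrelevant.\<close>

definition clinear_on ::
  "(complex \<Rightarrow> 'v \<Rightarrow> 'v) \<Rightarrow> 'v set \<Rightarrow> ('v::ab_group_add \<Rightarrow> 'v) \<Rightarrow> bool" where
  "clinear_on sc V T \<longleftrightarrow>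
     (\<forall>g\<in>V. \<forall>h\<in>V. T (g + h) = T g + T h) \<and> (\<forall>c. \<forall>h\<in>V. T (sc c h) = sc c (T h))"

definition cont_linear_op ::
  "(complex \<Rightarrow> 'v \<Rightarrow> 'v) \<Rightarrow> 'v topology \<Rightarrow> ('v::ab_group_add \<Rightarrow> 'v) \<Rightarrow> bool" where
  "cont_linear_op sc X T \<longleftrightarrow>
     T \<in> topspace X \<rightarrow> topspace X \<and> clinear_on sc (topspace X) T \<and> continuous_map X X T"


section \<open>Partial derivatives, smoothness, real analyticity\<close>

definition partial :: "'d \<Rightarrow> (real ^ 'd::finite \<Rightarrow> 'b::real_normed_vector) \<Rightarrow> real ^ 'd \<Rightarrow> 'b" where
  "partial i h = (\<lambda>x. frechet_derivative h (at x) (axis i 1))"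

definition partials ::
  "'d list \<Rightarrow> (real ^ 'd::finite \<Rightarrow> 'b::real_normed_vector) \<Rightarrow> real ^ 'd \<Rightarrow> 'b" where
  "partials is h = foldr partial is h"

text \<open>Differentiability of all iterated partial derivatives makes all of them continuous.\<close>

definition smooth_on ::
  "(real ^ 'd::finite) set \<Rightarrow> (real ^ 'd \<Rightarrow> 'b::real_normed_vector) \<Rightarrow> bool" where
  "smooth_on \<Omega> h \<longleftrightarrow> (\<forall>is. \<forall>x\<in>\<Omega>. partials is h differentiable (at x))"

text \<open>A multi-index is a function \<open>\<alpha> :: 'd \<Rightarrow> nat\<close>, with \<open>\<bar>\<alpha>\<bar> = sum \<alpha> UNIV\<close>. The index type
  carries no order, so some order of differentiation is chosen; it is immaterial for smooth
  functions, whose partial derivatives commute.\<close>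

definition mpartial ::
  "('d \<Rightarrow> nat) \<Rightarrow> (real ^ 'd::finite \<Rightarrow> 'b::real_normed_vector) \<Rightarrow> real ^ 'd \<Rightarrow> 'b" where
  "mpartial \<alpha> h = partials (SOME is. \<forall>i. count_list is i = \<alpha> i) h"

definition real_analytic_on :: "(real ^ 'd::finite) set \<Rightarrow> (real ^ 'd \<Rightarrow> complex) \<Rightarrow> bool" where
  "real_analytic_on \<Omega> h \<longleftrightarrow>
     (\<forall>a\<in>\<Omega>. \<exists>c :: ('d \<Rightarrow> nat) \<Rightarrow> complex. \<exists>e>0. \<forall>x\<in>ball a e.
        ((\<lambda>\<alpha>. c \<alpha> * of_real (\<Prod>i\<in>UNIV. (x $ i - a $ i) ^ \<alpha> i)) has_sum h x) UNIV)"


section \<open>Reproducing kernel Hilbert spaces\<close>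

type_synonym 'a inner_fun = "('a \<Rightarrow> complex) \<Rightarrow> ('a \<Rightarrow> complex) \<Rightarrow> complex"

text \<open>Positive definite in the sense of Aronszajn: all Gram matrices are Hermitian and positive
  semidefinite.\<close>

definition pos_def_kernel :: "'a set \<Rightarrow> ('a \<Rightarrow> 'a \<Rightarrow> complex) \<Rightarrow> bool" where
  "pos_def_kernel \<Omega> k \<longleftrightarrow>
     (\<forall>x\<in>\<Omega>. \<forall>y\<in>\<Omega>. k y x = cnj (k x y)) \<and>
     (\<forall>X c. finite X \<and> X \<subseteq> \<Omega> \<longrightarrow> 0 \<le> Re (\<Sum>x\<in>X. \<Sum>y\<in>X. c x * cnj (c y) * k x y))"

definition kfun :: "'a set \<Rightarrow> ('a \<Rightarrow> 'a \<Rightarrow> complex) \<Rightarrow> 'a \<Rightarrow> 'a \<Rightarrow> complex" where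
  "kfun \<Omega> k x = (\<lambda>y. if y \<in> \<Omega> then k x y else 0)"

definition hnorm :: "'a inner_fun \<Rightarrow> ('a \<Rightarrow> complex) \<Rightarrow> real" where
  "hnorm ip h = sqrt (Re (ip h h))"

text \<open>The guard makes \<open>hdist\<close> symmetric and nonnegative on the whole type, as required by the
  locale \<open>Metric_space\<close>.\<close>

definition hdist :: "('a \<Rightarrow> complex) set \<Rightarrow> 'a inner_fun \<Rightarrow> ('a \<Rightarrow> complex) \<Rightarrow> ('a \<Rightarrow> complex) \<Rightarrow> real" where
  "hdist H ip g h = (if g \<in> H \<and> h \<in> H then hnorm ip (g - h) else 0)"

definition htop :: "('a \<Rightarrow> complex) set \<Rightarrow> 'a inner_fun \<Rightarrow> ('a \<Rightarrow> complex) topology" where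
  "htop H ip = Metric_space.mtopology H (hdist H ip)"

definition is_rkhs ::
  "'a set \<Rightarrow> ('a \<Rightarrow> 'a \<Rightarrow> complex) \<Rightarrow> ('a \<Rightarrow> complex) set \<Rightarrow> 'a inner_fun \<Rightarrow> bool" where
  "is_rkhs \<Omega> k H ip \<longleftrightarrow>
     cfun.subspace H \<and> (\<forall>h\<in>H. \<forall>x. x \<notin> \<Omega> \<longrightarrow> h x = 0) \<and>
     (\<forall>g\<in>H. \<forall>h\<in>H. \<forall>l\<in>H. ip (g + h) l = ip g l + ip h l) \<and>
     (\<forall>c. \<forall>g\<in>H. \<forall>h\<in>H. ip (cscale c g) h = c * ip g h) \<and>
     (\<forall>g\<in>H. \<forall>h\<in>H. ip h g = cnj (ip g h)) \<and>
     (\<forall>h\<in>H. h \<noteq> 0 \<longrightarrow> 0 < Re (ip h h)) \<and>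
     Metric_space.mcomplete H (hdist H ip) \<and>
     (\<forall>x\<in>\<Omega>. kfun \<Omega> k x \<in> H \<and> (\<forall>h\<in>H. ip h (kfun \<Omega> k x) = h x))"

text \<open>Continuity of the linear inclusion into the space of smooth functions, whose topology is given
  by the seminorms \<open>h \<mapsto> sup {\<bar>\<partial>\<^sup>\<alpha> h x\<bar> | x \<in> K}\<close> for \<open>K \<subseteq> \<Omega>\<close> compact.\<close>

definition continuously_in_smooth ::
  "(real ^ 'd::finite) set \<Rightarrow> (real ^ 'd \<Rightarrow> complex) set \<Rightarrow> (real ^ 'd) inner_fun \<Rightarrow> bool" where
  "continuously_in_smooth \<Omega> H ip \<longleftrightarrow>
     (\<forall>h\<in>H. smooth_on \<Omega> h) \<and>
     (\<forall>K \<alpha>. compact K \<and> K \<subseteq> \<Omega> \<longrightarrow>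
        (\<exists>C. \<forall>h\<in>H. \<forall>x\<in>K. norm (mpartial \<alpha> h x) \<le> C * hnorm ip h))"


section \<open>Koopman operators and their adjoints\<close>

definition koopman :: "'a set \<Rightarrow> ('a \<Rightarrow> 'a) \<Rightarrow> ('a \<Rightarrow> complex) \<Rightarrow> 'a \<Rightarrow> complex" where
  "koopman \<Omega> f h = (\<lambda>x. if x \<in> \<Omega> then h (f x) else 0)"

definition koopman_dom ::
  "'a set \<Rightarrow> ('a \<Rightarrow> complex) set \<Rightarrow> ('a \<Rightarrow> 'a) \<Rightarrow> ('a \<Rightarrow> complex) set" where
  "koopman_dom \<Omega> H f = {h \<in> H. koopman \<Omega> f h \<in> H}"

definition densely_defined ::
  "('a \<Rightarrow> complex) set \<Rightarrow> 'a inner_fun \<Rightarrow> ('a \<Rightarrow> complex) set \<Rightarrow> bool" where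
  "densely_defined H ip D \<longleftrightarrow> D \<subseteq> H \<and> htop H ip closure_of D = H"

definition is_adjoint_value ::
  "('a \<Rightarrow> complex) set \<Rightarrow> 'a inner_fun \<Rightarrow> ('a \<Rightarrow> complex) set \<Rightarrow>
   (('a \<Rightarrow> complex) \<Rightarrow> 'a \<Rightarrow> complex) \<Rightarrow> ('a \<Rightarrow> complex) \<Rightarrow> ('a \<Rightarrow> complex) \<Rightarrow> bool" where
  "is_adjoint_value H ip D A g g' \<longleftrightarrow> g' \<in> H \<and> (\<forall>h\<in>D. ip (A h) g = ip h g')"

definition koopman_adj_dom ::
  "'a set \<Rightarrow> ('a \<Rightarrow> complex) set \<Rightarrow> 'a inner_fun \<Rightarrow> ('a \<Rightarrow> 'a) \<Rightarrow> ('a \<Rightarrow> complex) set" where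
  "koopman_adj_dom \<Omega> H ip f =
     {g \<in> H. \<exists>g'. is_adjoint_value H ip (koopman_dom \<Omega> H f) (koopman \<Omega> f) g g'}"

definition koopman_adj ::
  "'a set \<Rightarrow> ('a \<Rightarrow> complex) set \<Rightarrow> 'a inner_fun \<Rightarrow> ('a \<Rightarrow> 'a) \<Rightarrow> ('a \<Rightarrow> complex) \<Rightarrow> 'a \<Rightarrow> complex" where
  "koopman_adj \<Omega> H ip f g =
     (THE g'. is_adjoint_value H ip (koopman_dom \<Omega> H f) (koopman \<Omega> f) g g')"


section \<open>The rigged space\<close>

definition kernel_deriv ::
  "(real ^ 'd::finite) set \<Rightarrow> (real ^ 'd \<Rightarrow> real ^ 'd \<Rightarrow> complex) \<Rightarrow> ('d \<Rightarrow> nat) \<Rightarrow> real ^ 'd \<Rightarrow>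
   real ^ 'd \<Rightarrow> complex" where
  "kernel_deriv \<Omega> k \<alpha> p = (\<lambda>y. if y \<in> \<Omega> then mpartial \<alpha> (\<lambda>x. k x y) p else 0)"

definition jet_space ::
  "(real ^ 'd::finite) set \<Rightarrow> (real ^ 'd \<Rightarrow> real ^ 'd \<Rightarrow> complex) \<Rightarrow> real ^ 'd \<Rightarrow> nat \<Rightarrow>
   (real ^ 'd \<Rightarrow> complex) set" where
  "jet_space \<Omega> k p n = cfun.span {kernel_deriv \<Omega> k \<alpha> p | \<alpha>. sum \<alpha> UNIV \<le> n}"

definition jet_sum ::
  "(real ^ 'd::finite) set \<Rightarrow> (real ^ 'd \<Rightarrow> real ^ 'd \<Rightarrow> complex) \<Rightarrow> (real ^ 'd) set \<Rightarrow> nat \<Rightarrow>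
   (real ^ 'd \<Rightarrow> complex) set" where
  "jet_sum \<Omega> k \<Lambda> n = {\<Sum>p\<in>\<Lambda>. v p | v. \<forall>p\<in>\<Lambda>. v p \<in> jet_space \<Omega> k p n}"

text \<open>In the following, \<open>V\<close> stands for the sequence of spaces \<open>V\<^bsub>\<Lambda>,n\<^esub>\<close>.\<close>

definition Phi :: "(nat \<Rightarrow> ('a \<Rightarrow> complex) set) \<Rightarrow> ('a \<Rightarrow> complex) set" where
  "Phi V = (\<Union>n. V n)"

text \<open>The final topology with respect to the inclusions of the spaces \<open>V n\<close>.\<close>

definition Phi_top ::
  "('a \<Rightarrow> complex) set \<Rightarrow> 'a inner_fun \<Rightarrow> (nat \<Rightarrow> ('a \<Rightarrow> complex) set) \<Rightarrow> ('a \<Rightarrow> complex) topology" where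
  "Phi_top H ip V =
     topology (\<lambda>U. U \<subseteq> Phi V \<and> (\<forall>n. openin (subtopology (htop H ip) (V n)) (U \<inter> V n)))"

lemma istopology_Phi_top:
  "istopology (\<lambda>U. U \<subseteq> Phi V \<and> (\<forall>n. openin (subtopology X (V n)) (U \<inter> V n)))"
  unfolding istopology_def
proof (intro conjI allI impI)
  fix S T n
  assume S: "S \<subseteq> Phi V \<and> (\<forall>n. openin (subtopology X (V n)) (S \<inter> V n))"
    and T: "T \<subseteq> Phi V \<and> (\<forall>n. openin (subtopology X (V n)) (T \<inter> V n))"
  show "S \<inter> T \<subseteq> Phi V"
    using S by auto
  have "openin (subtopology X (V n)) ((S \<inter> V n) \<inter> (T \<inter> V n))"
    by (rule openin_Int) (use S T in simp_all)
  also have "(S \<inter> V n) \<inter> (T \<inter> V n) = S \<inter> T \<inter> V n"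
    by auto
  finally show "openin (subtopology X (V n)) (S \<inter> T \<inter> V n)" .
next
  fix \<K> n
  assume K: "\<forall>K\<in>\<K>. K \<subseteq> Phi V \<and> (\<forall>n. openin (subtopology X (V n)) (K \<inter> V n))"
  show "\<Union>\<K> \<subseteq> Phi V"
    using K by auto
  have "openin (subtopology X (V n)) (\<Union>K\<in>\<K>. K \<inter> V n)"
    by (rule openin_clauses(3)) (use K in auto)
  also have "(\<Union>K\<in>\<K>. K \<inter> V n) = \<Union>\<K> \<inter> V n"
    by auto
  finally show "openin (subtopology X (V n)) (\<Union>\<K> \<inter> V n)" .
qed

lemma openin_Phi_top:
  "openin (Phi_top H ip V) U \<longleftrightarrow>
     U \<subseteq> Phi V \<and> (\<forall>n. openin (subtopology (htop H ip) (V n)) (U \<inter> V n))"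
  unfolding Phi_top_def by (simp add: topology_inverse'[OF istopology_Phi_top])

definition orth_proj ::
  "'a inner_fun \<Rightarrow> ('a \<Rightarrow> complex) set \<Rightarrow> ('a \<Rightarrow> complex) \<Rightarrow> 'a \<Rightarrow> complex" where
  "orth_proj ip W h = (THE g. g \<in> W \<and> (\<forall>v\<in>W. ip (h - g) v = 0))"

definition Phi_star ::
  "'a inner_fun \<Rightarrow> (nat \<Rightarrow> ('a \<Rightarrow> complex) set) \<Rightarrow> (nat \<Rightarrow> 'a \<Rightarrow> complex) set" where
  "Phi_star ip V = {\<mu>. (\<forall>n. \<mu> n \<in> V n) \<and> (\<forall>n. orth_proj ip (V n) (\<mu> (Suc n)) = \<mu> n)}"

definition Phi_star_top ::
  "('a \<Rightarrow> complex) set \<Rightarrow> 'a inner_fun \<Rightarrow> (nat \<Rightarrow> ('a \<Rightarrow> complex) set) \<Rightarrow>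
   (nat \<Rightarrow> 'a \<Rightarrow> complex) topology" where
  "Phi_star_top H ip V =
     subtopology (product_topology (\<lambda>n. subtopology (htop H ip) (V n)) UNIV) (Phi_star ip V)"

definition pairing :: "'a inner_fun \<Rightarrow> ('a \<Rightarrow> complex) \<Rightarrow> (nat \<Rightarrow> 'a \<Rightarrow> complex) \<Rightarrow> complex" where
  "pairing ip h \<mu> = lim (\<lambda>n. ip h (\<mu> n))"

text \<open>Extensionality makes the operator unique as a function on the whole type.\<close>

definition koopman_ext ::
  "'a set \<Rightarrow> ('a \<Rightarrow> complex) set \<Rightarrow> 'a inner_fun \<Rightarrow> ('a \<Rightarrow> 'a) \<Rightarrow> (nat \<Rightarrow> ('a \<Rightarrow> complex) set) \<Rightarrow>
   (nat \<Rightarrow> 'a \<Rightarrow> complex) \<Rightarrow> nat \<Rightarrow> 'a \<Rightarrow> complex" where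
  "koopman_ext \<Omega> H ip f V =
     (THE T. T \<in> extensional (Phi_star ip V) \<and>
        cont_linear_op cscale_seq (Phi_star_top H ip V) T \<and>
        (\<forall>g\<in>Phi V. \<forall>\<mu>\<in>Phi_star ip V.
           pairing ip g (T \<mu>) = pairing ip (koopman_adj \<Omega> H ip f g) \<mu>))"

end

theory Submission
  imports Defs "HOL-Computational_Algebra.Fundamental_Theorem_Algebra"
begin

text \<open>Differentiating \<open>h \<circ> f\<close> at a fixed point \<open>p\<close> of \<open>f\<close> only involves derivatives of \<open>h\<close> at \<open>p\<close> of at most the
  same order, so the adjoint of the Koopman operator maps each finite-dimensional space
  \<open>V\<^bsub>\<Lambda>,n\<^esub>\<close> to itself. Its generalized eigenvectors in \<open>V\<^bsub>\<Lambda>,n\<^esub>\<close> span this space, so a basis consisting of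
  generalized eigenvectors can be extended from each \<open>V\<^bsub>\<Lambda>,n\<^esub>\<close> to the next one. The operator \<open>S\<close> multiplies
  each basis vector by its eigenvalue, and \<open>N\<close> is the rest. Finally \<open>\<Phi>\<^sup>*\<close> is the (conjugate) algebraic dual
  of \<open>\<Phi>\<close>, and both parts of the extended operator are obtained by transposition; all continuity
  statements reduce to the finite-dimensional spaces.\<close>

section \<open>Iterated partial derivatives\<close>

text \<open>\<open>koopman_adj\<close> is a possibly unbounded operator given by a definite
  description, so nothing can be said about it before its values are exhibited. On V_n they can be:
  a kernel derivative at p represents the functional that takes h to a partial derivative of h at p,
  and its adjoint value is the representer of the same derivative of h o f at p. In the
  decomposition the difficulty is that n is unbounded: one operator S and one numbering must serve
  all V_n, and Phi need not have a minimal polynomial. Nested bases settle both. That S commutes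
  with the operator is not visible on the basis; it holds because S acts as a scalar on the part of
  each generalized eigenspace inside V_n, whatever basis was chosen. The two series need no
  estimates, since tested against a fixed V_n their partial sums become stationary. Conjugates of
  eigenvalues come from the pairing, conjugate-linear in its second argument. Analyticity of the
  kernel functions shows that the numbering never stops when H is infinite-dimensional and there is
  at least one fixed point in \<Lambda>.\<close>

lemma has_derivative_frechet:
  "h differentiable (at x) \<Longrightarrow> (h has_derivative frechet_derivative h (at x)) (at x)"
  by (simp add: frechet_derivative_works)

lemma partial_eqI:
  "(h has_derivative h') (at x) \<Longrightarrow> partial i h x = h' (axis i 1)"
  unfolding partial_def by (metis frechet_derivative_at)

lemma differentiable_transform_open:
  assumes "g differentiable (at x)" "open \<Omega>" "x \<in> \<Omega>" "\<And>y. y \<in> \<Omega> \<Longrightarrow> g y = h y"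
  shows "h differentiable (at x)"
  using assms has_derivative_transform_within_open unfolding differentiable_def by blast

text \<open>Differentiability is not at stake: \<open>frechet_derivative\<close> is a choice among
  the derivatives at x, and two functions that agree near x have the same derivatives there, so the
  choices coincide.\<close>

lemma partial_cong_open:
  assumes "open \<Omega>" "x \<in> \<Omega>" "\<And>y. y \<in> \<Omega> \<Longrightarrow> g y = h y"
  shows "partial i g x = partial i h x"
proof -
  have "(g has_derivative D) (at x) \<longleftrightarrow> (h has_derivative D) (at x)" for D
    using assms by (auto elim!: has_derivative_transform_within_open)
  then show ?thesis
    by (simp add: partial_def frechet_derivative_def)
qed

lemma partials_simps [simp]:
  "partials [] h = h" "partials (i # is) h = partial i (partials is h)"
  by (simp_all add: partials_def)

lemma partials_append: "partials (is @ js) h = partials is (partials js h)"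
  by (simp add: partials_def)

lemma partials_cong_open:
  assumes "open \<Omega>" "x \<in> \<Omega>" "\<And>y. y \<in> \<Omega> \<Longrightarrow> g y = h y"
  shows "partials is g x = partials is h x"
  using assms(2)
proof (induction "is" arbitrary: x)
  case (Cons i "is")
  then show ?case
    using partial_cong_open[OF assms(1), of x "partials is g" "partials is h"] by simp
qed (use assms in simp)

lemma smooth_on_partials: "smooth_on \<Omega> h \<Longrightarrow> smooth_on \<Omega> (partials is h)"
  by (simp add: smooth_on_def flip: partials_append)

lemma smooth_on_partial: "smooth_on \<Omega> h \<Longrightarrow> smooth_on \<Omega> (partial i h)"
  using smooth_on_partials[of \<Omega> h "[i]"] by simp

lemma smooth_on_differentiable: "smooth_on \<Omega> h \<Longrightarrow> x \<in> \<Omega> \<Longrightarrow> h differentiable (at x)"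
  unfolding smooth_on_def by (metis partials_simps(1))

text \<open>Any class of differentiable functions that is closed under partial derivatives, up to
  equality on \<Omega>, consists of smooth functions. This proves smoothness without a formula for
  the iterated derivatives.\<close>

lemma smooth_onI_closed:
  assumes "open \<Omega>" "P h"
    and diff: "\<And>g x. P g \<Longrightarrow> x \<in> \<Omega> \<Longrightarrow> g differentiable (at x)"
    and closed: "\<And>g i. P g \<Longrightarrow> \<exists>g'. P g' \<and> (\<forall>x\<in>\<Omega>. partial i g x = g' x)"
  shows "smooth_on \<Omega> h"
proof -
  have "\<exists>g. P g \<and> (\<forall>x\<in>\<Omega>. partials is h x = g x)" for "is"
  proof (induction "is")
    case (Cons i "is")
    then obtain g where g: "P g" "\<forall>x\<in>\<Omega>. partials is h x = g x" by blast
    obtain g' where "P g'" "\<forall>x\<in>\<Omega>. partial i g x = g' x" using closed[OF g(1)] by blast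
    then show ?case
      using partial_cong_open[OF assms(1)] g by (metis partials_simps(2))
  qed (use assms in auto)
  then show ?thesis
    unfolding smooth_on_def using diff differentiable_transform_open[OF _ assms(1)] by metis
qed

lemma partial_bounded_linear:
  assumes "bounded_linear L" "h differentiable (at x)"
  shows "partial i (\<lambda>x. L (h x)) x = L (partial i h x)"
  unfolding partial_def[of i h]
  by (rule partial_eqI bounded_linear.has_derivative[OF assms(1)] has_derivative_frechet assms)+

lemma partials_bounded_linear:
  assumes L: "bounded_linear L" and o: "open \<Omega>" and h: "smooth_on \<Omega> h" and x: "x \<in> \<Omega>"
  shows "partials is (\<lambda>x. L (h x)) x = L (partials is h x)"
  using x
proof (induction "is" arbitrary: x)
  case (Cons i "is")
  have "partials (i # is) (\<lambda>x. L (h x)) x = partial i (\<lambda>x. L (partials is h x)) x"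
    by (simp add: partial_cong_open[OF o Cons.prems Cons.IH])
  also have "\<dots> = L (partial i (partials is h) x)"
    by (rule partial_bounded_linear[OF L]) (use h Cons.prems in \<open>simp add: smooth_on_def\<close>)
  finally show ?case by simp
qed simp

lemma bounded_linear_differentiable:
  "bounded_linear L \<Longrightarrow> h differentiable (at x) \<Longrightarrow> (\<lambda>x. L (h x)) differentiable (at x)"
  unfolding differentiable_def using bounded_linear.has_derivative by blast

lemma smooth_on_bounded_linear:
  assumes L: "bounded_linear L" and o: "open \<Omega>" and h: "smooth_on \<Omega> h"
  shows "smooth_on \<Omega> (\<lambda>x. L (h x))"
  unfolding smooth_on_def
proof (intro allI ballI)
  fix "is" x assume x: "x \<in> \<Omega>"
  have "partials is h differentiable at x" using h x by (simp add: smooth_on_def)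
  then have "(\<lambda>x. L (partials is h x)) differentiable at x"
    by (rule bounded_linear_differentiable[OF L])
  then show "partials is (\<lambda>x. L (h x)) differentiable at x"
    by (rule differentiable_transform_open[OF _ o x]) (simp add: partials_bounded_linear[OF L o h])
qed

lemma partial_add:
  assumes "g differentiable (at x)" "h differentiable (at x)"
  shows "partial i (\<lambda>x. g x + h x) x = partial i g x + partial i h x"
  using partial_eqI[OF has_derivative_add[OF assms[THEN has_derivative_frechet]]]
  by (simp add: partial_def)

lemma partials_add:
  assumes o: "open \<Omega>" and g: "smooth_on \<Omega> g" and h: "smooth_on \<Omega> h" and x: "x \<in> \<Omega>"
  shows "partials is (\<lambda>x. g x + h x) x = partials is g x + partials is h x"
  using x
proof (induction "is" arbitrary: x)
  case (Cons i "is")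
  have "partials (i # is) (\<lambda>x. g x + h x) x = partial i (\<lambda>x. partials is g x + partials is h x) x"
    by (simp add: partial_cong_open[OF o Cons.prems Cons.IH])
  also have "\<dots> = partial i (partials is g) x + partial i (partials is h) x"
    by (rule partial_add) (use g h Cons.prems in \<open>simp_all add: smooth_on_def\<close>)
  finally show ?case by simp
qed simp

lemma smooth_on_add:
  assumes o: "open \<Omega>" and g: "smooth_on \<Omega> g" and h: "smooth_on \<Omega> h"
  shows "smooth_on \<Omega> (\<lambda>x. g x + h x)"
  unfolding smooth_on_def
proof (intro allI ballI)
  fix "is" x assume x: "x \<in> \<Omega>"
  show "partials is (\<lambda>x. g x + h x) differentiable at x"
    by (rule differentiable_transform_open[where g = "\<lambda>x. partials is g x + partials is h x", OF _ o x])
      (use g h x in \<open>auto simp: partials_add[OF o g h] smooth_on_def\<close>)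
qed

lemma partial_mult:
  fixes g h :: "real ^ 'd::finite \<Rightarrow> complex"
  assumes "g differentiable (at x)" "h differentiable (at x)"
  shows "partial i (\<lambda>x. g x * h x) x = partial i g x * h x + g x * partial i h x"
  using partial_eqI[OF has_derivative_mult[OF assms[THEN has_derivative_frechet]]]
  by (simp add: partial_def)

text \<open>The product rule turns one product into a sum of two, so sums have to be included for
  the class to be closed under partial derivatives.\<close>

inductive sum_of_smooth_products :: "(real ^ 'd::finite) set \<Rightarrow> (real ^ 'd \<Rightarrow> complex) \<Rightarrow> bool"
  for \<Omega> where
  prod: "smooth_on \<Omega> a \<Longrightarrow> smooth_on \<Omega> b \<Longrightarrow> sum_of_smooth_products \<Omega> (\<lambda>x. a x * b x)"
| add: "sum_of_smooth_products \<Omega> g \<Longrightarrow> sum_of_smooth_products \<Omega> h \<Longrightarrow>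
    sum_of_smooth_products \<Omega> (\<lambda>x. g x + h x)"

lemma sum_of_smooth_products_partial:
  "sum_of_smooth_products \<Omega> g \<Longrightarrow>
    (\<forall>x\<in>\<Omega>. g differentiable (at x)) \<and>
    (\<exists>g'. sum_of_smooth_products \<Omega> g' \<and> (\<forall>x\<in>\<Omega>. partial i g x = g' x))"
proof (induction rule: sum_of_smooth_products.induct)
  case (prod a b)
  have d: "\<forall>x\<in>\<Omega>. a differentiable (at x)" "\<forall>x\<in>\<Omega>. b differentiable (at x)"
    using prod smooth_on_differentiable by blast+
  let ?g = "\<lambda>x. partial i a x * b x + a x * partial i b x"
  have "sum_of_smooth_products \<Omega> ?g"
    by (intro sum_of_smooth_products.intros smooth_on_partial prod)
  moreover have "\<forall>x\<in>\<Omega>. partial i (\<lambda>x. a x * b x) x = ?g x"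
    using d partial_mult by blast
  ultimately show ?case
    using d by (auto intro: differentiable_mult)
next
  case (add g h)
  then obtain g' h' where
    *: "sum_of_smooth_products \<Omega> g'" "sum_of_smooth_products \<Omega> h'"
      "\<forall>x\<in>\<Omega>. partial i g x = g' x" "\<forall>x\<in>\<Omega>. partial i h x = h' x" by blast
  have "sum_of_smooth_products \<Omega> (\<lambda>x. g' x + h' x)"
    using * by (intro sum_of_smooth_products.add)
  moreover have "\<forall>x\<in>\<Omega>. partial i (\<lambda>x. g x + h x) x = g' x + h' x"
    using add.IH *(3,4) by (simp add: partial_add)
  ultimately show ?case
    using add.IH by (auto intro: differentiable_add)
qed

lemma smooth_on_mult:
  fixes g h :: "real ^ 'd::finite \<Rightarrow> complex"
  assumes "open \<Omega>" "smooth_on \<Omega> g" "smooth_on \<Omega> h"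
  shows "smooth_on \<Omega> (\<lambda>x. g x * h x)"
  by (rule smooth_onI_closed[where P = "sum_of_smooth_products \<Omega>", OF assms(1)
        sum_of_smooth_products.prod[OF assms(2,3)]])
    (use sum_of_smooth_products_partial in blast)+

section \<open>Symmetry of mixed partial derivatives\<close>

lemma second_difference_limit:
  fixes \<phi> :: "real ^ 'd::finite \<Rightarrow> real"
  assumes o: "open \<Omega>" and x: "x \<in> \<Omega>" and d: "\<And>y. y \<in> \<Omega> \<Longrightarrow> \<phi> differentiable (at y)"
    and d2: "partial i \<phi> differentiable (at x)"
  shows "((\<lambda>t. (\<phi> (x + t *\<^sub>R axis i 1 + t *\<^sub>R axis j 1) - \<phi> (x + t *\<^sub>R axis i 1) -
      \<phi> (x + t *\<^sub>R axis j 1) + \<phi> x) / t\<^sup>2) \<longlongrightarrow> partial j (partial i \<phi>) x) (at_right 0)"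
proof (rule tendstoI)
  fix e :: real assume e: "e > 0"
  define L where "L = frechet_derivative (partial i \<phi>) (at x)"
  define a where "a = (axis i 1 :: real ^ 'd)"
  define b where "b = (axis j 1 :: real ^ 'd)"
  have na: "norm a = 1" "norm b = 1" by (simp_all add: a_def b_def norm_axis_1)
  have L: "(partial i \<phi> has_derivative L) (at x)" unfolding L_def by (rule has_derivative_frechet[OF d2])
  have linL: "linear L" using L has_derivative_linear by blast
  obtain \<delta> where \<delta>: "\<delta> > 0"
    "\<And>y. norm (y - x) < \<delta> \<Longrightarrow> \<bar>partial i \<phi> y - partial i \<phi> x - L (y - x)\<bar> \<le> e/4 * norm (y - x)"
    using has_derivative_within_alt[THEN iffD1, OF L] e by (auto elim!: allE[of _ "e/4"])
  obtain \<rho> where \<rho>: "\<rho> > 0" "ball x \<rho> \<subseteq> \<Omega>" using o x openE by blast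
  \<comment> \<open>Halved because the far corner of the parallelogram, x + t a + t b, is only known
    to lie within 2 t of x.\<close>
  define s where "s = min \<delta> \<rho> / 2"
  have s: "s > 0" using \<delta> \<rho> by (simp add: s_def)
  have main: "\<bar>(\<phi> (x + t *\<^sub>R a + t *\<^sub>R b) - \<phi> (x + t *\<^sub>R a) - \<phi> (x + t *\<^sub>R b) + \<phi> x) / t\<^sup>2 - L b\<bar> < e"
    if t: "0 < t" "t < s" for t
  proof -
    \<comment> \<open>The second difference is \<psi> t - \<psi> 0. The mean value theorem in u
      turns it into a difference of two values of \<open>partial i \<phi>\<close>, to which
      differentiability at the single point x applies.\<close>
    define \<psi> where "\<psi> u = \<phi> (x + u *\<^sub>R a + t *\<^sub>R b) - \<phi> (x + u *\<^sub>R a)" for u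
    have nb: "norm (u *\<^sub>R a + t *\<^sub>R b) < min \<delta> \<rho>" "norm (u *\<^sub>R a) < min \<delta> \<rho>"
      "norm (u *\<^sub>R a + t *\<^sub>R b) \<le> 2 * t" "norm (u *\<^sub>R a) \<le> t"
      if "0 \<le> u" "u \<le> t" for u
    proof -
      have "norm (u *\<^sub>R a + t *\<^sub>R b) \<le> u + t"
        using norm_triangle_ineq[of "u *\<^sub>R a" "t *\<^sub>R b"] that na t by simp
      moreover have "u + t < min \<delta> \<rho>" using t that unfolding s_def by linarith
      ultimately show "norm (u *\<^sub>R a + t *\<^sub>R b) < min \<delta> \<rho>" "norm (u *\<^sub>R a) < min \<delta> \<rho>"
      "norm (u *\<^sub>R a + t *\<^sub>R b) \<le> 2 * t" "norm (u *\<^sub>R a) \<le> t"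
        using na that t by auto
    qed
    have der: "(\<psi> has_derivative (\<lambda>h. h * (partial i \<phi> (x + u *\<^sub>R a + t *\<^sub>R b) - partial i \<phi> (x + u *\<^sub>R a)))) (at u)"
      if "0 \<le> u" "u \<le> t" for u
    proof -
      have in\<Omega>: "x + u *\<^sub>R a + t *\<^sub>R b \<in> \<Omega>" "x + u *\<^sub>R a \<in> \<Omega>"
        using nb[OF that] \<rho>(2) by (auto simp: subset_iff dist_norm algebra_simps norm_minus_commute)
      have D1: "((\<lambda>u. \<phi> (x + u *\<^sub>R a + t *\<^sub>R b)) has_derivative
          (\<lambda>h. frechet_derivative \<phi> (at (x + u *\<^sub>R a + t *\<^sub>R b)) (h *\<^sub>R a))) (at u)"
        by (rule has_derivative_compose[where f = "\<lambda>u. x + u *\<^sub>R a + t *\<^sub>R b" and g = \<phi>,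
            OF _ has_derivative_frechet[OF d[OF in\<Omega>(1)]]])
          (auto intro!: derivative_eq_intros)
      have D2: "((\<lambda>u. \<phi> (x + u *\<^sub>R a)) has_derivative
          (\<lambda>h. frechet_derivative \<phi> (at (x + u *\<^sub>R a)) (h *\<^sub>R a))) (at u)"
        by (rule has_derivative_compose[where f = "\<lambda>u. x + u *\<^sub>R a" and g = \<phi>,
            OF _ has_derivative_frechet[OF d[OF in\<Omega>(2)]]])
          (auto intro!: derivative_eq_intros)
      have lin: "frechet_derivative \<phi> (at y) (h *\<^sub>R a) = h * partial i \<phi> y" if "y \<in> \<Omega>" for y h
        using linear_cmul[OF linear_frechet_derivative[OF d[OF that]]] by (simp add: partial_def a_def)
      show ?thesis
        unfolding \<psi>_def using has_derivative_diff[OF D1 D2]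
        by (simp only: lin[OF in\<Omega>(1)] lin[OF in\<Omega>(2)] right_diff_distrib)
    qed
    obtain \<xi> where \<xi>: "0 < \<xi>" "\<xi> < t"
      "\<psi> t - \<psi> 0 = (t - 0) * (partial i \<phi> (x + \<xi> *\<^sub>R a + t *\<^sub>R b) - partial i \<phi> (x + \<xi> *\<^sub>R a))"
    proof -
      have "continuous_on {0..t} \<psi>"
        by (intro continuous_at_imp_continuous_on ballI) (use der has_derivative_continuous in fastforce)
      then show ?thesis
        by (rule mvt[OF t(1), of \<psi>, OF _ der]) (auto intro: that)
    qed
    \<comment> \<open>The remainders of the linear approximation at the two points. In their
      difference the common term L (\<xi> a) cancels, leaving t L b, the expected main term.\<close>
    define P where "P = partial i \<phi> (x + \<xi> *\<^sub>R a + t *\<^sub>R b) - partial i \<phi> x - L (\<xi> *\<^sub>R a + t *\<^sub>R b)"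
    define Q where "Q = partial i \<phi> (x + \<xi> *\<^sub>R a) - partial i \<phi> x - L (\<xi> *\<^sub>R a)"
    have "\<bar>P\<bar> \<le> e/4 * norm (\<xi> *\<^sub>R a + t *\<^sub>R b)"
      unfolding P_def using \<delta>(2)[of "x + \<xi> *\<^sub>R a + t *\<^sub>R b"] nb[of \<xi>] \<xi> by (simp add: add.assoc)
    also have "\<dots> \<le> e/4 * (2*t)" by (intro mult_left_mono) (use nb[of \<xi>] \<xi> e in auto)
    finally have P: "\<bar>P\<bar> \<le> e/4 * (2*t)" .
    have "\<bar>Q\<bar> \<le> e/4 * norm (\<xi> *\<^sub>R a)"
      unfolding Q_def using \<delta>(2)[of "x + \<xi> *\<^sub>R a"] nb[of \<xi>] \<xi> by simp
    also have "\<dots> \<le> e/4 * t" by (intro mult_left_mono) (use nb[of \<xi>] \<xi> e in auto)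
    finally have Q: "\<bar>Q\<bar> \<le> e/4 * t" .
    have "partial i \<phi> (x + \<xi> *\<^sub>R a + t *\<^sub>R b) - partial i \<phi> (x + \<xi> *\<^sub>R a) = t * L b + (P - Q)"
      unfolding P_def Q_def by (simp add: linear_add[OF linL] linear_cmul[OF linL])
    then have "\<psi> t - \<psi> 0 = t * (t * L b + (P - Q))" using \<xi> by simp
    then have "(\<psi> t - \<psi> 0) / t\<^sup>2 - L b = (P - Q) / t"
      using t by (simp add: divide_simps power2_eq_square)
    moreover have "\<bar>(P - Q) / t\<bar> < e"
    proof -
      \<comment> \<open>The two points are within 2 t and t of x, so the tolerance e/4 chosen for
        the remainder adds up to 3/4 of e t, strictly below e t.\<close>
      have "\<bar>P - Q\<bar> \<le> e/4 * (2*t) + e/4 * t" using P Q by linarith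
      also have "\<dots> < e * t" using e t by (simp add: field_simps)
      finally show ?thesis using t by (simp add: field_simps)
    qed
    ultimately show ?thesis by (simp add: \<psi>_def algebra_simps)
  qed
  have "eventually (\<lambda>t. t \<in> {0<..<s}) (at_right 0)"
    by (rule eventually_at_right_real[OF s])
  then show "\<forall>\<^sub>F t in at_right 0. dist ((\<phi> (x + t *\<^sub>R axis i 1 + t *\<^sub>R axis j 1) - \<phi> (x + t *\<^sub>R axis i 1) -
      \<phi> (x + t *\<^sub>R axis j 1) + \<phi> x) / t\<^sup>2) (partial j (partial i \<phi>) x) < e"
  proof (rule eventually_mono)
    fix t assume "t \<in> {0<..<s}"
    then show "dist ((\<phi> (x + t *\<^sub>R axis i 1 + t *\<^sub>R axis j 1) - \<phi> (x + t *\<^sub>R axis i 1) -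
      \<phi> (x + t *\<^sub>R axis j 1) + \<phi> x) / t\<^sup>2) (partial j (partial i \<phi>) x) < e"
      using main[of t] unfolding dist_real_def a_def b_def L_def partial_def[of j] by simp
  qed
qed

text \<open>The second difference quotient is symmetric in i and j, and limits are unique.\<close>

lemma partial_commute_real:
  fixes \<phi> :: "real ^ 'd::finite \<Rightarrow> real"
  assumes o: "open \<Omega>" and x: "x \<in> \<Omega>" and s: "smooth_on \<Omega> \<phi>"
  shows "partial i (partial j \<phi>) x = partial j (partial i \<phi>) x"
proof -
  have d: "\<And>y. y \<in> \<Omega> \<Longrightarrow> \<phi> differentiable (at y)" "\<And>k. partial k \<phi> differentiable (at x)"
    using s x smooth_on_differentiable smooth_on_partial by blast+
  have swap: "x + t *\<^sub>R axis j 1 + t *\<^sub>R axis i 1 = x + t *\<^sub>R axis i 1 + t *\<^sub>R axis j 1"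
    "p - \<phi> (x + t *\<^sub>R axis j 1) - \<phi> (x + t *\<^sub>R axis i 1) + q =
      p - \<phi> (x + t *\<^sub>R axis i 1) - \<phi> (x + t *\<^sub>R axis j 1) + q" for t p q
    by (simp_all add: ac_simps)
  show ?thesis
    by (rule tendsto_unique[OF trivial_limit_at_right_real
        second_difference_limit[OF o x d, of j i, unfolded swap]
        second_difference_limit[OF o x d, of i j]])
qed

text \<open>The mean value theorem behind the real case forces a detour through real and imaginary
  parts.\<close>

lemma partial_commute:
  fixes h :: "real ^ 'd::finite \<Rightarrow> complex"
  assumes o: "open \<Omega>" and x: "x \<in> \<Omega>" and s: "smooth_on \<Omega> h"
  shows "partial i (partial j h) x = partial j (partial i h) x"
proof (rule complex_eqI)
  have "L (partial i (partial j h) x) = L (partial j (partial i h) x)"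
    if L: "bounded_linear L" for L :: "complex \<Rightarrow> real"
    by (simp only: partial_commute_real[OF o x smooth_on_bounded_linear[OF L o s], of i j]
      partials_bounded_linear[OF L o s x, of "[i, j]", unfolded partials_simps, symmetric]
      partials_bounded_linear[OF L o s x, of "[j, i]", unfolded partials_simps, symmetric])
  from this[OF bounded_linear_Re] this[OF bounded_linear_Im]
  show "Re (partial i (partial j h) x) = Re (partial j (partial i h) x)"
    "Im (partial i (partial j h) x) = Im (partial j (partial i h) x)" .
qed

lemma partials_move:
  fixes h :: "real ^ 'd::finite \<Rightarrow> complex"
  assumes o: "open \<Omega>" and x: "x \<in> \<Omega>" and s: "smooth_on \<Omega> h"
  shows "partials (is @ [i]) h x = partials (i # is) h x"
  using x
proof (induction "is" arbitrary: x)
  case (Cons j "is")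
  have "partials ((j # is) @ [i]) h x = partial j (partials (is @ [i]) h) x" by simp
  also have "\<dots> = partial j (partials (i # is) h) x"
    by (rule partial_cong_open[OF o Cons.prems Cons.IH])
  also have "\<dots> = partials (i # j # is) h x"
    using partial_commute[OF o Cons.prems smooth_on_partials[OF s], of j i] by simp
  finally show ?case .
qed simp

text \<open>The head of the first list is located in the second list and moved to the front. The
  induction hypothesis is then differentiated once more, so it must be available at all points of
  \<Omega> and not only at x.\<close>

lemma partials_mset:
  fixes h :: "real ^ 'd::finite \<Rightarrow> complex"
  assumes o: "open \<Omega>" and x: "x \<in> \<Omega>" and s: "smooth_on \<Omega> h" and m: "mset is = mset js"
  shows "partials is h x = partials js h x"
  using x m
proof (induction "is" arbitrary: js x)
  case (Cons i "is")
  have "i \<in> set js" using Cons.prems by (metis list.set_intros(1) set_mset_mset)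
  then obtain as bs where js: "js = as @ i # bs" by (meson split_list)
  have m: "mset is = mset (as @ bs)" using Cons.prems js by simp
  have "partials js h x = partials (as @ [i]) (partials bs h) x"
    using js by (simp flip: partials_append)
  also have "\<dots> = partials (i # as) (partials bs h) x"
    by (rule partials_move[OF o Cons.prems(1) smooth_on_partials[OF s]])
  also have "\<dots> = partial i (partials (as @ bs) h) x" by (simp add: partials_append)
  also have "\<dots> = partial i (partials is h) x"
    by (rule partial_cong_open[OF o Cons.prems(1)]) (use Cons.IH m in metis)
  finally show ?case by simp
qed simp

lemma ex_count_list: "\<exists>is. \<forall>i. count_list is i = \<alpha> i" for \<alpha> :: "'d::finite \<Rightarrow> nat"
proof -
  obtain "is" where "mset is = (\<Sum>i\<in>UNIV. replicate_mset (\<alpha> i) i)" using ex_mset by blast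
  then have "count (mset is) j = \<alpha> j" for j by (simp add: count_sum)
  then show ?thesis by (metis count_mset)
qed

text \<open>Links the order of differentiation chosen inside \<open>mpartial\<close> with arbitrary
  lists, which are what induction over repeated differentiation produces.\<close>

lemma mpartial_eq_partials:
  fixes h :: "real ^ 'd::finite \<Rightarrow> complex"
  assumes "open \<Omega>" "x \<in> \<Omega>" "smooth_on \<Omega> h"
  shows "partials is h x = mpartial (count_list is) h x"
  unfolding mpartial_def
proof (rule partials_mset[OF assms])
  have "\<forall>i. count_list (SOME js. \<forall>i. count_list js i = count_list is i) i = count_list is i"
    by (rule someI[of _ "is"]) simp
  then show "mset is = mset (SOME js. \<forall>i. count_list js i = count_list is i)"
    by (intro multiset_eqI) (simp add: count_mset)
qed

lemma sum_count_list: "sum (count_list is) UNIV = length is" for "is" :: "'d::finite list"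
proof (induction "is")
  case (Cons a "is")
  have "count_list (a # is) = (\<lambda>x. (if x = a then 1 else 0) + count_list is x)" by auto
  then show ?case using Cons by (simp add: sum.distrib sum.delta)
qed simp

lemma ex_mpartial_eq_partials:
  "\<exists>is. length is = sum \<alpha> UNIV \<and>
    (mpartial \<alpha> :: (real ^ 'd::finite \<Rightarrow> 'b::real_normed_vector) \<Rightarrow> _) = partials is"
proof -
  define js where "js = (SOME is. \<forall>i. count_list is i = \<alpha> i)"
  have "\<forall>i. count_list js i = \<alpha> i"
    unfolding js_def by (rule someI_ex[OF ex_count_list])
  then have "count_list js = \<alpha>" by auto
  then show ?thesis
    using sum_count_list[of js] by (intro exI[of _ js]) (auto simp: mpartial_def js_def)
qed

lemma finite_multi_indices: "finite {\<alpha> :: 'd::finite \<Rightarrow> nat. sum \<alpha> UNIV \<le> n}"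
proof (rule finite_subset)
  show "{\<alpha> :: 'd \<Rightarrow> nat. sum \<alpha> UNIV \<le> n} \<subseteq> PiE UNIV (\<lambda>_. {..n})"
  proof
    fix \<alpha> :: "'d \<Rightarrow> nat" assume "\<alpha> \<in> {\<alpha>. sum \<alpha> UNIV \<le> n}"
    then have "\<alpha> i \<le> n" for i using member_le_sum[of i UNIV \<alpha>] by simp
    then show "\<alpha> \<in> PiE UNIV (\<lambda>_. {..n})" by auto
  qed
qed (simp add: finite_PiE)

section \<open>Generalized eigenvectors adapted to a filtration\<close>

text \<open>The ambient space may have infinite dimension and the operator is total on it.
  Finite-dimensional invariant subspaces appear as hypotheses of single lemmas, so that one operator
  can be treated on all members of a filtration.\<close>

locale complex_operator = vector_space sc
  for sc :: "complex \<Rightarrow> 'v::ab_group_add \<Rightarrow> 'v" (infixr \<open>*\<^sub>C\<close> 75) +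
  fixes A :: "'v \<Rightarrow> 'v"
  assumes lin: "Vector_Spaces.linear sc sc A"
begin

sublocale A: Vector_Spaces.linear sc sc A by (rule lin)

sublocale vector_space_pair sc sc ..

definition shifted :: "complex \<Rightarrow> 'v \<Rightarrow> 'v" where
  "shifted \<nu> x = A x - \<nu> *\<^sub>C x"

definition gen_eigenspace :: "complex \<Rightarrow> 'v set" where
  "gen_eigenspace \<nu> = {x. \<exists>m. (shifted \<nu> ^^ m) x = 0}"

lemma linear_shifted: "Vector_Spaces.linear sc sc (shifted \<nu>)"
  by unfold_locales
    (simp_all add: shifted_def A.add A.scale scale_right_distrib scale_right_diff_distrib mult.commute)

lemma linear_shifted_pow: "Vector_Spaces.linear sc sc (shifted \<nu> ^^ m)"
proof (induction m)
  case 0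
  show ?case using linear_id by (simp add: id_def)
next
  case (Suc m)
  show ?case using Vector_Spaces.linear_compose[OF Suc linear_shifted] by (simp add: comp_def)
qed

lemmas shifted_pow_simps = linear_add[OF linear_shifted_pow] linear_scale[OF linear_shifted_pow]
  linear_0[OF linear_shifted_pow] linear_sum[OF linear_shifted_pow]

lemma shifted_commute: "shifted \<nu> (shifted \<mu> x) = shifted \<mu> (shifted \<nu> x)"
  by (simp add: shifted_def A.diff A.scale scale_right_diff_distrib mult.commute)

lemma shifted_pow_commute: "(shifted \<nu> ^^ m) (shifted \<mu> x) = shifted \<mu> ((shifted \<nu> ^^ m) x)"
  by (induction m) (simp_all add: shifted_commute)

lemma subspace_gen_eigenspace: "subspace (gen_eigenspace \<nu>)"
proof (rule subspaceI)
  fix x y assume "x \<in> gen_eigenspace \<nu>" "y \<in> gen_eigenspace \<nu>"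
  then obtain m n where mn: "(shifted \<nu> ^^ m) x = 0" "(shifted \<nu> ^^ n) y = 0"
    by (auto simp: gen_eigenspace_def)
  have "(shifted \<nu> ^^ (m + n)) (x + y) = (shifted \<nu> ^^ (n + m)) x + (shifted \<nu> ^^ (m + n)) y"
    by (simp only: shifted_pow_simps add.commute[of m n])
  also have "\<dots> = 0"
    by (simp only: funpow_add comp_apply mn shifted_pow_simps add_0)
  finally show "x + y \<in> gen_eigenspace \<nu>"
    unfolding gen_eigenspace_def by blast
next
  fix c x assume "x \<in> gen_eigenspace \<nu>"
  then show "c *\<^sub>C x \<in> gen_eigenspace \<nu>"
    by (auto simp: gen_eigenspace_def shifted_pow_simps)
qed (auto simp: gen_eigenspace_def shifted_pow_simps)

lemma gen_eigenspace_shifted: "x \<in> gen_eigenspace \<nu> \<Longrightarrow> shifted \<mu> x \<in> gen_eigenspace \<nu>"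
proof -
  assume "x \<in> gen_eigenspace \<nu>"
  then obtain m where "(shifted \<nu> ^^ m) x = 0" by (auto simp: gen_eigenspace_def)
  then have "(shifted \<nu> ^^ m) (shifted \<mu> x) = 0"
    by (simp add: shifted_pow_commute linear_0[OF linear_shifted])
  then show ?thesis unfolding gen_eigenspace_def by blast
qed

lemma gen_eigenspace_shifted_iff: "shifted \<nu> x \<in> gen_eigenspace \<nu> \<longleftrightarrow> x \<in> gen_eigenspace \<nu>"
proof
  assume "shifted \<nu> x \<in> gen_eigenspace \<nu>"
  then obtain m where "(shifted \<nu> ^^ m) (shifted \<nu> x) = 0" by (auto simp: gen_eigenspace_def)
  then have "(shifted \<nu> ^^ Suc m) x = 0" by (simp add: funpow_swap1)
  then show "x \<in> gen_eigenspace \<nu>" unfolding gen_eigenspace_def by blast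
qed (rule gen_eigenspace_shifted)

lemma shifted_eigenvalue_change: "shifted \<mu> x = shifted \<nu> x + (\<nu> - \<mu>) *\<^sub>C x"
  by (simp add: shifted_def scale_left_diff_distrib)

text \<open>On the kernel of A - \<mu> the operator A - \<nu> is multiplication by the nonzero
  number \<mu> - \<nu>, and no power of that is nilpotent.\<close>

lemma shifted_inj_gen_eigenspace:
  assumes "x \<in> gen_eigenspace \<nu>" "\<mu> \<noteq> \<nu>" "shifted \<mu> x = 0"
  shows "x = 0"
proof -
  obtain m where m: "(shifted \<nu> ^^ m) x = 0" using assms by (auto simp: gen_eigenspace_def)
  have s: "shifted \<nu> x = (\<mu> - \<nu>) *\<^sub>C x"
    using shifted_eigenvalue_change[of \<nu> x \<mu>] assms(3) by simp
  have "(shifted \<nu> ^^ m) x = ((\<mu> - \<nu>) ^ m) *\<^sub>C x"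
    by (induction m) (simp_all add: linear_scale[OF linear_shifted] s mult.commute)
  then show ?thesis using m assms(2) by (simp add: scale_eq_0_iff)
qed

lemma shifted_pow_inj_gen_eigenspace:
  assumes "x \<in> gen_eigenspace \<nu>" "\<mu> \<noteq> \<nu>" "(shifted \<mu> ^^ m) x = 0"
  shows "x = 0"
  using assms(3,1)
proof (induction m arbitrary: x)
  case (Suc m)
  have "shifted \<mu> x = 0"
    by (rule Suc.IH) (use Suc.prems gen_eigenspace_shifted in \<open>simp_all add: funpow_swap1\<close>)
  then show ?case using shifted_inj_gen_eigenspace[OF Suc.prems(2) assms(2)] by blast
qed simp

text \<open>A power of A - \<mu> that annihilates the component for \<mu> shortens the sum by one
  term and is injective on the remaining generalized eigenspaces.\<close>

lemma gen_eigenspaces_direct: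
  assumes "finite M" "\<And>\<nu>. \<nu> \<in> M \<Longrightarrow> g \<nu> \<in> gen_eigenspace \<nu>" "(\<Sum>\<nu>\<in>M. g \<nu>) = 0"
  shows "\<forall>\<nu>\<in>M. g \<nu> = 0"
  using assms
proof (induction M arbitrary: g rule: finite_induct)
  case (insert \<mu> M)
  obtain m where m: "(shifted \<mu> ^^ m) (g \<mu>) = 0" using insert.prems(1)[of \<mu>] by (auto simp: gen_eigenspace_def)
  have mem: "(shifted \<mu> ^^ m) x \<in> gen_eigenspace \<nu>" if "x \<in> gen_eigenspace \<nu>" for \<nu> x
    by (induction m) (use that gen_eigenspace_shifted in auto)
  have "(\<Sum>\<nu>\<in>M. (shifted \<mu> ^^ m) (g \<nu>)) = (shifted \<mu> ^^ m) (\<Sum>\<nu>\<in>insert \<mu> M. g \<nu>)"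
    using insert.hyps m by (simp add: shifted_pow_simps)
  also have "\<dots> = 0" using insert.prems by (simp add: shifted_pow_simps)
  finally have "\<forall>\<nu>\<in>M. (shifted \<mu> ^^ m) (g \<nu>) = 0"
    using insert.IH[of "\<lambda>\<nu>. (shifted \<mu> ^^ m) (g \<nu>)"] insert.prems mem by blast
  then have "\<forall>\<nu>\<in>M. g \<nu> = 0"
    using shifted_pow_inj_gen_eigenspace insert.prems(1) insert.hyps(2) by (metis insertCI)
  then show ?case using insert.prems(2) insert.hyps by simp
qed simp

text \<open>On a generalized eigenspace for \<open>\<nu> \<noteq> \<mu>\<close> the operator \<open>A - \<mu>\<close> is inverted by a finite
  Neumann series; here it is unfolded as an induction on the nilpotency order.\<close>

lemma shifted_surj_gen_eigenspace:
  assumes "subspace V" "\<And>x. x \<in> V \<Longrightarrow> A x \<in> V" "\<mu> \<noteq> \<nu>"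
    "y \<in> gen_eigenspace \<nu> \<inter> V"
  shows "\<exists>x\<in>gen_eigenspace \<nu> \<inter> V. shifted \<mu> x = y"
proof -
  obtain m where "(shifted \<nu> ^^ m) y = 0" using assms by (auto simp: gen_eigenspace_def)
  then show ?thesis using assms(4)
  proof (induction m arbitrary: y)
    case 0
    then have "y = 0" by simp
    then show ?case using assms(1) subspace_gen_eigenspace
      by (intro bexI[of _ 0]) (simp_all add: subspace_0 linear_0[OF linear_shifted])
  next
    case (Suc m)
    have V: "shifted \<nu> y \<in> V"
      using Suc.prems assms(1,2) by (auto simp: shifted_def intro!: subspace_diff subspace_scale)
    obtain z where z: "z \<in> gen_eigenspace \<nu> \<inter> V" "shifted \<mu> z = shifted \<nu> y"
      using Suc.IH[of "shifted \<nu> y"] Suc.prems V gen_eigenspace_shifted by (auto simp: funpow_swap1)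
    define c where "c = inverse (\<nu> - \<mu>)"
    have "shifted \<mu> (c *\<^sub>C (y - z)) = c *\<^sub>C (shifted \<mu> y - shifted \<nu> y)"
      by (simp add: linear_scale[OF linear_shifted] linear_diff[OF linear_shifted] z)
    also have "\<dots> = y"
      using assms(3) by (simp add: shifted_eigenvalue_change[of \<mu> y \<nu>] c_def)
    finally show ?case
      using Suc.prems z assms(1) subspace_gen_eigenspace
      by (intro bexI[of _ "c *\<^sub>C (y - z)"]) (auto intro!: subspace_diff subspace_scale)
  qed
qed

definition gen_eigenvectors :: "'v set" where
  "gen_eigenvectors = (\<Union>\<nu>. gen_eigenspace \<nu>)"

text \<open>The image of x under A - \<mu> can be solved for away from the eigenvalue \<mu>. The
  solution differs from x by a vector whose image lies in the generalized eigenspace for \<mu>,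
  hence by a vector of that eigenspace.\<close>

lemma shifted_in_span_gen_eigenvectors:
  assumes V: "subspace V" "\<And>x. x \<in> V \<Longrightarrow> A x \<in> V"
    and x: "x \<in> V" "shifted \<mu> x \<in> span (gen_eigenvectors \<inter> V)"
  shows "x \<in> span (gen_eigenvectors \<inter> V)"
proof -
  \<comment> \<open>Modulo \<open>gen_eigenspace \<mu>\<close> every element of the span is the
    image under A - \<mu> of another one: summands for \<mu> are absorbed, the others have preimages
    in their own generalized eigenspace.\<close>
  have "\<exists>y\<in>span (gen_eigenvectors \<inter> V). h - shifted \<mu> y \<in> gen_eigenspace \<mu> \<inter> V"
    if "h \<in> span (gen_eigenvectors \<inter> V)" for h
    using that
  proof (induction rule: span_induct_alt)
    case base
    show ?case
      by (intro bexI[of _ 0]) (simp_all add: V subspace_gen_eigenspace subspace_0 span_zero linear_0[OF linear_shifted])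
  next
    case (step c b h)
    obtain y where y: "y \<in> span (gen_eigenvectors \<inter> V)" "h - shifted \<mu> y \<in> gen_eigenspace \<mu> \<inter> V"
      using step by blast
    obtain \<nu> where \<nu>: "b \<in> gen_eigenspace \<nu> \<inter> V" using step by (auto simp: gen_eigenvectors_def)
    show ?case
    proof (cases "\<nu> = \<mu>")
      case True
      have "c *\<^sub>C b + h - shifted \<mu> y = c *\<^sub>C b + (h - shifted \<mu> y)" by simp
      then have "c *\<^sub>C b + h - shifted \<mu> y \<in> gen_eigenspace \<mu> \<inter> V"
        using \<nu> True y(2) V(1) subspace_gen_eigenspace
        by (metis Int_iff subspace_add subspace_scale)
      then show ?thesis using y(1) by blast
    next
      case False
      obtain z where z: "z \<in> gen_eigenspace \<nu> \<inter> V" "shifted \<mu> z = b"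
        using shifted_surj_gen_eigenspace[OF V, of \<mu> \<nu> b] False \<nu> by auto
      have "z \<in> span (gen_eigenvectors \<inter> V)" using z by (intro span_base) (auto simp: gen_eigenvectors_def)
      then have "c *\<^sub>C z + y \<in> span (gen_eigenvectors \<inter> V)" using y by (intro span_add span_scale)
      moreover have "c *\<^sub>C b + h - shifted \<mu> (c *\<^sub>C z + y) = h - shifted \<mu> y"
        by (simp add: linear_scale[OF linear_shifted] linear_add[OF linear_shifted] z)
      ultimately show ?thesis using y(2) by metis
    qed
  qed
  then obtain y where y: "y \<in> span (gen_eigenvectors \<inter> V)" "shifted \<mu> x - shifted \<mu> y \<in> gen_eigenspace \<mu>"
    using x(2) by blast
  have "shifted \<mu> (x - y) \<in> gen_eigenspace \<mu>" using y(2) by (simp add: linear_diff[OF linear_shifted])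
  moreover have "y \<in> V" using y(1) V(1) span_minimal[of "gen_eigenvectors \<inter> V" V] by blast
  ultimately have "x - y \<in> gen_eigenvectors \<inter> V"
    using V(1) x(1) by (auto simp: gen_eigenspace_shifted_iff gen_eigenvectors_def subspace_diff)
  then have "(x - y) + y \<in> span (gen_eigenvectors \<inter> V)" by (rule span_add[OF span_base y(1)])
  then show ?thesis by simp
qed

section \<open>Annihilating polynomials and spanning by generalized eigenvectors\<close>

definition poly_apply :: "complex poly \<Rightarrow> 'v \<Rightarrow> 'v" where
  "poly_apply p x = (\<Sum>i\<le>degree p. coeff p i *\<^sub>C (A ^^ i) x)"

lemma poly_apply_eq_sum: "degree p \<le> n \<Longrightarrow> poly_apply p x = (\<Sum>i\<le>n. coeff p i *\<^sub>C (A ^^ i) x)"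
  unfolding poly_apply_def by (rule sum.mono_neutral_left) (auto simp: coeff_eq_0)

lemma poly_apply_linear_factor: "poly_apply ([:-a, 1:] * q) x = poly_apply q (shifted a x)"
proof -
  have lp: "Vector_Spaces.linear sc sc (A ^^ i)" for i
  proof (induction i)
    case 0
    show ?case using linear_id by (simp add: id_def)
  next
    case (Suc i)
    show ?case using Vector_Spaces.linear_compose[OF Suc lin] by (simp add: comp_def)
  qed
  let ?n = "degree q"
  have 1: "[:-a, 1:] * q = pCons 0 q - smult a q" by simp
  have "degree ([:-a, 1:] * q) \<le> Suc ?n"
    using degree_mult_le[of "[:-a, 1:]" q] by simp
  then have "poly_apply ([:-a, 1:] * q) x = (\<Sum>i\<le>Suc ?n. (coeff (pCons 0 q) i - a * coeff q i) *\<^sub>C (A ^^ i) x)"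
    using poly_apply_eq_sum unfolding 1 by simp
  also have "\<dots> = (\<Sum>i\<le>Suc ?n. coeff (pCons 0 q) i *\<^sub>C (A ^^ i) x) -
      (\<Sum>i\<le>Suc ?n. (a * coeff q i) *\<^sub>C (A ^^ i) x)"
    by (simp only: scale_left_diff_distrib sum_subtractf)
  also have "(\<Sum>i\<le>Suc ?n. coeff (pCons 0 q) i *\<^sub>C (A ^^ i) x) = (\<Sum>i\<le>?n. coeff q i *\<^sub>C (A ^^ i) (A x))"
    by (subst sum.atMost_Suc_shift) (simp add: funpow_swap1)
  also have "(\<Sum>i\<le>Suc ?n. (a * coeff q i) *\<^sub>C (A ^^ i) x) = (\<Sum>i\<le>?n. coeff q i *\<^sub>C (A ^^ i) (a *\<^sub>C x))"
    by (simp add: coeff_eq_0 linear_scale[OF lp] mult.commute)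
  finally show ?thesis
    by (simp add: poly_apply_def shifted_def linear_diff[OF lp] scale_right_diff_distrib sum_subtractf)
qed

text \<open>A root a of p splits off a linear factor; the cofactor annihilates (A - a) x, which is
  then in the span by induction, and membership lifts back through A - a.\<close>

lemma annihilated_in_span_gen_eigenvectors:
  assumes V: "subspace V" "\<And>x. x \<in> V \<Longrightarrow> A x \<in> V"
  shows "p \<noteq> 0 \<Longrightarrow> x \<in> V \<Longrightarrow> poly_apply p x = 0 \<Longrightarrow> x \<in> span (gen_eigenvectors \<inter> V)"
proof (induction "degree p" arbitrary: p x rule: less_induct)
  case less
  show ?case
  proof (cases "degree p = 0")
    case True
    then have "x = 0" using less.prems by (auto simp: poly_apply_def elim!: degree_eq_zeroE)
    then show ?thesis by (simp add: span_zero)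
  next
    case False
    then obtain a where "poly p a = 0"
      using fundamental_theorem_of_algebra[of p] by (auto simp: constant_degree)
    then obtain q where q: "p = [:-a, 1:] * q" using poly_eq_0_iff_dvd by (metis dvdE)
    have "q \<noteq> 0" using less.prems q by auto
    then have "degree p = Suc (degree q)" unfolding q by (subst degree_mult_eq) simp_all
    moreover have "shifted a x \<in> V"
      using less.prems V by (auto simp: shifted_def intro!: subspace_diff subspace_scale)
    moreover have "poly_apply q (shifted a x) = 0"
      using less.prems q poly_apply_linear_factor by metis
    ultimately have "shifted a x \<in> span (gen_eigenvectors \<inter> V)"
      using less.hyps[of q "shifted a x"] \<open>q \<noteq> 0\<close> by simp
    then show ?thesis
      using shifted_in_span_gen_eigenvectors[of V x a] V less.prems(2) by blast
  qed
qed

text \<open>With n generators, the n + 1 vectors x, A x, ..., A^n x are linearly dependent, and the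
  coefficients of a dependence are those of the polynomial.\<close>

lemma ex_annihilating_poly:
  assumes V: "\<And>x. x \<in> V \<Longrightarrow> A x \<in> V" "V \<subseteq> span F" "finite F" and x: "x \<in> V"
  shows "\<exists>p. p \<noteq> 0 \<and> poly_apply p x = 0"
proof -
  define n where "n = card F"
  have it: "(A ^^ i) x \<in> V" for i by (induction i) (use V x in auto)
  have "\<exists>c. (\<exists>i\<le>n. c i \<noteq> 0) \<and> (\<Sum>i\<le>n. c i *\<^sub>C (A ^^ i) x) = 0"
  proof (cases "inj_on (\<lambda>i. (A ^^ i) x) {..n}")
    case True
    let ?T = "(\<lambda>i. (A ^^ i) x) ` {..n}"
    have "card ?T = Suc n" using True by (simp add: card_image)
    then have "dependent ?T"
      using independent_span_bound[OF assms(3), of ?T] it V(2) n_def by auto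
    then obtain u where u: "\<exists>v\<in>?T. u v \<noteq> 0" "(\<Sum>v\<in>?T. u v *\<^sub>C v) = 0"
      using dependent_finite[of ?T] by auto
    have "(\<Sum>v\<in>?T. u v *\<^sub>C v) = (\<Sum>i\<le>n. u ((A ^^ i) x) *\<^sub>C (A ^^ i) x)"
      using sum.reindex[OF True] by (simp add: comp_def)
    then have "(\<Sum>i\<le>n. u ((A ^^ i) x) *\<^sub>C (A ^^ i) x) = 0" using u(2) by simp
    moreover have "\<exists>i\<le>n. u ((A ^^ i) x) \<noteq> 0" using u(1) by auto
    ultimately show ?thesis by (intro exI[of _ "\<lambda>i. u ((A ^^ i) x)"] conjI)
  next
    case False
    then obtain i j where ij: "i \<le> n" "j \<le> n" "i \<noteq> j" "(A ^^ i) x = (A ^^ j) x"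
      by (auto simp: inj_on_def)
    \<comment> \<open>If two powers of A agree on x, the set of these vectors is too small for the
      counting argument, but the repetition itself is a dependence: the polynomial is X^i -
      X^j.\<close>
    define c where "c k = (if k = i then 1 else 0) - (if k = j then 1 else 0 :: complex)" for k
    have "(\<Sum>k\<le>n. c k *\<^sub>C (A ^^ k) x) =
        (\<Sum>k\<le>n. if k = i then (A ^^ k) x else 0) - (\<Sum>k\<le>n. if k = j then (A ^^ k) x else 0)"
      unfolding sum_subtractf[symmetric] by (rule sum.cong) (auto simp: c_def scale_left_diff_distrib)
    also have "\<dots> = 0" using ij by (simp add: sum.delta)
    finally show ?thesis using ij by (intro exI[of _ c]) (auto simp: c_def intro!: exI[of _ i])
  qed
  then obtain c i where c: "i \<le> n" "c i \<noteq> 0" "(\<Sum>i\<le>n. c i *\<^sub>C (A ^^ i) x) = 0" by blast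
  define p where "p = (\<Sum>i\<le>n. monom (c i) i)"
  have co: "coeff p k = (if k \<le> n then c k else 0)" for k
    by (simp add: p_def coeff_sum sum.delta)
  have "degree p \<le> n" by (rule degree_le) (simp add: co)
  then have "poly_apply p x = 0" using c(3) poly_apply_eq_sum by (simp add: co)
  moreover have "p \<noteq> 0" using co[of i] c by auto
  ultimately show ?thesis by blast
qed

text \<open>Each vector uses its own annihilating polynomial, so that no minimal polynomial of A on
  V has to be constructed.\<close>

lemma span_gen_eigenvectors:
  assumes "subspace V" "\<And>x. x \<in> V \<Longrightarrow> A x \<in> V" "V \<subseteq> span F" "finite F"
  shows "V \<subseteq> span (gen_eigenvectors \<inter> V)"
  using annihilated_in_span_gen_eigenvectors[OF assms(1,2)] ex_annihilating_poly[OF assms(2-4)]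
  by blast

section \<open>Nested bases and the semisimple part\<close>

lemma ex_adapted_bases:
  assumes sub: "\<And>n. subspace (V n)" and inv: "\<And>n x. x \<in> V n \<Longrightarrow> A x \<in> V n"
    and mono: "\<And>n. V n \<subseteq> V (Suc n)"
    and fin: "\<And>n. \<exists>F. finite F \<and> V n \<subseteq> span F"
  shows "\<exists>xs :: nat \<Rightarrow> 'v list. \<forall>n. distinct (xs n) \<and> set (xs n) \<subseteq> gen_eigenvectors \<and>
    independent (set (xs n)) \<and> span (set (xs n)) = V n \<and> (\<exists>ys. xs (Suc n) = xs n @ ys)"
proof -
  \<comment> \<open>Lists instead of sets: each basis is to be an initial segment of the next, so
    that positions give one numbering valid for all n.\<close>
  define P where "P n zs \<longleftrightarrow> distinct zs \<and> set zs \<subseteq> gen_eigenvectors \<and>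
    independent (set zs) \<and> span (set zs) = V n" for n and zs :: "'v list"
  have ext: "\<exists>ys. P n (zs @ ys)"
    if zs: "distinct zs" "set zs \<subseteq> gen_eigenvectors" "independent (set zs)" "set zs \<subseteq> V n" for zs n
  proof -
    obtain F where F: "finite F" "V n \<subseteq> span F" using fin by blast
    \<comment> \<open>The extension is taken inside the generalized eigenvectors of V n; since these
      span V n, a maximal independent subset of them is a basis.\<close>
    obtain B where B: "set zs \<subseteq> B" "B \<subseteq> gen_eigenvectors \<inter> V n" "independent B"
      "gen_eigenvectors \<inter> V n \<subseteq> span B"
      using maximal_independent_subset_extend[of "set zs" "gen_eigenvectors \<inter> V n"] zs by blast
    have "finite B" using independent_span_bound[OF F(1) B(3)] B(2) F(2) by blast
    then obtain ys where ys: "set ys = B - set zs" "distinct ys"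
      using finite_distinct_list by (metis finite_Diff)
    have "span B = V n"
    proof
      show "span B \<subseteq> V n" by (rule span_minimal) (use B sub in auto)
      have "V n \<subseteq> span (gen_eigenvectors \<inter> V n)"
        by (rule span_gen_eigenvectors[OF sub inv F(2,1)])
      also have "\<dots> \<subseteq> span B" by (rule span_minimal) (use B in auto)
      finally show "V n \<subseteq> span B" .
    qed
    then have "P n (zs @ ys)" using ys zs B by (auto simp: P_def Un_absorb1)
    then show ?thesis by blast
  qed
  have "\<exists>xs. \<forall>n. P n (xs n) \<and> (\<exists>ys. xs (Suc n) = xs n @ ys)"
  proof (rule dependent_nat_choice)
    show "\<exists>zs. P 0 zs" using ext[of "[]" 0] independent_empty by auto
    fix zs n assume "P n zs"
    then have *: "distinct zs" "set zs \<subseteq> gen_eigenvectors" "independent (set zs)" "span (set zs) = V n"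
      by (auto simp: P_def)
    then have "set zs \<subseteq> V (Suc n)" using mono[of n] span_superset by blast
    then show "\<exists>zs'. P (Suc n) zs' \<and> (\<exists>ys. zs' = zs @ ys)" using ext *(1-3) by blast
  qed
  then show ?thesis unfolding P_def by blast
qed

text \<open>S is diagonal on the union of the nested bases, with the eigenvalue attached to each
  basis vector. Commutation with A and nilpotency of A - S on V n both rest on the intermediate fact
  \<open>SE\<close>, which makes S independent of the basis inside each generalized
  eigenspace.\<close>

theorem ex_adapted_Jordan_decomposition:
  assumes sub: "\<And>n. subspace (V n)" and inv: "\<And>n x. x \<in> V n \<Longrightarrow> A x \<in> V n"
    and mono: "\<And>n. V n \<subseteq> V (Suc n)"
    and fin: "\<And>n. \<exists>F. finite F \<and> V n \<subseteq> span F"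
  shows "\<exists>S (w :: nat \<Rightarrow> 'v) \<gamma>. Vector_Spaces.linear sc sc S \<and>
    (\<forall>n. \<forall>x\<in>V n. S x \<in> V n \<and> S (A x) = A (S x)) \<and>
    (\<forall>n. \<exists>m. \<forall>x\<in>V n. ((\<lambda>x. A x - S x) ^^ m) x = 0) \<and>
    (\<forall>n. inj_on w {1..dim (V n)} \<and> independent (w ` {1..dim (V n)}) \<and> span (w ` {1..dim (V n)}) = V n) \<and>
    (\<forall>n. \<forall>i\<in>{1..dim (V n)}. S (w i) = \<gamma> i *\<^sub>C w i)"
proof -
  obtain xs :: "nat \<Rightarrow> 'v list" where xs: "\<And>n. distinct (xs n)" "\<And>n. set (xs n) \<subseteq> gen_eigenvectors"
    "\<And>n. independent (set (xs n))" "\<And>n. span (set (xs n)) = V n" "\<And>n. \<exists>ys. xs (Suc n) = xs n @ ys"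
    using ex_adapted_bases[of V, OF assms] by blast
  have prefix: "\<exists>ys. xs n = xs m @ ys" if "m \<le> n" for m n
    using that
  proof (induction rule: dec_induct)
    case (step k)
    then show ?case using xs(5)[of k] by auto
  qed simp
  define B where "B = (\<Union>n. set (xs n))"
  have "independent B"
    unfolding B_def
  proof (rule independent_Union_directed)
    fix c d assume "c \<in> range (\<lambda>n. set (xs n))" "d \<in> range (\<lambda>n. set (xs n))"
    then obtain m n where "c = set (xs m)" "d = set (xs n)" by blast
    then show "c \<subseteq> d \<or> d \<subseteq> c" using prefix[of m n] prefix[of n m] by (cases "m \<le> n") auto
  qed (use xs(3) in auto)
  have len: "length (xs n) = dim (V n)" for n
    using dim_span_eq_card_independent[OF xs(3)[of n]] xs(4)[of n] distinct_card[OF xs(1)[of n]] by simp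
  have "\<forall>b\<in>B. \<exists>\<nu>. b \<in> gen_eigenspace \<nu>"
    using xs(2) by (auto simp: B_def gen_eigenvectors_def)
  then obtain \<nu> where \<nu>: "\<And>b. b \<in> B \<Longrightarrow> b \<in> gen_eigenspace (\<nu> b)" by metis
  \<comment> \<open>\<open>construct\<close> extends B to a basis of the whole space and sends the
    additional basis vectors to 0, which makes S linear everywhere.\<close>
  define S where "S = construct B (\<lambda>b. \<nu> b *\<^sub>C b)"
  have linS: "Vector_Spaces.linear sc sc S"
    unfolding S_def by (rule linear_construct[OF \<open>independent B\<close>])
  have Sb: "S b = \<nu> b *\<^sub>C b" if "b \<in> B" for b
    unfolding S_def by (rule construct_basis[OF \<open>independent B\<close> that])
  have xsB: "set (xs n) \<subseteq> B" "set (xs n) \<subseteq> V n" for n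
    using xs(4)[of n] span_superset by (auto simp: B_def)
  have xsD: "b \<in> B" "b \<in> V n" if "b \<in> set (xs n)" for b n
    using xsB[of n] that by auto
  have SV: "S x \<in> V n" if "x \<in> V n" for x n
  proof -
    have "x \<in> span (set (xs n))" using that xs(4) by simp
    then show ?thesis
    proof (induction rule: span_induct_alt)
      case (step c b y)
      have "b \<in> B" "b \<in> V n" using step xsD by auto
      then show ?case using step sub by (simp add: linear_add[OF linS] linear_scale[OF linS] Sb subspace_add subspace_scale)
    qed (use sub in \<open>simp add: linear_0[OF linS] subspace_0\<close>)
  qed
  \<comment> \<open>The expansion of g is grouped by the eigenvalues of the basis vectors.
    Directness of the sum of generalized eigenspaces leaves the group for \<mu>, on which S is
    multiplication by \<mu>.\<close>
  have SE: "S g = \<mu> *\<^sub>C g" if g: "g \<in> gen_eigenspace \<mu>" "g \<in> V n" for g \<mu> n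
  proof -
    have "g \<in> span (set (xs n))" using g xs(4) by simp
    then obtain c where c: "g = (\<Sum>b\<in>set (xs n). c b *\<^sub>C b)"
      using span_finite[of "set (xs n)"] by auto
    define G where "G \<theta> = (\<Sum>b\<in>{b\<in>set (xs n). \<nu> b = \<theta>}. c b *\<^sub>C b)" for \<theta>
    \<comment> \<open>\<mu> is inserted because it need not be the eigenvalue of any basis vector;
      its group is then empty and g is 0.\<close>
    define M where "M = insert \<mu> (\<nu> ` set (xs n))"
    have finM: "finite M" by (simp add: M_def)
    have "(\<Sum>\<theta>\<in>M. G \<theta>) = g"
      unfolding G_def c by (rule sum.group) (use finM in \<open>auto simp: M_def\<close>)
    moreover have "(\<Sum>\<theta>\<in>M. if \<theta> = \<mu> then g else 0) = g"
      using finM by (simp add: M_def sum.delta)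
    ultimately have "(\<Sum>\<theta>\<in>M. G \<theta> - (if \<theta> = \<mu> then g else 0)) = 0"
      by (simp only: sum_subtractf) simp
    moreover have GE: "G \<theta> \<in> gen_eigenspace \<theta>" for \<theta>
      unfolding G_def using \<nu> xsD(1) by (intro subspace_sum subspace_scale subspace_gen_eigenspace) auto
    ultimately have "\<forall>\<theta>\<in>M. G \<theta> - (if \<theta> = \<mu> then g else 0) = 0"
      using g(1) subspace_gen_eigenspace
      by (intro gen_eigenspaces_direct[OF finM]) (auto intro!: subspace_diff)
    then have "g = G \<mu>" by (simp add: M_def)
    also have "S (G \<mu>) = \<mu> *\<^sub>C G \<mu>"
      unfolding G_def linear_sum[OF linS] scale_sum_right
      by (rule sum.cong) (use xsB(1)[of n] in \<open>auto simp: subset_iff linear_scale[OF linS] Sb mult.commute\<close>)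
    finally show ?thesis .
  qed
  have comm: "S (A x) = A (S x)" if "x \<in> V n" for x n
  proof -
    have "x \<in> span (set (xs n))" using that xs(4) by simp
    then show ?thesis
    proof (induction rule: span_induct_alt)
      case (step c b y)
      have b: "b \<in> B" "b \<in> V n" using step xsD by auto
      have "A b = shifted 0 b" by (simp add: shifted_def)
      then have "A b \<in> gen_eigenspace (\<nu> b)" using gen_eigenspace_shifted[OF \<nu>[OF b(1)]] by simp
      then have "S (A b) = A (S b)" using SE inv b(2) by (metis A.scale Sb b(1))
      then show ?case using step by (simp add: linear_add[OF linS] linear_scale[OF linS] A.add A.scale)
    qed (simp add: linear_0[OF linS] A.zero)
  qed
  define N where "N = (\<lambda>x. A x - S x)"
  have NV: "N x \<in> V n" if "x \<in> V n" for x n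
    unfolding N_def using that inv SV sub by (blast intro: subspace_diff)
  have linN: "Vector_Spaces.linear sc sc (N ^^ m)" for m
  proof (induction m)
    case 0
    show ?case using linear_id by (simp add: id_def)
  next
    case (Suc m)
    show ?case using Vector_Spaces.linear_compose[OF Suc linear_compose_sub[OF lin linS]]
      by (simp add: comp_def N_def)
  qed
  have nil: "\<exists>m. (N ^^ m) b = 0" if b: "b \<in> set (xs n)" for b n
  proof -
    have E: "b \<in> gen_eigenspace (\<nu> b)" "b \<in> V n" using b \<nu> xsD by auto
    \<comment> \<open>The orbit of b under N stays in its generalized eigenspace, where S is the
      scalar \<nu> b; hence N acts on it as A - \<nu> b does.\<close>
    have *: "(N ^^ m) b = (shifted (\<nu> b) ^^ m) b \<and> (N ^^ m) b \<in> gen_eigenspace (\<nu> b) \<inter> V n" for m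
    proof (induction m)
      case (Suc m)
      let ?y = "(N ^^ m) b"
      have "S ?y = \<nu> b *\<^sub>C ?y" using SE Suc by blast
      then have "N ?y = shifted (\<nu> b) ?y" by (simp add: N_def shifted_def)
      moreover have "N ?y \<in> V n" using Suc NV by blast
      moreover have "shifted (\<nu> b) ?y \<in> gen_eigenspace (\<nu> b)" using Suc gen_eigenspace_shifted by blast
      ultimately show ?case using Suc by simp
    qed (use E in simp)
    then show ?thesis using E by (simp add: gen_eigenspace_def)
  qed
  have nilV: "\<exists>m. \<forall>x\<in>V n. (N ^^ m) x = 0" for n
  proof -
    obtain m where m: "\<And>b. b \<in> set (xs n) \<Longrightarrow> (N ^^ m b) b = 0" using nil[of _ n] by metis
    \<comment> \<open>A common exponent for the whole basis. The sum serves as upper bound in place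
      of a maximum, so the empty basis is no special case.\<close>
    define M where "M = (\<Sum>b\<in>set (xs n). m b)"
    have "(N ^^ M) b = 0" if b: "b \<in> set (xs n)" for b
    proof -
      have "m b \<le> M" unfolding M_def using b by (intro member_le_sum) auto
      then have "N ^^ M = N ^^ (M - m b) \<circ> N ^^ m b" by (metis funpow_add le_add_diff_inverse2)
      then show ?thesis using m[OF b] linear_0[OF linN] by simp
    qed
    then have "(N ^^ M) x = 0" if "x \<in> V n" for x
      using linear_eq_0_on_span[OF linN, of "set (xs n)" M] that xs(4) by blast
    then show ?thesis by blast
  qed
  \<comment> \<open>Indices start at 1 and list positions at 0. Any sufficiently long list gives the
    same entry by the prefix property; for indices beyond all dimensions the value is
    arbitrary.\<close>
  define w where "w i = xs (LEAST n. i \<le> length (xs n)) ! (i - 1)" for i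
  have w: "w i = xs n ! (i - 1)" if "1 \<le> i" "i \<le> length (xs n)" for i n
  proof -
    define m where "m = (LEAST n. i \<le> length (xs n))"
    have "i \<le> length (xs m)" "m \<le> n"
      unfolding m_def using that(2) by (rule LeastI, intro Least_le)
    then show ?thesis using prefix[of m n] that(1) by (auto simp: w_def nth_append simp flip: m_def)
  qed
  have img: "w ` {1..dim (V n)} = set (xs n)" for n
  proof -
    have "w ` {1..dim (V n)} = (\<lambda>i. xs n ! (i - 1)) ` {1..length (xs n)}"
      by (rule image_cong) (auto simp: len w)
    also have "\<dots> = (\<lambda>i. xs n ! i) ` ((\<lambda>i. i - 1) ` {1..length (xs n)})"
      by (simp add: image_image)
    also have "(\<lambda>i. i - 1) ` {1..length (xs n)} = {..<length (xs n)}"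
      by (auto simp: image_iff intro!: bexI[of _ "Suc _"])
    finally show ?thesis by (auto simp: set_conv_nth)
  qed
  have "inj_on w {1..dim (V n)}" for n
    by (rule eq_card_imp_inj_on) (use img[of n] distinct_card[OF xs(1)[of n]] len in auto)
  note inj = this
  have eig: "S (w i) = \<nu> (w i) *\<^sub>C w i" if "i \<in> {1..dim (V n)}" for n i
    using img[of n] that xsD(1) by (intro Sb) fastforce
  have bas: "independent (w ` {1..dim (V n)})" "span (w ` {1..dim (V n)}) = V n" for n
    unfolding img by (rule xs(3,4))+
  show ?thesis
    by (rule exI[of _ S], rule exI[of _ w], rule exI[of _ "\<lambda>i. \<nu> (w i)"], intro conjI allI ballI)
      (assumption | rule linS SV comm nilV[unfolded N_def] inj bas eig)+
qed

end

section \<open>Inner product spaces of functions\<close>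

definition linear_functional_on :: "('a \<Rightarrow> complex) set \<Rightarrow> (('a \<Rightarrow> complex) \<Rightarrow> complex) \<Rightarrow> bool" where
  "linear_functional_on W L \<longleftrightarrow>
    (\<forall>g\<in>W. \<forall>h\<in>W. L (g + h) = L g + L h) \<and> (\<forall>c. \<forall>g\<in>W. L (cscale c g) = c * L g)"

lemma linear_functional_on_mono:
  "linear_functional_on W L \<Longrightarrow> W' \<subseteq> W \<Longrightarrow> linear_functional_on W' L"
  by (simp add: linear_functional_on_def subset_iff)

locale inner_function_space =
  fixes H :: "('a \<Rightarrow> complex) set" and ip :: "'a inner_fun"
  assumes subspace_H: "cfun.subspace H"
    and ip_add_left: "\<And>g h l. g \<in> H \<Longrightarrow> h \<in> H \<Longrightarrow> l \<in> H \<Longrightarrow> ip (g + h) l = ip g l + ip h l"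
    and ip_scale_left: "\<And>c g h. g \<in> H \<Longrightarrow> h \<in> H \<Longrightarrow> ip (cscale c g) h = c * ip g h"
    and ip_commute: "\<And>g h. g \<in> H \<Longrightarrow> h \<in> H \<Longrightarrow> ip h g = cnj (ip g h)"
    and ip_pos: "\<And>h. h \<in> H \<Longrightarrow> h \<noteq> 0 \<Longrightarrow> 0 < Re (ip h h)"
begin

lemmas H_closed [simp] = cfun.subspace_0[OF subspace_H] cfun.subspace_add[OF subspace_H]
  cfun.subspace_scale[OF subspace_H] cfun.subspace_diff[OF subspace_H] cfun.subspace_neg[OF subspace_H]

lemma ip_add_right: "g \<in> H \<Longrightarrow> h \<in> H \<Longrightarrow> l \<in> H \<Longrightarrow> ip l (g + h) = ip l g + ip l h"
  using ip_commute ip_add_left by (metis H_closed(2) complex_cnj_add)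

lemma ip_scale_right: "g \<in> H \<Longrightarrow> h \<in> H \<Longrightarrow> ip h (cscale c g) = cnj c * ip h g"
  using ip_commute ip_scale_left by (metis H_closed(3) complex_cnj_mult)

lemma ip_zero_left [simp]: "h \<in> H \<Longrightarrow> ip 0 h = 0"
  using ip_scale_left[of 0 h 0] by simp

lemma ip_zero_right [simp]: "h \<in> H \<Longrightarrow> ip h 0 = 0"
  using ip_scale_right[of 0 h 0] by simp

lemma ip_diff_left: "g \<in> H \<Longrightarrow> h \<in> H \<Longrightarrow> l \<in> H \<Longrightarrow> ip (g - h) l = ip g l - ip h l"
  using ip_add_left[of "g - h" h l] by simp

lemma ip_diff_right: "g \<in> H \<Longrightarrow> h \<in> H \<Longrightarrow> l \<in> H \<Longrightarrow> ip l (g - h) = ip l g - ip l h"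
  using ip_add_right[of "g - h" h l] by simp

lemma ip_self: "h \<in> H \<Longrightarrow> ip h h = complex_of_real ((hnorm ip h)\<^sup>2)"
proof -
  assume h: "h \<in> H"
  have "Im (ip h h) = 0" using ip_commute[OF h h] by (metis Reals_cnj_iff complex_is_Real_iff)
  moreover have "Re (ip h h) \<ge> 0" using ip_pos[OF h] h by (cases "h = 0") auto
  ultimately show ?thesis by (simp add: hnorm_def complex_eq_iff)
qed

lemma ip_eq_0_iff: "h \<in> H \<Longrightarrow> ip h h = 0 \<longleftrightarrow> h = 0"
  using ip_pos by force

lemma hnorm_nonneg [simp]: "h \<in> H \<Longrightarrow> 0 \<le> hnorm ip h"
  using ip_pos[of h] by (cases "h = 0") (auto simp: hnorm_def)

lemma hnorm_eq_0: "h \<in> H \<Longrightarrow> hnorm ip h = 0 \<longleftrightarrow> h = 0"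
  using ip_self[of h] ip_eq_0_iff[of h] by auto

lemma ip_determines:
  assumes "cfun.subspace W" "W \<subseteq> H" "g \<in> W" "h \<in> W" "\<And>v. v \<in> W \<Longrightarrow> ip v g = ip v h"
  shows "g = h"
proof -
  have "ip (g - h) (g - h) = 0"
    using assms cfun.subspace_diff[OF assms(1,3,4)] by (subst ip_diff_right) auto
  then show ?thesis using assms(2-4) ip_eq_0_iff[of "g - h"] by (simp add: subset_iff)
qed

lemma Cauchy_Schwarz:
  assumes g: "g \<in> H" and h: "h \<in> H"
  shows "cmod (ip g h) \<le> hnorm ip g * hnorm ip h"
proof (cases "h = 0")
  case True
  then show ?thesis using g by simp
next
  case False
  define n where "n = (hnorm ip h)\<^sup>2"
  have n: "n > 0" using False h hnorm_eq_0[OF h] by (simp add: n_def)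
  \<comment> \<open>The coefficient of the orthogonal projection of g onto h; the remainder l is
    orthogonal to h, and its squared norm is the gap in the inequality.\<close>
  define c where "c = ip g h / of_real n"
  define l where "l = g - cscale c h"
  have l: "l \<in> H" using g h by (simp add: l_def)
  have lh: "ip l h = 0"
    using g h n ip_self[OF h] by (simp add: l_def ip_diff_left ip_scale_left c_def n_def)
  have "ip l l = ip l g"
    using lh g h l by (subst l_def) (simp add: ip_diff_right ip_scale_right)
  also have "\<dots> = ip g g - c * cnj (ip g h)"
    using g h by (simp add: l_def ip_diff_left ip_scale_left ip_commute[OF g h])
  also have "c * cnj (ip g h) = of_real ((cmod (ip g h))\<^sup>2 / n)"
    by (simp only: c_def times_divide_eq_left complex_norm_square of_real_divide)
  finally have "(hnorm ip l)\<^sup>2 = (hnorm ip g)\<^sup>2 - (cmod (ip g h))\<^sup>2 / n"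
    using ip_self[OF l] ip_self[OF g] by (metis of_real_diff of_real_eq_iff)
  then have "(cmod (ip g h))\<^sup>2 / n \<le> (hnorm ip g)\<^sup>2" by (metis diff_ge_0_iff_ge zero_le_power2)
  then have "(cmod (ip g h))\<^sup>2 \<le> (hnorm ip g)\<^sup>2 * n" using n by (simp add: divide_le_eq)
  then have "(cmod (ip g h))\<^sup>2 \<le> (hnorm ip g * hnorm ip h)\<^sup>2" by (simp add: power_mult_distrib n_def)
  then show ?thesis by (rule power2_le_imp_le) (use g h in simp)
qed

lemma hnorm_add_square:
  assumes "g \<in> H" "h \<in> H"
  shows "(hnorm ip (g + h))\<^sup>2 = (hnorm ip g)\<^sup>2 + (hnorm ip h)\<^sup>2 + 2 * Re (ip g h)"
proof -
  have "ip (g + h) (g + h) = ip g g + ip h h + (ip g h + cnj (ip g h))"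
    using assms by (simp add: ip_add_left ip_add_right ip_commute[OF assms])
  then have "Re (ip (g + h) (g + h)) = Re (ip g g) + Re (ip h h) + 2 * Re (ip g h)" by simp
  then show ?thesis using assms by (simp add: ip_self)
qed

lemma hnorm_scale: "h \<in> H \<Longrightarrow> hnorm ip (cscale c h) = cmod c * hnorm ip h"
proof -
  assume h: "h \<in> H"
  have "ip (cscale c h) (cscale c h) = (c * cnj c) * ip h h"
    using h by (simp add: ip_scale_left ip_scale_right)
  also have "c * cnj c = of_real ((cmod c)\<^sup>2)" by (simp only: complex_norm_square)
  finally have "complex_of_real ((hnorm ip (cscale c h))\<^sup>2) = of_real ((cmod c * hnorm ip h)\<^sup>2)"
    using h by (simp only: ip_self H_closed power_mult_distrib of_real_mult)
  then have "(hnorm ip (cscale c h))\<^sup>2 = (cmod c * hnorm ip h)\<^sup>2"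
    by (simp only: of_real_eq_iff)
  then show ?thesis by (rule power2_eq_imp_eq) (use h in auto)
qed

lemma hnorm_minus: "h \<in> H \<Longrightarrow> hnorm ip (- h) = hnorm ip h"
  using hnorm_scale[of h "-1"] by (simp add: cscale_def fun_Compl_def)

lemma hnorm_triangle:
  assumes "g \<in> H" "h \<in> H"
  shows "hnorm ip (g + h) \<le> hnorm ip g + hnorm ip h"
proof (rule power2_le_imp_le)
  have "Re (ip g h) \<le> hnorm ip g * hnorm ip h"
    using Cauchy_Schwarz[OF assms] complex_Re_le_cmod order_trans by blast
  then show "(hnorm ip (g + h))\<^sup>2 \<le> (hnorm ip g + hnorm ip h)\<^sup>2"
    using hnorm_add_square[OF assms] by (simp add: power2_sum)
qed (use assms in simp)

sublocale Metric_space H "hdist H ip"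
proof
  show "0 \<le> hdist H ip g h" for g h by (simp add: hdist_def)
  show "hdist H ip g h = hdist H ip h g" for g h
    using hnorm_minus[of "g - h"] by (simp add: hdist_def)
  show "hdist H ip g h = 0 \<longleftrightarrow> g = h" if "g \<in> H" "h \<in> H" for g h
    using that hnorm_eq_0[of "g - h"] by (simp add: hdist_def)
  show "hdist H ip g l \<le> hdist H ip g h + hdist H ip h l" if "g \<in> H" "h \<in> H" "l \<in> H" for g h l
    using that hnorm_triangle[of "g - h" "h - l"] by (simp add: hdist_def)
qed

lemma topspace_htop [simp]: "topspace (htop H ip) = H"
  by (simp add: htop_def)

section \<open>Representation of linear functionals\<close>

lemma linear_functional_on_ip: "m \<in> H \<Longrightarrow> W \<subseteq> H \<Longrightarrow> linear_functional_on W (\<lambda>v. ip v m)"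
  by (auto simp: linear_functional_on_def ip_add_left ip_scale_left subset_iff)

text \<open>Gram-Schmidt by induction on the spanning set. The functional is kept arbitrary because
  the induction hypothesis is needed twice: for L and for the functional whose representer is the
  projection of the new vector.\<close>

lemma finite_Riesz:
  assumes "finite F" "F \<subseteq> H" "linear_functional_on (cfun.span F) L"
  shows "\<exists>u\<in>cfun.span F. \<forall>v\<in>cfun.span F. ip v u = L v"
  using assms
proof (induction F arbitrary: L rule: finite_induct)
  case empty
  have "L (cscale 0 0) = 0 * L 0"
    using empty cfun.span_zero unfolding linear_functional_on_def by blast
  then have "ip 0 0 = L 0"
    unfolding cfun.scale_zero_left using ip_zero_left[OF H_closed(1)] by (metis mult_zero_left)
  then show ?case unfolding cfun.span_empty by blast
next
  case (insert b F)
  let ?W = "cfun.span F"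
  have "F \<subseteq> H" using insert.prems by blast
  from cfun.subspace_span cfun.span_minimal[OF this subspace_H] cfun.span_mono[OF subset_insertI]
  have W: "cfun.subspace ?W" "?W \<subseteq> H" "?W \<subseteq> cfun.span (insert b F)" .
  have b: "b \<in> H" using insert by simp
  \<comment> \<open>q is the orthogonal projection of b onto the span of F.\<close>
  obtain q where q: "q \<in> ?W" "\<And>v. v \<in> ?W \<Longrightarrow> ip v q = ip v b"
    using insert.IH[of "\<lambda>v. ip v b"] linear_functional_on_ip[OF b W(2)] insert.prems by auto
  obtain u where u: "u \<in> ?W" "\<And>v. v \<in> ?W \<Longrightarrow> ip v u = L v"
    using insert.IH[of L] linear_functional_on_mono[OF insert.prems(2) W(3)] insert.prems by auto
  define e where "e = b - q"
  have qH: "q \<in> H" "u \<in> H" using q u W by auto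
  have e: "e \<in> H" using b qH by (simp add: e_def)
  have es: "e \<in> cfun.span (insert b F)"
    unfolding e_def by (rule cfun.span_diff[OF cfun.span_base]) (use q(1) W(3) in auto)
  have eW: "ip v e = 0" if "v \<in> ?W" for v
    using that q qH b W by (auto simp: e_def ip_diff_right)
  have dec: "\<exists>v\<in>?W. \<exists>c. x = v + cscale c e" if x: "x \<in> cfun.span (insert b F)" for x
  proof -
    obtain c where c: "x - cscale c b \<in> ?W" using cfun.span_breakdown_eq[of x b F] x by auto
    have "x = (x - cscale c b + cscale c q) + cscale c e"
      by (simp add: e_def cfun.scale_right_diff_distrib)
    moreover have "x - cscale c b + cscale c q \<in> ?W"
      using c q(1) by (intro cfun.span_add cfun.span_scale)
    ultimately show ?thesis by blast
  qed
  \<comment> \<open>Conjugated since \<open>ip\<close> is conjugate-linear in its second argument.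
    If b already lies in the span of F, then e is 0 and division by 0 makes c vanish.\<close>
  define c where "c = cnj (L e / ip e e)"
  define z where "z = u + cscale c e"
  have zs: "z \<in> cfun.span (insert b F)" unfolding z_def
    using u(1) W(3) es by (intro cfun.span_add cfun.span_scale) auto
  have L0: "L 0 = 0"
    using insert.prems(2) cfun.span_zero unfolding linear_functional_on_def
    by (metis cfun.scale_zero_left mult_zero_left)
  have ee: "ip e z = L e"
  proof (cases "e = 0")
    case True
    then show ?thesis using L0 qH by (simp add: z_def)
  next
    case False
    then have "ip e e \<noteq> 0" using e ip_eq_0_iff by simp
    moreover have "ip e u = 0" using eW[OF u(1)] ip_commute[OF e qH(2)] by simp
    ultimately show ?thesis using e qH by (simp add: z_def ip_add_right ip_scale_right c_def)
  qed
  have "ip x z = L x" if x: "x \<in> cfun.span (insert b F)" for x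
  proof -
    obtain v d where v: "v \<in> ?W" "x = v + cscale d e" using dec[OF x] by blast
    have vH: "v \<in> H" "z \<in> H" using v W e qH by (auto simp: z_def)
    have "ip v z = L v" using eW[OF v(1)] u(2)[OF v(1)] vH e qH by (simp add: z_def ip_add_right ip_scale_right)
    then have "ip x z = L v + d * L e" using v vH e ee by (simp add: ip_add_left ip_scale_left)
    also have "\<dots> = L v + L (cscale d e)"
      using insert.prems(2) es by (simp add: linear_functional_on_def)
    also have "\<dots> = L x"
      using insert.prems(2) v(1) W(3) cfun.span_scale[OF es, of d] unfolding v(2) linear_functional_on_def
      by (simp add: subset_iff)
    finally show ?thesis .
  qed
  then show ?case using zs by blast
qed

lemma hnorm_parallelogram:
  assumes "g \<in> H" "h \<in> H"
  shows "(hnorm ip (g - h))\<^sup>2 = 2 * (hnorm ip g)\<^sup>2 + 2 * (hnorm ip h)\<^sup>2 - (hnorm ip (g + h))\<^sup>2"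
proof -
  have "ip g (- h) = - ip g h"
    using ip_scale_right[OF assms(2,1), of "- 1"] by simp
  then have "(hnorm ip (g - h))\<^sup>2 = (hnorm ip g)\<^sup>2 + (hnorm ip h)\<^sup>2 - 2 * Re (ip g h)"
    using hnorm_add_square[of g "- h"] assms by (simp add: hnorm_minus)
  then show ?thesis using hnorm_add_square[OF assms] by simp
qed

text \<open>The representing vector minimizes the convex functional \<open>\<parallel>h\<parallel>\<^sup>2 - 2 Re (L h)\<close>.\<close>

lemma Riesz:
  assumes complete: "mcomplete" and L: "linear_functional_on H L"
    and C: "\<And>h. h \<in> H \<Longrightarrow> cmod (L h) \<le> C * hnorm ip h"
  shows "\<exists>g\<in>H. \<forall>h\<in>H. ip h g = L h"
proof -
  have Ladd: "L (g + h) = L g + L h" and Lscale: "L (cscale c g) = c * L g"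
    if "g \<in> H" "h \<in> H" for g h c
    using L that unfolding linear_functional_on_def by blast+
  define J where "J h = (hnorm ip h)\<^sup>2 - 2 * Re (L h)" for h
  define m where "m = Inf (J ` H)"
  \<comment> \<open>Completing the square: y^2 - 2 C y is at least - C^2, with y the norm of
    h.\<close>
  have low: "- (C\<^sup>2) \<le> J h" if "h \<in> H" for h
  proof -
    have "Re (L h) \<le> C * hnorm ip h" using C[OF that] complex_Re_le_cmod order_trans by blast
    moreover have "0 \<le> (hnorm ip h - C)\<^sup>2" by simp
    ultimately show ?thesis unfolding J_def power2_diff by (simp add: mult.commute)
  qed
  then have bdd: "bdd_below (J ` H)" by (auto simp: bdd_below_def)
  have ge: "m \<le> J h" if "h \<in> H" for h
    unfolding m_def by (rule cInf_lower) (use that bdd in auto)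
  have "\<exists>h. h \<in> H \<and> J h < m + 1 / Suc n" for n :: nat
  proof -
    have "Inf (J ` H) < m + 1 / Suc n" unfolding m_def by simp
    then show ?thesis using cInf_lessD[of "J ` H"] H_closed(1) by blast
  qed
  then obtain s where s: "\<And>n. s n \<in> H" "\<And>n. J (s n) < m + 1 / Suc n" by metis
  \<comment> \<open>The parallelogram identity with the value of J at the midpoint, which is at
    least m. It forces minimizing sequences to be Cauchy.\<close>
  have half: "(hnorm ip (g - h))\<^sup>2 \<le> 2 * (J g + J h) - 4 * m" if "g \<in> H" "h \<in> H" for g h
  proof -
    have 1: "Re (L (cscale (1/2) (g + h))) = (Re (L g) + Re (L h)) / 2"
      using that Ladd Lscale[of "g + h" 0] by simp
    have 2: "4 * (hnorm ip (cscale (1/2) (g + h)))\<^sup>2 = (hnorm ip (g + h))\<^sup>2"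
      using that by (simp add: hnorm_scale power_divide)
    have "4 * J (cscale (1/2) (g + h)) = (hnorm ip (g + h))\<^sup>2 - 4 * (Re (L g) + Re (L h))"
      unfolding J_def 1 using 2 by (simp add: field_simps)
    moreover have "m \<le> J (cscale (1/2) (g + h))" using ge that by simp
    ultimately show ?thesis using hnorm_parallelogram[OF that] by (simp add: J_def)
  qed
  have "MCauchy s"
    unfolding MCauchy_def
  proof (intro conjI allI impI)
    show "range s \<subseteq> H" using s by auto
    fix e :: real assume e: "e > 0"
    \<comment> \<open>Both excesses over m are below e^2 / 4, and the preceding estimate doubles
      their sum.\<close>
    obtain M where M: "inverse (real (Suc M)) < e\<^sup>2 / 4" using reals_Archimedean[of "e\<^sup>2 / 4"] e by auto
    have "hdist H ip (s p) (s q) < e" if "M \<le> p" "M \<le> q" for p q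
    proof -
      have "1 / real (Suc p) \<le> inverse (real (Suc M))" "1 / real (Suc q) \<le> inverse (real (Suc M))"
        using that by (auto simp: divide_simps)
      then have "(hnorm ip (s p - s q))\<^sup>2 < e\<^sup>2"
        using half[OF s(1) s(1), of p q] s(2)[of p] s(2)[of q] M by argo
      then have "hnorm ip (s p - s q) < e" by (rule power2_less_imp_less) (use e in simp)
      then show ?thesis using s by (simp add: hdist_def)
    qed
    then show "\<exists>N. \<forall>n n'. N \<le> n \<longrightarrow> N \<le> n' \<longrightarrow> hdist H ip (s n) (s n') < e" by blast
  qed
  then obtain g where "limitin mtopology s g sequentially" using complete unfolding mcomplete_def by blast
  then have g: "g \<in> H" "\<And>e. e > 0 \<Longrightarrow> \<exists>N. \<forall>n\<ge>N. hnorm ip (s n - g) < e"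
    using s unfolding limit_metric_sequentially hdist_def by auto
  have lim0: "(\<lambda>n. hnorm ip (s n - g)) \<longlonglongrightarrow> 0"
    using g(2) s(1) g(1) by (auto simp: lim_sequentially dist_real_def)
  have up: "J g \<le> m"
  proof (rule LIMSEQ_le[where X = "\<lambda>_. J g"])
    \<comment> \<open>A generous form of the expansion of J around g: the error terms tend to 0 with
      the distance from \<open>s n\<close> to g, so J attains its infimum at g.\<close>
    have "J g \<le> J (s n) + hnorm ip (s n - g) * (hnorm ip (s n - g) + 2 * hnorm ip g + 2 * C) +
        (hnorm ip (s n - g))\<^sup>2" for n
    proof -
      have sg: "s n - g \<in> H" "s n = g + (s n - g)" using s g by auto
      have "J (s n) = J g + (hnorm ip (s n - g))\<^sup>2 + 2 * Re (ip g (s n - g)) - 2 * Re (L (s n - g))"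
        using hnorm_add_square[OF g(1) sg(1)] Ladd[OF g(1) sg(1)] by (simp add: J_def)
      moreover have "- Re (ip g (s n - g)) \<le> hnorm ip g * hnorm ip (s n - g)"
        using Cauchy_Schwarz[OF g(1) sg(1)] abs_Re_le_cmod[of "ip g (s n - g)"] by linarith
      moreover have "Re (L (s n - g)) \<le> C * hnorm ip (s n - g)"
        using C[OF sg(1)] complex_Re_le_cmod order_trans by blast
      moreover have "hnorm ip (s n - g) * (hnorm ip (s n - g) + 2 * hnorm ip g + 2 * C) =
          (hnorm ip (s n - g))\<^sup>2 + 2 * (hnorm ip g * hnorm ip (s n - g)) + 2 * (C * hnorm ip (s n - g))"
        by (simp add: algebra_simps power2_eq_square)
      moreover have "0 \<le> (hnorm ip (s n - g))\<^sup>2" by simp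
      ultimately show ?thesis by linarith
    qed
    then show "\<exists>N. \<forall>n\<ge>N. J g \<le> (m + 1 / Suc n) +
        hnorm ip (s n - g) * (hnorm ip (s n - g) + 2 * hnorm ip g + 2 * C) + (hnorm ip (s n - g))\<^sup>2"
      using s(2) by (smt (verit))
    have "(\<lambda>n. (m + 1 / Suc n) +
        hnorm ip (s n - g) * (hnorm ip (s n - g) + 2 * hnorm ip g + 2 * C) + (hnorm ip (s n - g))\<^sup>2)
      \<longlonglongrightarrow> (m + 0) + 0 * (0 + 2 * hnorm ip g + 2 * C) + 0\<^sup>2"
      by (intro tendsto_intros lim0 LIMSEQ_Suc[OF lim_1_over_n])
    then show "(\<lambda>n. (m + 1 / Suc n) +
        hnorm ip (s n - g) * (hnorm ip (s n - g) + 2 * hnorm ip g + 2 * C) + (hnorm ip (s n - g))\<^sup>2)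
      \<longlonglongrightarrow> m" by simp
  qed simp
  have Re0: "Re (ip g h - L h) = 0" if h: "h \<in> H" for h
  proof (rule ccontr)
    define d where "d = Re (ip g h - L h)"
    assume "\<not> ?thesis"
    then have d: "d \<noteq> 0" by (simp add: d_def)
    \<comment> \<open>The added 1 keeps q positive. The step t = - d / q minimizes t^2 q + 2 t d,
      with value - d^2 / q; this would undercut the minimum if d were not 0.\<close>
    define q where "q = (hnorm ip h)\<^sup>2 + 1"
    have q: "q > 0" by (simp add: q_def add_nonneg_pos)
    define t where "t = - d / q"
    have "J (g + cscale (of_real t) h) = J g + t\<^sup>2 * (hnorm ip h)\<^sup>2 + 2 * t * d"
      using g h Ladd[OF g(1), of "cscale (of_real t) h"] Lscale[OF h h]
      by (simp add: J_def hnorm_add_square hnorm_scale ip_scale_right power_mult_distrib d_def algebra_simps)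
    moreover have "J g \<le> J (g + cscale (of_real t) h)" using up ge[of "g + cscale (of_real t) h"] g h by simp
    ultimately have "0 \<le> t\<^sup>2 * (hnorm ip h)\<^sup>2 + 2 * t * d" by simp
    also have "\<dots> \<le> t\<^sup>2 * q + 2 * t * d" by (simp add: q_def mult_left_mono)
    also have "\<dots> = - d\<^sup>2 / q" using q by (simp add: t_def power2_eq_square divide_simps)
    finally have "d\<^sup>2 / q \<le> 0" by simp
    moreover have "d\<^sup>2 / q > 0" using d q by simp
    ultimately show False by linarith
  qed
  have "ip h g = L h" if h: "h \<in> H" for h
  proof -
    have 1: "Re (ip h g) = Re (L h)" using Re0[OF h] ip_commute[OF g(1) h] by simp
    \<comment> \<open>Multiplication of h by the imaginary unit turns imaginary parts into real
      parts.\<close>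
    have "Re (ip (cscale \<i> h) g) = Re (L (cscale \<i> h))"
      using Re0[of "cscale \<i> h"] ip_commute[OF g(1), of "cscale \<i> h"] h by simp
    then have "Im (ip h g) = Im (L h)" using h g Lscale[OF h h] by (simp add: ip_scale_left)
    with 1 show ?thesis by (rule complex_eqI)
  qed
  then show ?thesis using g by blast
qed

end

lemma linear_functional_on_sum:
  assumes W: "cfun.subspace W" and L: "linear_functional_on W L"
    and "finite X" "\<And>j. j \<in> X \<Longrightarrow> g j \<in> W"
  shows "L (\<Sum>j\<in>X. cscale (c j) (g j)) = (\<Sum>j\<in>X. c j * L (g j))"
  using assms(3,4)
proof (induction X rule: finite_induct)
  case empty
  have "L (cscale 0 0) = 0 * L 0"
    using L cfun.subspace_0[OF W] unfolding linear_functional_on_def by blast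
  then show ?case by (simp only: sum.empty cfun.scale_zero_left mult_zero_left)
next
  case (insert x X)
  have mem: "(\<Sum>j\<in>X. cscale (c j) (g j)) \<in> W" "cscale (c x) (g x) \<in> W" "g x \<in> W"
    using insert.prems by (auto intro!: cfun.subspace_sum[OF W] cfun.subspace_scale[OF W])
  have "L (cscale (c x) (g x) + (\<Sum>j\<in>X. cscale (c j) (g j))) =
      L (cscale (c x) (g x)) + L (\<Sum>j\<in>X. cscale (c j) (g j))"
    using L mem unfolding linear_functional_on_def by blast
  moreover have "L (cscale (c x) (g x)) = c x * L (g x)"
    using L mem unfolding linear_functional_on_def by blast
  ultimately show ?case
    unfolding sum.insert[OF insert.hyps] using insert.IH[OF insert.prems] by (metis insertCI)
qed

context inner_function_space
begin

lemma ip_sum_right: "(\<And>i. i \<in> X \<Longrightarrow> g i \<in> H) \<Longrightarrow> h \<in> H \<Longrightarrow> ip h (\<Sum>i\<in>X. g i) = (\<Sum>i\<in>X. ip h (g i))"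
proof (induction X rule: infinite_finite_induct)
  case (insert i X)
  then have "(\<Sum>i\<in>X. g i) \<in> H" by (intro cfun.subspace_sum[OF subspace_H]) auto
  then show ?case
    unfolding sum.insert[OF insert.hyps] by (subst ip_add_right) (use insert in auto)
qed simp_all

lemma hnorm_sum: "(\<And>i. i \<in> X \<Longrightarrow> g i \<in> H) \<Longrightarrow> hnorm ip (\<Sum>i\<in>X. g i) \<le> (\<Sum>i\<in>X. hnorm ip (g i))"
proof (induction X rule: infinite_finite_induct)
  case (insert i X)
  then have "(\<Sum>i\<in>X. g i) \<in> H" by (intro cfun.subspace_sum[OF subspace_H]) auto
  then have "hnorm ip (g i + (\<Sum>i\<in>X. g i)) \<le> hnorm ip (g i) + (\<Sum>i\<in>X. hnorm ip (g i))"
    using insert hnorm_triangle[of "g i" "\<Sum>i\<in>X. g i"] by fastforce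
  then show ?case unfolding sum.insert[OF insert.hyps] .
qed (use hnorm_eq_0[OF H_closed(1)] in simp_all)

section \<open>Bounded operators on finite-dimensional subspaces\<close>

lemma continuous_map_bounded:
  assumes W: "cfun.subspace W" "W \<subseteq> H" and T: "\<And>x. x \<in> W \<Longrightarrow> T x \<in> H"
    and diff: "\<And>x y. x \<in> W \<Longrightarrow> y \<in> W \<Longrightarrow> T (x - y) = T x - T y"
    and C: "\<And>x. x \<in> W \<Longrightarrow> hnorm ip (T x) \<le> C * hnorm ip x"
  shows "continuous_map (subtopology (htop H ip) W) (htop H ip) T"
  unfolding htop_def continuous_map_to_metric
proof (intro ballI allI impI)
  fix x and e :: real assume "x \<in> topspace (subtopology mtopology W)" and e: "e > 0"
  then have x: "x \<in> W" "x \<in> H" by auto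
  define \<delta> where "\<delta> = e / (\<bar>C\<bar> + 1)"
  have \<delta>: "\<delta> > 0" using e by (simp add: \<delta>_def)
  show "\<exists>U. openin (subtopology mtopology W) U \<and> x \<in> U \<and> (\<forall>y\<in>U. T y \<in> mball (T x) e)"
  proof (intro exI[of _ "W \<inter> mball x \<delta>"] conjI ballI)
    show "openin (subtopology mtopology W) (W \<inter> mball x \<delta>)" by (simp add: openin_subtopology_Int2)
    show "x \<in> W \<inter> mball x \<delta>" using x \<delta> by simp
    fix y assume "y \<in> W \<inter> mball x \<delta>"
    then have y: "y \<in> W" "y \<in> H" "hnorm ip (x - y) < \<delta>" using x by (auto simp: hdist_def)
    have xy: "x - y \<in> W" using x y cfun.subspace_diff[OF W(1)] by blast
    then have xyH: "x - y \<in> H" using W by blast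
    have "hnorm ip (T x - T y) \<le> C * hnorm ip (x - y)" using C[OF xy] diff x y by simp
    also have "\<dots> \<le> (\<bar>C\<bar> + 1) * hnorm ip (x - y)" by (rule mult_right_mono) (use xyH in auto)
    also have "\<dots> < e" using y(3) by (simp add: \<delta>_def pos_less_divide_eq mult.commute)
    finally show "T y \<in> mball (T x) e" using T x y by (simp add: hdist_def)
  qed
qed

text \<open>Each coordinate with respect to a basis is an inner product with some vector of the
  span, so Cauchy-Schwarz bounds it by the norm of x; finitely many coordinates bound T x.\<close>

lemma finite_span_bounded:
  assumes F: "finite F" "F \<subseteq> H" and T: "Vector_Spaces.linear cscale cscale T"
    and TH: "\<And>x. x \<in> cfun.span F \<Longrightarrow> T x \<in> H"
  shows "\<exists>C. \<forall>x\<in>cfun.span F. hnorm ip (T x) \<le> C * hnorm ip x"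
proof -
  interpret T: Vector_Spaces.linear cscale cscale T by (rule T)
  obtain B where B: "B \<subseteq> F" "cfun.independent B" "F \<subseteq> cfun.span B"
    using cfun.maximal_independent_subset[of F] by blast
  have BF: "cfun.span B = cfun.span F"
    using B by (intro antisym cfun.span_mono cfun.span_minimal) auto
  have BH: "finite B" "B \<subseteq> H" using B F finite_subset by auto
  have spanH: "cfun.span F \<subseteq> H" by (rule cfun.span_minimal[OF F(2) subspace_H])
  have "\<exists>u\<in>cfun.span B. \<forall>v\<in>cfun.span B. ip v u = cfun.representation B v b" for b
    by (rule finite_Riesz[OF BH])
      (use B in \<open>auto simp: linear_functional_on_def cfun.representation_add cfun.representation_scale\<close>)
  then obtain u where u: "\<And>b. u b \<in> cfun.span B"
    "\<And>b v. v \<in> cfun.span B \<Longrightarrow> ip v (u b) = cfun.representation B v b" by metis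
  show ?thesis
  proof (intro exI ballI)
    fix x assume x: "x \<in> cfun.span F"
    have uH: "u b \<in> H" for b using u(1) BF spanH by auto
    have xH: "x \<in> H" using x spanH by auto
    have Tb: "T b \<in> H" if "b \<in> B" for b using that TH B(1) by (auto intro: cfun.span_base)
    have "x = (\<Sum>b\<in>B. cscale (ip x (u b)) b)"
      using cfun.sum_representation_eq[OF B(2) _ BH(1), of x] x BF u(2) by simp
    then have "T x = T (\<Sum>b\<in>B. cscale (ip x (u b)) b)" by simp
    also have "\<dots> = (\<Sum>b\<in>B. cscale (ip x (u b)) (T b))" by (simp add: T.sum T.scale)
    finally have "hnorm ip (T x) \<le> (\<Sum>b\<in>B. hnorm ip (cscale (ip x (u b)) (T b)))"
      using hnorm_sum[of B "\<lambda>b. cscale (ip x (u b)) (T b)"] Tb by simp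
    also have "\<dots> \<le> (\<Sum>b\<in>B. hnorm ip x * (hnorm ip (u b) * hnorm ip (T b)))"
    proof (rule sum_mono)
      fix b assume b: "b \<in> B"
      have "cmod (ip x (u b)) * hnorm ip (T b) \<le> (hnorm ip x * hnorm ip (u b)) * hnorm ip (T b)"
        by (rule mult_right_mono[OF Cauchy_Schwarz[OF xH uH]]) (use Tb b in simp)
      then show "hnorm ip (cscale (ip x (u b)) (T b)) \<le> hnorm ip x * (hnorm ip (u b) * hnorm ip (T b))"
        using Tb[OF b] by (simp add: hnorm_scale mult.assoc)
    qed
    finally show "hnorm ip (T x) \<le> (\<Sum>b\<in>B. hnorm ip (u b) * hnorm ip (T b)) * hnorm ip x"
      by (simp add: sum_distrib_left mult.commute)
  qed
qed

end

section \<open>The rigged space of a filtration\<close>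

locale rigged = inner_function_space H ip for H :: "('a \<Rightarrow> complex) set" and ip +
  fixes V :: "nat \<Rightarrow> ('a \<Rightarrow> complex) set"
  assumes V_finite_span: "\<And>n. \<exists>F. finite F \<and> F \<subseteq> H \<and> V n = cfun.span F"
    and V_Suc: "\<And>n. V n \<subseteq> V (Suc n)"
begin

lemma subspace_V: "cfun.subspace (V n)"
  using V_finite_span[of n] by auto

lemma V_subset: "V n \<subseteq> H"
  using V_finite_span[of n] cfun.span_minimal[OF _ subspace_H] by auto

lemma V_in_H: "v \<in> V n \<Longrightarrow> v \<in> H"
  using V_subset by blast

lemma V_mono: "m \<le> n \<Longrightarrow> V m \<subseteq> V n"
  using lift_Suc_mono_le[of V] V_Suc by blast

lemma Phi_in_H: "g \<in> Phi V \<Longrightarrow> g \<in> H"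
  unfolding Phi_def using V_in_H by blast

lemma V_in_Phi: "g \<in> V n \<Longrightarrow> g \<in> Phi V"
  unfolding Phi_def by blast

lemma Phi_common:
  assumes "g \<in> Phi V" "h \<in> Phi V"
  obtains n where "g \<in> V n" "h \<in> V n"
proof -
  obtain m n where "g \<in> V m" "h \<in> V n" using assms by (auto simp: Phi_def)
  then show ?thesis using V_mono[of m "max m n"] V_mono[of n "max m n"] by (intro that[of "max m n"]) auto
qed

lemma subspace_Phi: "cfun.subspace (Phi V)"
proof (rule cfun.subspaceI)
  show "0 \<in> Phi V" using V_in_Phi cfun.subspace_0[OF subspace_V] .
  show "g + h \<in> Phi V" if "g \<in> Phi V" "h \<in> Phi V" for g h
    using Phi_common[OF that] V_in_Phi cfun.subspace_add[OF subspace_V] by metis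
  show "cscale c g \<in> Phi V" if "g \<in> Phi V" for c g
    using Phi_common[OF that that] V_in_Phi cfun.subspace_scale[OF subspace_V] by metis
qed

section \<open>Compatible sequences and the pairing\<close>

lemma V_determines: "g \<in> V n \<Longrightarrow> h \<in> V n \<Longrightarrow> (\<And>v. v \<in> V n \<Longrightarrow> ip v g = ip v h) \<Longrightarrow> g = h"
  by (rule ip_determines[OF subspace_V V_subset])

lemma V_Riesz: "linear_functional_on (V n) L \<Longrightarrow> \<exists>u\<in>V n. \<forall>v\<in>V n. ip v u = L v"
  using V_finite_span[of n] finite_Riesz by metis

text \<open>Rewrites projection as equality of functionals on V n; existence of the projection comes
  from finite-dimensional representation of functionals.\<close>

lemma orth_proj_eq_iff:
  assumes h: "h \<in> H"
  shows "orth_proj ip (V n) h = g \<longleftrightarrow> g \<in> V n \<and> (\<forall>v\<in>V n. ip v h = ip v g)"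
proof -
  have eq: "g \<in> V n \<and> (\<forall>v\<in>V n. ip (h - g) v = 0) \<longleftrightarrow> g \<in> V n \<and> (\<forall>v\<in>V n. ip v h = ip v g)" for g
  proof (intro conj_cong refl ball_cong)
    fix v assume "g \<in> V n" "v \<in> V n"
    then have H: "g \<in> H" "v \<in> H" by (auto dest: V_in_H)
    have "ip (h - g) v = 0 \<longleftrightarrow> ip v (h - g) = 0"
      using ip_commute[of "h - g" v] h H by simp
    then show "ip (h - g) v = 0 \<longleftrightarrow> ip v h = ip v g" using h H by (simp add: ip_diff_right)
  qed
  obtain u where u: "u \<in> V n" "\<And>v. v \<in> V n \<Longrightarrow> ip v u = ip v h"
    using V_Riesz[OF linear_functional_on_ip[OF h V_subset]] by blast
  have "orth_proj ip (V n) h = u"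
    unfolding orth_proj_def eq by (rule the_equality) (use u V_determines in auto)
  then show ?thesis using u V_determines by metis
qed

text \<open>In this form an element of \<open>Phi_star\<close> is a sequence of representers of one
  functional on Phi, restricted to the spaces V n.\<close>

lemma Phi_star_iff:
  "\<mu> \<in> Phi_star ip V \<longleftrightarrow> (\<forall>n. \<mu> n \<in> V n) \<and> (\<forall>n. \<forall>v\<in>V n. ip v (\<mu> (Suc n)) = ip v (\<mu> n))"
  using orth_proj_eq_iff V_in_H unfolding Phi_star_def mem_Collect_eq by metis

lemma Phi_star_V: "\<mu> \<in> Phi_star ip V \<Longrightarrow> \<mu> n \<in> V n"
  by (simp add: Phi_star_def)

lemma Phi_star_ip_stable:
  assumes "\<mu> \<in> Phi_star ip V" "v \<in> V n" "n \<le> m"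
  shows "ip v (\<mu> m) = ip v (\<mu> n)"
  using assms(3)
proof (induction rule: dec_induct)
  case (step k)
  then show ?case using assms(1,2) V_mono[of n k] unfolding Phi_star_iff by (metis subsetD)
qed simp

text \<open>The sequence whose limit defines the pairing is constant from index n on.\<close>

lemma pairing_eq:
  assumes "\<mu> \<in> Phi_star ip V" "v \<in> V n"
  shows "pairing ip v \<mu> = ip v (\<mu> n)"
proof -
  have "eventually (\<lambda>m. ip v (\<mu> m) = ip v (\<mu> n)) sequentially"
    unfolding eventually_sequentially using Phi_star_ip_stable[OF assms] by blast
  then show ?thesis unfolding pairing_def by (intro limI tendsto_eventually)
qed

text \<open>Phi separates the points of \<open>Phi_star\<close>; every identity between transposed
  operators is verified through this.\<close>

lemma Phi_star_eqI:
  assumes "\<mu> \<in> Phi_star ip V" "\<nu> \<in> Phi_star ip V"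
    "\<And>g. g \<in> Phi V \<Longrightarrow> pairing ip g \<mu> = pairing ip g \<nu>"
  shows "\<mu> = \<nu>"
proof
  fix n
  show "\<mu> n = \<nu> n"
  proof (rule V_determines[of _ n])
    fix v assume v: "v \<in> V n"
    show "ip v (\<mu> n) = ip v (\<nu> n)"
      using assms(3)[OF V_in_Phi[OF v]] unfolding pairing_eq[OF assms(1) v] pairing_eq[OF assms(2) v] .
  qed (use assms Phi_star_V in auto)
qed

lemma Phi_star_add: "\<mu> \<in> Phi_star ip V \<Longrightarrow> \<nu> \<in> Phi_star ip V \<Longrightarrow> \<mu> + \<nu> \<in> Phi_star ip V"
proof -
  assume *: "\<mu> \<in> Phi_star ip V" "\<nu> \<in> Phi_star ip V"
  then have H: "\<mu> n \<in> H" "\<nu> n \<in> H" for n using Phi_star_V V_in_H by blast+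
  show ?thesis
    unfolding Phi_star_iff plus_fun_apply[of \<mu> \<nu>]
  proof (intro conjI allI ballI)
    show "\<mu> n + \<nu> n \<in> V n" for n
      by (rule cfun.subspace_add[OF subspace_V]) (use * Phi_star_V in auto)
    show "ip v (\<mu> (Suc n) + \<nu> (Suc n)) = ip v (\<mu> n + \<nu> n)" if "v \<in> V n" for n v
      unfolding ip_add_right[OF H V_in_H[OF that]] using * that by (simp add: Phi_star_iff)
  qed
qed

lemma Phi_star_scale: "\<mu> \<in> Phi_star ip V \<Longrightarrow> cscale_seq c \<mu> \<in> Phi_star ip V"
proof -
  assume *: "\<mu> \<in> Phi_star ip V"
  then have H: "\<mu> n \<in> H" for n using Phi_star_V V_in_H by blast
  show ?thesis
    unfolding Phi_star_iff cscale_seq_def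
  proof (intro conjI allI ballI)
    show "cscale c (\<mu> n) \<in> V n" for n
      by (rule cfun.subspace_scale[OF subspace_V]) (use * Phi_star_V in auto)
    show "ip v (cscale c (\<mu> (Suc n))) = ip v (cscale c (\<mu> n))" if "v \<in> V n" for n v
      unfolding ip_scale_right[OF H V_in_H[OF that]] using * that by (simp add: Phi_star_iff)
  qed
qed

lemma Phi_star_0: "0 \<in> Phi_star ip V"
  unfolding Phi_star_iff using cfun.subspace_0[OF subspace_V] by auto

lemma Phi_star_sum: "(\<And>i. i \<in> X \<Longrightarrow> \<mu> i \<in> Phi_star ip V) \<Longrightarrow> (\<Sum>i\<in>X. \<mu> i) \<in> Phi_star ip V"
  by (induction X rule: infinite_finite_induct) (auto simp: Phi_star_0 Phi_star_add)

lemma pairing_add_left: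
  assumes "\<mu> \<in> Phi_star ip V" "g \<in> Phi V" "h \<in> Phi V"
  shows "pairing ip (g + h) \<mu> = pairing ip g \<mu> + pairing ip h \<mu>"
proof -
  obtain n where n: "g \<in> V n" "h \<in> V n" using Phi_common assms by blast
  then show ?thesis
    using cfun.subspace_add[OF subspace_V n] assms(1) V_in_H Phi_star_V[OF assms(1), of n]
    by (simp add: pairing_eq[OF assms(1), of _ n] ip_add_left)
qed

lemma pairing_scale_left:
  assumes "\<mu> \<in> Phi_star ip V" "g \<in> Phi V"
  shows "pairing ip (cscale c g) \<mu> = c * pairing ip g \<mu>"
proof -
  obtain n where n: "g \<in> V n" using Phi_common assms by blast
  then show ?thesis
    using cfun.subspace_scale[OF subspace_V n] assms(1) V_in_H Phi_star_V[OF assms(1), of n]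
    by (simp add: pairing_eq[OF assms(1), of _ n] ip_scale_left)
qed

lemma linear_functional_on_pairing:
  "\<mu> \<in> Phi_star ip V \<Longrightarrow> linear_functional_on (Phi V) (\<lambda>g. pairing ip g \<mu>)"
  by (simp add: linear_functional_on_def pairing_add_left pairing_scale_left)

lemma pairing_add_right:
  assumes "\<mu> \<in> Phi_star ip V" "\<nu> \<in> Phi_star ip V" "g \<in> Phi V"
  shows "pairing ip g (\<mu> + \<nu>) = pairing ip g \<mu> + pairing ip g \<nu>"
proof -
  obtain n where n: "g \<in> V n" using Phi_common assms by blast
  then show ?thesis
    using assms Phi_star_add[OF assms(1,2)] V_in_H Phi_star_V[OF assms(1), of n] Phi_star_V[OF assms(2), of n]
    by (simp add: pairing_eq[of _ _ n] ip_add_right)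
qed

lemma pairing_scale_right:
  assumes "\<mu> \<in> Phi_star ip V" "g \<in> Phi V"
  shows "pairing ip g (cscale_seq c \<mu>) = cnj c * pairing ip g \<mu>"
proof -
  obtain n where n: "g \<in> V n" using Phi_common assms by blast
  then show ?thesis
    using assms Phi_star_scale[OF assms(1)] V_in_H Phi_star_V[OF assms(1), of n]
    by (simp add: pairing_eq[of _ _ n] ip_scale_right cscale_seq_def)
qed

lemma pairing_0_right: "g \<in> Phi V \<Longrightarrow> pairing ip g 0 = 0"
  using pairing_scale_right[OF Phi_star_0, of g 0] by (simp add: cscale_seq_def zero_fun_def cscale_def)

lemma pairing_sum_right:
  "(\<And>i. i \<in> X \<Longrightarrow> \<mu> i \<in> Phi_star ip V) \<Longrightarrow> g \<in> Phi V \<Longrightarrow>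
    pairing ip g (\<Sum>i\<in>X. \<mu> i) = (\<Sum>i\<in>X. pairing ip g (\<mu> i))"
  by (induction X rule: infinite_finite_induct)
    (auto simp: pairing_0_right pairing_add_right Phi_star_sum)

section \<open>Phi_star as the conjugate algebraic dual of Phi\<close>

definition represent :: "(('a \<Rightarrow> complex) \<Rightarrow> complex) \<Rightarrow> nat \<Rightarrow> 'a \<Rightarrow> complex" where
  "represent L = (\<lambda>n. SOME u. u \<in> V n \<and> (\<forall>v\<in>V n. ip v u = L v))"

text \<open>The n-th component represents the restriction of L to V n. Every linear functional on
  Phi qualifies, since finite dimension of V n makes the restrictions representable without any
  continuity assumption.\<close>

lemma represent:
  assumes "linear_functional_on (Phi V) L"
  shows represent_V: "represent L n \<in> V n" and ip_represent: "\<And>v. v \<in> V n \<Longrightarrow> ip v (represent L n) = L v"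
proof -
  have "linear_functional_on (V n) L"
    by (rule linear_functional_on_mono[OF assms]) (auto simp: Phi_def)
  then have "\<exists>u. u \<in> V n \<and> (\<forall>v\<in>V n. ip v u = L v)" using V_Riesz by blast
  then have "represent L n \<in> V n \<and> (\<forall>v\<in>V n. ip v (represent L n) = L v)"
    unfolding represent_def by (rule someI_ex)
  then show "represent L n \<in> V n" "\<And>v. v \<in> V n \<Longrightarrow> ip v (represent L n) = L v"
    by blast+
qed

lemma represent_Phi_star: "linear_functional_on (Phi V) L \<Longrightarrow> represent L \<in> Phi_star ip V"
  unfolding Phi_star_iff using V_Suc by (simp add: represent_V ip_represent subset_iff)

lemma pairing_represent:
  assumes "linear_functional_on (Phi V) L" "g \<in> Phi V"
  shows "pairing ip g (represent L) = L g"
proof -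
  obtain n where "g \<in> V n" using Phi_common assms(2) by blast
  then show ?thesis
    using pairing_eq[OF represent_Phi_star[OF assms(1)]] ip_represent[OF assms(1)] by simp
qed

text \<open>Linearity is required on all functions and not only on Phi, so that the theory of linear
  maps applies directly; invariance concerns the spaces V n alone.\<close>

definition filtered :: "(('a \<Rightarrow> complex) \<Rightarrow> 'a \<Rightarrow> complex) \<Rightarrow> bool" where
  "filtered T \<longleftrightarrow> Vector_Spaces.linear cscale cscale T \<and> (\<forall>n. \<forall>x\<in>V n. T x \<in> V n)"

lemma filtered_linear: "filtered T \<Longrightarrow> T (g + h) = T g + T h" "filtered T \<Longrightarrow> T (cscale c g) = cscale c (T g)"
  "filtered T \<Longrightarrow> T (g - h) = T g - T h" "filtered T \<Longrightarrow> T 0 = 0"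
proof -
  assume "filtered T"
  then interpret Vector_Spaces.linear cscale cscale T by (simp add: filtered_def)
  show "T (g + h) = T g + T h" "T (cscale c g) = cscale c (T g)" "T (g - h) = T g - T h" "T 0 = 0"
    by (rule add scale diff zero)+
qed

lemma filtered_V: "filtered T \<Longrightarrow> x \<in> V n \<Longrightarrow> T x \<in> V n"
  by (simp add: filtered_def)

lemma filtered_Phi: "filtered T \<Longrightarrow> x \<in> Phi V \<Longrightarrow> T x \<in> Phi V"
  by (auto simp: Phi_def filtered_def)

lemma filtered_bounded: "filtered T \<Longrightarrow> \<exists>C\<ge>0. \<forall>x\<in>V n. hnorm ip (T x) \<le> C * hnorm ip x"
proof -
  assume T: "filtered T"
  obtain F where F: "finite F" "F \<subseteq> H" "V n = cfun.span F" using V_finite_span by blast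
  obtain C where C: "\<And>x. x \<in> V n \<Longrightarrow> hnorm ip (T x) \<le> C * hnorm ip x"
    using finite_span_bounded[OF F(1,2), of T] T V_in_H F(3) unfolding filtered_def by metis
  have "hnorm ip (T x) \<le> \<bar>C\<bar> * hnorm ip x" if "x \<in> V n" for x
    using C[OF that] mult_right_mono[of C "\<bar>C\<bar>" "hnorm ip x"] V_in_H[OF that] by force
  then show ?thesis by (intro exI[of _ "\<bar>C\<bar>"]) auto
qed

lemma filtered_continuous_V:
  assumes "filtered T"
  shows "continuous_map (subtopology (htop H ip) (V n)) (subtopology (htop H ip) (V n)) T"
proof -
  obtain C where C: "\<And>x. x \<in> V n \<Longrightarrow> hnorm ip (T x) \<le> C * hnorm ip x"
    using filtered_bounded[OF assms] by metis
  have "continuous_map (subtopology (htop H ip) (V n)) (htop H ip) T"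
    by (rule continuous_map_bounded[OF subspace_V V_subset V_in_H[OF filtered_V[OF assms]]
          filtered_linear(3)[OF assms] C])
  then show ?thesis
    using filtered_V[OF assms] by (auto simp: continuous_map_in_subtopology)
qed

lemma topspace_Phi_top [simp]: "topspace (Phi_top H ip V) = Phi V"
proof
  show "topspace (Phi_top H ip V) \<subseteq> Phi V"
    using openin_topspace[of "Phi_top H ip V"] by (simp only: openin_Phi_top)
  have "Phi V \<inter> V n = topspace (subtopology (htop H ip) (V n))" for n
    using V_subset by (auto simp: Phi_def)
  then have "openin (Phi_top H ip V) (Phi V)"
    unfolding openin_Phi_top by (metis openin_topspace subset_refl)
  then show "Phi V \<subseteq> topspace (Phi_top H ip V)" by (rule openin_subset)
qed

text \<open>In the final topology a preimage is tested on each V n, where it is the preimage under a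
  continuous map of V n to itself.\<close>

lemma filtered_cont_linear_op:
  assumes "filtered T"
  shows "cont_linear_op cscale (Phi_top H ip V) T"
  unfolding cont_linear_op_def
proof (intro conjI)
  show "T \<in> topspace (Phi_top H ip V) \<rightarrow> topspace (Phi_top H ip V)"
    using filtered_Phi[OF assms] by simp
  show "clinear_on cscale (topspace (Phi_top H ip V)) T"
    using filtered_linear[OF assms] by (simp add: clinear_on_def)
  show "continuous_map (Phi_top H ip V) (Phi_top H ip V) T"
    unfolding continuous_map_def
  proof (intro conjI allI impI)
    show "T \<in> topspace (Phi_top H ip V) \<rightarrow> topspace (Phi_top H ip V)"
      using filtered_Phi[OF assms] by simp
    fix U assume U: "openin (Phi_top H ip V) U"
    show "openin (Phi_top H ip V) {x \<in> topspace (Phi_top H ip V). T x \<in> U}"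
      unfolding openin_Phi_top
    proof (intro conjI allI)
      fix n
      have "openin (subtopology (htop H ip) (V n)) (U \<inter> V n)" using U by (simp add: openin_Phi_top)
      then have "openin (subtopology (htop H ip) (V n))
          {x \<in> topspace (subtopology (htop H ip) (V n)). T x \<in> U \<inter> V n}"
        using filtered_continuous_V[OF assms] openin_continuous_map_preimage by blast
      also have "{x \<in> topspace (subtopology (htop H ip) (V n)). T x \<in> U \<inter> V n} =
          {x \<in> topspace (Phi_top H ip V). T x \<in> U} \<inter> V n"
        using filtered_V[OF assms] V_in_H V_in_Phi by auto
      finally show "openin (subtopology (htop H ip) (V n)) ({x \<in> topspace (Phi_top H ip V). T x \<in> U} \<inter> V n)" .
    qed auto
  qed
qed

lemma topspace_Phi_star_top [simp]: "topspace (Phi_star_top H ip V) = Phi_star ip V"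
  using V_subset Phi_star_V by (auto simp: Phi_star_top_def PiE_iff)

section \<open>Transposed operators on Phi_star\<close>

definition dual :: "(('a \<Rightarrow> complex) \<Rightarrow> 'a \<Rightarrow> complex) \<Rightarrow> (nat \<Rightarrow> 'a \<Rightarrow> complex) \<Rightarrow> nat \<Rightarrow> 'a \<Rightarrow> complex" where
  "dual T \<mu> = represent (\<lambda>g. pairing ip (T g) \<mu>)"

lemma linear_functional_on_pairing_filtered:
  assumes "filtered T" "\<mu> \<in> Phi_star ip V"
  shows "linear_functional_on (Phi V) (\<lambda>g. pairing ip (T g) \<mu>)"
  using assms filtered_Phi[OF assms(1)] filtered_linear[OF assms(1)]
  by (simp add: linear_functional_on_def pairing_add_left pairing_scale_left)

lemma dual_Phi_star: "filtered T \<Longrightarrow> \<mu> \<in> Phi_star ip V \<Longrightarrow> dual T \<mu> \<in> Phi_star ip V"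
  unfolding dual_def by (intro represent_Phi_star linear_functional_on_pairing_filtered)

lemma pairing_dual:
  "filtered T \<Longrightarrow> \<mu> \<in> Phi_star ip V \<Longrightarrow> g \<in> Phi V \<Longrightarrow> pairing ip g (dual T \<mu>) = pairing ip (T g) \<mu>"
  unfolding dual_def by (intro pairing_represent linear_functional_on_pairing_filtered)

lemma ip_dual:
  assumes "filtered T" "\<mu> \<in> Phi_star ip V" "v \<in> V n"
  shows "ip v (dual T \<mu> n) = ip (T v) (\<mu> n)"
  using assms by (metis pairing_dual pairing_eq dual_Phi_star filtered_V V_in_Phi)

lemma dual_clinear_on: "filtered T \<Longrightarrow> clinear_on cscale_seq (Phi_star ip V) (dual T)"
  unfolding clinear_on_def
  by (intro conjI ballI allI Phi_star_eqI)
    (simp_all add: dual_Phi_star Phi_star_add Phi_star_scale pairing_dual pairing_add_right pairing_scale_right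
      filtered_Phi)

lemma diff_eq_add_cscale_seq: "\<mu> - \<nu> = \<mu> + cscale_seq (- 1) \<nu>"
  by (auto simp: cscale_seq_def cscale_def fun_eq_iff)

lemma dual_diff:
  assumes "filtered T" "\<mu> \<in> Phi_star ip V" "\<nu> \<in> Phi_star ip V"
  shows "dual T (\<mu> - \<nu>) = dual T \<mu> - dual T \<nu>"
proof -
  have "dual T (\<mu> + cscale_seq (- 1) \<nu>) = dual T \<mu> + cscale_seq (- 1) (dual T \<nu>)"
    using dual_clinear_on[OF assms(1)] assms Phi_star_scale unfolding clinear_on_def by simp
  then show ?thesis by (simp only: diff_eq_add_cscale_seq)
qed

text \<open>The n-th component is the adjoint of the restriction of T to V n, applied to \<mu> n,
  hence obeys the same bound. The proof tests it against itself and divides by its norm.\<close>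

lemma hnorm_dual:
  assumes T: "filtered T" and \<mu>: "\<mu> \<in> Phi_star ip V"
    and C: "C \<ge> 0" "\<And>x. x \<in> V n \<Longrightarrow> hnorm ip (T x) \<le> C * hnorm ip x"
  shows "hnorm ip (dual T \<mu> n) \<le> C * hnorm ip (\<mu> n)"
proof -
  define z where "z = dual T \<mu> n"
  have z: "z \<in> V n" unfolding z_def by (rule Phi_star_V[OF dual_Phi_star[OF T \<mu>]])
  have H: "z \<in> H" "\<mu> n \<in> H" "T z \<in> H" using z Phi_star_V[OF \<mu>] filtered_V[OF T z] by (auto dest: V_in_H)
  have "(hnorm ip z)\<^sup>2 = cmod (ip z z)" using ip_self[OF H(1)] by (simp only: norm_of_real) simp
  also have "\<dots> = cmod (ip (T z) (\<mu> n))" using ip_dual[OF T \<mu> z] by (simp add: z_def)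
  also have "\<dots> \<le> hnorm ip (T z) * hnorm ip (\<mu> n)" by (rule Cauchy_Schwarz) (use H in auto)
  also have "\<dots> \<le> (C * hnorm ip z) * hnorm ip (\<mu> n)" by (rule mult_right_mono) (use C z H in auto)
  finally have *: "hnorm ip z * hnorm ip z \<le> hnorm ip z * (C * hnorm ip (\<mu> n))"
    by (simp add: power2_eq_square mult_ac)
  show ?thesis
  proof (cases "hnorm ip z = 0")
    case True
    then show ?thesis using C H by (simp add: z_def)
  next
    case False
    then have "hnorm ip z > 0" using hnorm_nonneg[OF H(1)] by linarith
    then show ?thesis using * mult_le_cancel_left_pos unfolding z_def by blast
  qed
qed

text \<open>Since T preserves V n, the n-th component of the image is controlled by the n-th
  component of the argument alone; that is exactly continuity for the product topology.\<close>

lemma dual_cont_linear_op: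
  assumes T: "filtered T"
  shows "cont_linear_op cscale_seq (Phi_star_top H ip V) (dual T)"
proof -
  let ?X = "Phi_star_top H ip V"
  have "continuous_map ?X (subtopology (htop H ip) (V n)) (\<lambda>\<mu>. dual T \<mu> n)" for n
  proof -
    have coord: "continuous_map ?X (htop H ip) (\<lambda>\<mu>. \<mu> n)"
      unfolding Phi_star_top_def
      by (intro continuous_map_from_subtopology continuous_map_into_fulltopology
          [OF continuous_map_product_projection[of n UNIV "\<lambda>n. subtopology (htop H ip) (V n)"]]) auto
    obtain C where C: "C \<ge> 0" "\<And>x. x \<in> V n \<Longrightarrow> hnorm ip (T x) \<le> C * hnorm ip x"
      using filtered_bounded[OF T] by metis
    have "continuous_map ?X (htop H ip) (\<lambda>\<mu>. dual T \<mu> n)"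
      unfolding htop_def continuous_map_to_metric
    proof (intro ballI allI impI)
      fix \<mu> and e :: real assume "\<mu> \<in> topspace ?X" and e: "e > 0"
      then have \<mu>: "\<mu> \<in> Phi_star ip V" by simp
      define \<delta> where "\<delta> = e / (C + 1)"
      have \<delta>: "\<delta> > 0" using e C by (simp add: \<delta>_def)
      obtain U where U: "openin ?X U" "\<mu> \<in> U" "\<And>\<nu>. \<nu> \<in> U \<Longrightarrow> \<nu> n \<in> mball (\<mu> n) \<delta>"
        using coord \<mu> \<delta> unfolding htop_def continuous_map_to_metric by (metis topspace_Phi_star_top)
      have "dual T \<nu> n \<in> mball (dual T \<mu> n) e" if \<nu>U: "\<nu> \<in> U" for \<nu>
      proof -
        have \<nu>: "\<nu> \<in> Phi_star ip V" using openin_subset[OF U(1)] \<nu>U by auto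
        have H: "dual T \<mu> n \<in> H" "dual T \<nu> n \<in> H" "\<mu> n \<in> H" "\<nu> n \<in> H"
          using Phi_star_V \<mu> \<nu> dual_Phi_star[OF T] V_in_H by blast+
        have d: "\<mu> - \<nu> \<in> Phi_star ip V"
          unfolding diff_eq_add_cscale_seq by (rule Phi_star_add[OF \<mu> Phi_star_scale[OF \<nu>]])
        have "hnorm ip (dual T \<mu> n - dual T \<nu> n) \<le> C * hnorm ip (\<mu> n - \<nu> n)"
          using hnorm_dual[OF T d C] dual_diff[OF T \<mu> \<nu>] by simp
        also have "\<dots> \<le> (C + 1) * hnorm ip (\<mu> n - \<nu> n)" by (rule mult_right_mono) (use H in auto)
        also have "\<dots> < e"
          using U(3)[OF \<nu>U] C(1) H by (simp add: hdist_def \<delta>_def pos_less_divide_eq mult.commute)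
        finally show ?thesis using H by (simp add: hdist_def)
      qed
      then show "\<exists>U. openin ?X U \<and> \<mu> \<in> U \<and> (\<forall>\<nu>\<in>U. dual T \<nu> n \<in> mball (dual T \<mu> n) e)" using U by blast
    qed
    then show ?thesis
      using dual_Phi_star[OF T] Phi_star_V by (auto simp: continuous_map_in_subtopology)
  qed
  then have "continuous_map ?X (product_topology (\<lambda>n. subtopology (htop H ip) (V n)) UNIV) (dual T)"
    by (simp add: continuous_map_componentwise_UNIV)
  then have "continuous_map ?X ?X (dual T)"
    using dual_Phi_star[OF T] by (subst (2) Phi_star_top_def) (auto simp: continuous_map_in_subtopology)
  then show ?thesis
    using dual_Phi_star[OF T] dual_clinear_on[OF T] by (simp add: cont_linear_op_def)
qed

text \<open>Agreement of the pairings on all of V n makes the n-th components equal from some index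
  on. That index may depend on n but not on the vector of V n.\<close>

lemma limitin_Phi_star_top:
  assumes "\<And>m. s m \<in> Phi_star ip V" "\<mu> \<in> Phi_star ip V"
    "\<And>n. \<exists>M. \<forall>m\<ge>M. \<forall>v\<in>V n. pairing ip v (s m) = pairing ip v \<mu>"
  shows "limitin (Phi_star_top H ip V) s \<mu> sequentially"
  unfolding Phi_star_top_def limitin_subtopology limitin_componentwise
proof (intro conjI ballI)
  fix n
  obtain M where M: "\<And>m v. m \<ge> M \<Longrightarrow> v \<in> V n \<Longrightarrow> pairing ip v (s m) = pairing ip v \<mu>"
    using assms(3) by blast
  have "s m n = \<mu> n" if "m \<ge> M" for m
  proof (rule V_determines[of _ n])
    fix v assume v: "v \<in> V n"
    show "ip v (s m n) = ip v (\<mu> n)"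
      using M[OF that v] unfolding pairing_eq[OF assms(1) v] pairing_eq[OF assms(2) v] .
  qed (use assms(1,2) Phi_star_V in auto)
  then show "limitin (htop H ip) (\<lambda>m. s m n) (\<mu> n) sequentially"
    using Phi_star_V[OF assms(2)] V_in_H
    by (intro limitin_eventually) (auto simp: eventually_sequentially)
next
  have "s m \<in> topspace (product_topology (\<lambda>n. subtopology (htop H ip) (V n)) UNIV)" for m
    using Phi_star_V[OF assms(1)] V_in_H by (auto simp: PiE_iff)
  then show "\<forall>\<^sub>F m in sequentially. s m \<in> topspace (product_topology (\<lambda>n. subtopology (htop H ip) (V n)) UNIV)"
    by simp
qed (use assms Phi_star_V in auto)

text \<open>The pairings prescribe every value on \<open>Phi_star\<close>, and extensionality fixes
  the rest; restriction of the transpose supplies existence.\<close>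

lemma ext_unique:
  assumes T: "filtered T" and A: "\<And>g. g \<in> Phi V \<Longrightarrow> T g = A g"
  shows "(THE E. E \<in> extensional (Phi_star ip V) \<and> cont_linear_op cscale_seq (Phi_star_top H ip V) E \<and>
      (\<forall>g\<in>Phi V. \<forall>\<mu>\<in>Phi_star ip V. pairing ip g (E \<mu>) = pairing ip (A g) \<mu>)) =
    restrict (dual T) (Phi_star ip V)"
proof (rule the_equality)
  let ?R = "restrict (dual T) (Phi_star ip V)"
  have cont: "cont_linear_op cscale_seq (Phi_star_top H ip V) (dual T)" by (rule dual_cont_linear_op[OF T])
  have "continuous_map (Phi_star_top H ip V) (Phi_star_top H ip V) ?R"
    by (rule continuous_map_eq[of _ _ "dual T"]) (use cont in \<open>simp_all add: cont_linear_op_def\<close>)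
  then have "cont_linear_op cscale_seq (Phi_star_top H ip V) ?R"
    using dual_clinear_on[OF T] dual_Phi_star[OF T]
    by (auto simp: cont_linear_op_def clinear_on_def Phi_star_add Phi_star_scale)
  then show "?R \<in> extensional (Phi_star ip V) \<and> cont_linear_op cscale_seq (Phi_star_top H ip V) ?R \<and>
      (\<forall>g\<in>Phi V. \<forall>\<mu>\<in>Phi_star ip V. pairing ip g (?R \<mu>) = pairing ip (A g) \<mu>)"
    by (simp add: pairing_dual[OF T] A)
  fix E assume E: "E \<in> extensional (Phi_star ip V) \<and> cont_linear_op cscale_seq (Phi_star_top H ip V) E \<and>
      (\<forall>g\<in>Phi V. \<forall>\<mu>\<in>Phi_star ip V. pairing ip g (E \<mu>) = pairing ip (A g) \<mu>)"
  show "E = ?R"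
  proof (rule extensionalityI[of _ "Phi_star ip V"])
    fix \<mu> assume \<mu>: "\<mu> \<in> Phi_star ip V"
    have "E \<mu> = dual T \<mu>"
    proof (rule Phi_star_eqI)
      show "E \<mu> \<in> Phi_star ip V" using E \<mu> by (auto simp: cont_linear_op_def)
      show "pairing ip g (E \<mu>) = pairing ip g (dual T \<mu>)" if "g \<in> Phi V" for g
        using E \<mu> that by (simp add: pairing_dual[OF T] A)
    qed (rule dual_Phi_star[OF T \<mu>])
    then show "E \<mu> = ?R \<mu>" using \<mu> by simp
  qed (use E in auto)
qed

text \<open>The operator of interest is meaningful on Phi only. It is replaced by a total linear map
  with the same values there, so that the decomposition for operators on a vector space can be
  used.\<close>

lemma ex_filtered_extension:
  assumes "clinear_on cscale (Phi V) A" "\<forall>n. \<forall>g\<in>V n. A g \<in> V n"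
  obtains T where "filtered T" "\<And>g. g \<in> Phi V \<Longrightarrow> T g = A g"
proof -
  interpret vp: vector_space_pair "cscale :: complex \<Rightarrow> ('a \<Rightarrow> complex) \<Rightarrow> _" "cscale :: complex \<Rightarrow> ('a \<Rightarrow> complex) \<Rightarrow> _" ..
  obtain B where B: "B \<subseteq> Phi V" "cfun.independent B" "Phi V \<subseteq> cfun.span B"
    using cfun.maximal_independent_subset[of "Phi V"] by blast
  define T where "T = vp.construct B A"
  have lin: "Vector_Spaces.linear cscale cscale T"
    unfolding T_def by (rule vp.linear_construct[OF B(2)])
  have eq: "T g = A g \<and> g \<in> Phi V" if "g \<in> cfun.span B" for g
    using that
  proof (induction rule: cfun.span_induct_alt)
    case base
    have "A 0 = A (cscale 0 0)" by (simp only: cfun.scale_zero_left)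
    also have "\<dots> = cscale 0 (A 0)"
      using assms(1) cfun.subspace_0[OF subspace_Phi] unfolding clinear_on_def by blast
    finally show ?case
      using vp.linear_0[OF lin] cfun.subspace_0[OF subspace_Phi] by (simp only: cfun.scale_zero_left)
  next
    case (step c b y)
    have mem: "b \<in> Phi V" "y \<in> Phi V" "cscale c b \<in> Phi V"
      using step B(1) cfun.subspace_scale[OF subspace_Phi] by auto
    have "T (cscale c b + y) = cscale c (A b) + A y"
      unfolding vp.linear_add[OF lin] vp.linear_scale[OF lin] conjunct1[OF step(2)]
      using vp.construct_basis[OF B(2) step(1)] by (simp only: T_def)
    also have "\<dots> = A (cscale c b + y)"
      using assms(1) mem unfolding clinear_on_def by simp
    finally show ?case using mem cfun.subspace_add[OF subspace_Phi] by blast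
  qed
  then have "T g = A g" if "g \<in> Phi V" for g using that B(3) by blast
  moreover from this have "filtered T"
    unfolding filtered_def using lin assms(2) V_in_Phi by simp
  ultimately show ?thesis using that by blast
qed

text \<open>The vectors \<open>u i\<close> represent the coordinate functionals of the nested bases,
  and everything on \<open>Phi_star\<close> is the transpose of its counterpart on Phi. The index
  set I may be finite, which is why partial sums run over its intersection with {1..m}.\<close>

theorem ex_rigged_Jordan_decomposition:
  fixes A :: "('a \<Rightarrow> complex) \<Rightarrow> 'a \<Rightarrow> complex" and r :: "nat \<Rightarrow> nat" and I :: "nat set"
  assumes A: "clinear_on cscale (Phi V) A" "\<forall>n. \<forall>g\<in>V n. A g \<in> V n"
    and E: "E = (THE T. T \<in> extensional (Phi_star ip V) \<and>
      cont_linear_op cscale_seq (Phi_star_top H ip V) T \<and>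
      (\<forall>g\<in>Phi V. \<forall>\<mu>\<in>Phi_star ip V. pairing ip g (T \<mu>) = pairing ip (A g) \<mu>))"
  defines "r \<equiv> (\<lambda>n. cfun.dim (V n))"
    and "I \<equiv> {i. 1 \<le> i \<and> (\<exists>n. i \<le> r n)}"
  shows "\<exists>Sx Nx S N.
        cont_linear_op cscale_seq (Phi_star_top H ip V) Sx \<and>
        cont_linear_op cscale_seq (Phi_star_top H ip V) Nx \<and>
        cont_linear_op cscale (Phi_top H ip V) S \<and>
        cont_linear_op cscale (Phi_top H ip V) N \<and>
        (\<forall>\<mu>\<in>Phi_star ip V. E \<mu> = Sx \<mu> + Nx \<mu>) \<and>
        (\<forall>g\<in>Phi V. A g = S g + N g) \<and>
        (\<exists>(\<gamma> :: nat \<Rightarrow> complex) w u.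
           (\<forall>i\<in>I. w i \<in> Phi V \<and> u i \<in> Phi_star ip V) \<and>
           (\<forall>n. inj_on w {1..r n} \<and> cfun.independent (w ` {1..r n}) \<and>
                cfun.span (w ` {1..r n}) = V n) \<and>
           (\<forall>i\<in>I. Sx (u i) = cscale_seq (\<gamma> i) (u i) \<and> S (w i) = cscale (cnj (\<gamma> i)) (w i)) \<and>
           (\<forall>i\<in>I. \<forall>j\<in>I. pairing ip (w j) (u i) = (if i = j then 1 else 0)) \<and>
           (\<forall>\<mu>\<in>Phi_star ip V.
              limitin (Phi_star_top H ip V)
                (\<lambda>m. \<Sum>i\<in>I \<inter> {1..m}. cscale_seq (\<gamma> i * cnj (pairing ip (w i) \<mu>)) (u i))
                (Sx \<mu>) sequentially) \<and>
           (\<forall>g\<in>Phi V.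
              limitin (Phi_top H ip V)
                (\<lambda>m. \<Sum>i\<in>I \<inter> {1..m}. cscale (cnj (\<gamma> i) * pairing ip g (u i)) (w i))
                (S g) sequentially)) \<and>
        (\<forall>\<mu>\<in>Phi_star ip V.
           limitin (Phi_star_top H ip V) (\<lambda>n. (Nx ^^ n) \<mu>) 0 sequentially) \<and>
        (\<forall>g\<in>Phi V. \<exists>n. (N ^^ n) g = 0) \<and>
        (\<forall>g\<in>Phi V. S (N g) = N (S g)) \<and>
        (\<forall>\<mu>\<in>Phi_star ip V. Sx (Nx \<mu>) = Nx (Sx \<mu>))"
proof -
  obtain T where T: "filtered T" "\<And>g. g \<in> Phi V \<Longrightarrow> T g = A g"
    using ex_filtered_extension[OF A] by blast
  interpret T: complex_operator cscale T
    by (intro complex_operator.intro complex_operator_axioms.intro cfun.vector_space_axioms)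
      (use T(1) in \<open>simp add: filtered_def\<close>)
  have fin: "\<exists>F. finite F \<and> V n \<subseteq> cfun.span F" for n using V_finite_span[of n] by auto
  have inv: "T x \<in> V n" if "x \<in> V n" for n x by (rule filtered_V[OF T(1) that])
  have "\<exists>S (w :: nat \<Rightarrow> 'a \<Rightarrow> complex) \<theta>. Vector_Spaces.linear cscale cscale S \<and>
    (\<forall>n. \<forall>x\<in>V n. S x \<in> V n \<and> S (T x) = T (S x)) \<and>
    (\<forall>n. \<exists>m. \<forall>x\<in>V n. ((\<lambda>x. T x - S x) ^^ m) x = 0) \<and>
    (\<forall>n. inj_on w {1..r n} \<and> cfun.independent (w ` {1..r n}) \<and> cfun.span (w ` {1..r n}) = V n) \<and>
    (\<forall>n. \<forall>i\<in>{1..r n}. S (w i) = cscale (\<theta> i) (w i))"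
    unfolding r_def by (rule T.ex_adapted_Jordan_decomposition[of V, OF subspace_V _ V_Suc fin])
      (rule inv)
  then obtain S and w :: "nat \<Rightarrow> 'a \<Rightarrow> complex" and \<theta> where linS: "Vector_Spaces.linear cscale cscale S"
    and S': "\<forall>n. \<forall>x\<in>V n. S x \<in> V n \<and> S (T x) = T (S x)"
    and nil: "\<forall>n. \<exists>m. \<forall>x\<in>V n. ((\<lambda>x. T x - S x) ^^ m) x = 0"
    and w': "\<forall>n. inj_on w {1..r n} \<and> cfun.independent (w ` {1..r n}) \<and> cfun.span (w ` {1..r n}) = V n"
    and eig': "\<forall>n. \<forall>i\<in>{1..r n}. S (w i) = cscale (\<theta> i) (w i)"
    by (elim exE conjE) (rule that; assumption)
  from S' have SV: "\<And>n x. x \<in> V n \<Longrightarrow> S x \<in> V n" and ST: "\<And>n x. x \<in> V n \<Longrightarrow> S (T x) = T (S x)"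
    by blast+
  from w' have w: "\<And>n. inj_on w {1..r n}" "\<And>n. cfun.independent (w ` {1..r n})"
    "\<And>n. cfun.span (w ` {1..r n}) = V n" by blast+
  from eig' have eig: "\<And>n i. i \<in> {1..r n} \<Longrightarrow> S (w i) = cscale (\<theta> i) (w i)" by blast
  define N where "N = (\<lambda>x. T x - S x)"
  have S: "filtered S" using linS SV by (simp add: filtered_def)
  have N: "filtered N"
    unfolding filtered_def N_def
    using T.linear_compose_sub[OF T.lin linS] cfun.subspace_diff[OF subspace_V] filtered_V[OF T(1)] SV by blast
  have SN: "S (N g) = N (S g)" if "g \<in> Phi V" for g
    using that ST by (auto simp: N_def Phi_def filtered_linear[OF S])
  have N_pow_V: "(N ^^ m) x \<in> V n" if "x \<in> V n" for m n x
    by (induction m) (use that filtered_V[OF N] in auto)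
  have IV: "\<exists>n. i \<in> {1..r n}" if "i \<in> I" for i using that by (auto simp: I_def)
  have wV: "w i \<in> V n" if "i \<in> {1..r n}" for i n
    using w(3)[of n] that cfun.span_base[of "w i" "w ` {1..r n}"] by blast
  have wPhi: "w i \<in> Phi V" if "i \<in> I" for i using IV[OF that] wV V_in_Phi by blast
  have r_mono: "r m \<le> r n" if "m \<le> n" for m n
  proof -
    have "w ` {1..r m} \<subseteq> cfun.span (w ` {1..r n})" using V_mono[OF that] wV w(3) by blast
    then have "card (w ` {1..r m}) \<le> card (w ` {1..r n})"
      using cfun.independent_span_bound[OF _ w(2)] by blast
    then show ?thesis using w(1) by (simp add: card_image)
  qed
  have rI: "{1..r n} \<subseteq> I" for n by (auto simp: I_def)
  have injI: "inj_on w I"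
  proof (rule inj_onI)
    fix i j assume ij: "i \<in> I" "j \<in> I" and eq: "w i = w j"
    obtain m n where "i \<in> {1..r m}" "j \<in> {1..r n}" using IV ij by blast
    then have "i \<in> {1..r (max m n)}" "j \<in> {1..r (max m n)}"
      using r_mono[of m "max m n"] r_mono[of n "max m n"] by auto
    then show "i = j" using w(1)[of "max m n"] eq by (auto dest: inj_onD)
  qed
  define W where "W = w ` I"
  have "I = (\<Union>n. {1..r n})" by (auto simp: I_def)
  then have WU: "W = (\<Union>n. w ` {1..r n})" by (simp only: W_def image_UN)
  have indep: "cfun.independent W"
    unfolding WU
  proof (rule cfun.independent_Union_directed)
    fix c d assume "c \<in> range (\<lambda>n. w ` {1..r n})" "d \<in> range (\<lambda>n. w ` {1..r n})"
    then obtain m n where cd: "c = w ` {1..r m}" "d = w ` {1..r n}" by blast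
    have "{1..r m} \<subseteq> {1..r n} \<or> {1..r n} \<subseteq> {1..r m}"
      using r_mono[of m n] r_mono[of n m] by (cases "m \<le> n") auto
    then show "c \<subseteq> d \<or> d \<subseteq> c" unfolding cd using image_mono by metis
  qed (use w(2) in auto)
  have VW: "V n \<subseteq> cfun.span W" for n
    unfolding w(3)[of n, symmetric] W_def by (rule cfun.span_mono[OF image_mono[OF rI]])
  then have PhiW: "Phi V \<subseteq> cfun.span W" by (auto simp: Phi_def)
  \<comment> \<open>Coordinates with respect to the union W of all bases; extending from V n to a
    larger V m does not change them.\<close>
  define L where "L i g = cfun.representation W g (w i)" for i g
  have L: "linear_functional_on (Phi V) (L i)" for i
    unfolding linear_functional_on_def L_def
    using PhiW indep by (simp add: cfun.representation_add cfun.representation_scale subset_iff)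
  define u where "u i = represent (L i)" for i
  have u: "u i \<in> Phi_star ip V" for i unfolding u_def by (rule represent_Phi_star[OF L])
  have pu: "pairing ip g (u i) = L i g" if "g \<in> Phi V" for g i
    unfolding u_def by (rule pairing_represent[OF L that])
  have dualpair: "pairing ip (w j) (u i) = (if i = j then 1 else 0)" if "i \<in> I" "j \<in> I" for i j
  proof -
    have "w j \<in> W" using that by (simp add: W_def)
    then show ?thesis
      using cfun.representation_basis[OF indep] injI that wPhi[OF that(2)]
      by (auto simp: pu L_def dest: inj_onD)
  qed
  \<comment> \<open>Once m reaches \<open>r n\<close>, the partial sum contains the whole basis of V
    n and is exact; further terms have coefficient 0.\<close>
  have expand: "(\<Sum>i\<in>I \<inter> {1..m}. cscale (pairing ip g (u i)) (w i)) = g" if g: "g \<in> V n" and m: "r n \<le> m" for g n m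
  proof -
    have J: "{1..r n} \<subseteq> I \<inter> {1..m}" using rI m by auto
    have gs: "g \<in> cfun.span (w ` {1..r n})" using g w(3) by simp
    have "cfun.representation W g = cfun.representation (w ` {1..r n}) g"
      by (rule cfun.representation_extend[OF indep gs]) (use rI in \<open>auto simp: W_def\<close>)
    then have "(\<Sum>b\<in>w ` (I \<inter> {1..m}). cscale (cfun.representation W g b) b) = g"
      using cfun.sum_representation_eq[OF w(2) gs _ image_mono[OF J]] by simp
    then show ?thesis
      using V_in_Phi[OF g] inj_on_subset[OF injI, of "I \<inter> {1..m}"] by (simp add: sum.reindex pu L_def)
  qed
  have eigI: "S (w i) = cscale (\<theta> i) (w i)" if "i \<in> I" for i using IV[OF that] eig by blast
  have expandS: "(\<Sum>i\<in>I \<inter> {1..m}. cscale (\<theta> i * pairing ip g (u i)) (w i)) = S g" if g: "g \<in> V n" and m: "r n \<le> m" for g n m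
  proof -
    have "S g = S (\<Sum>i\<in>I \<inter> {1..m}. cscale (pairing ip g (u i)) (w i))" using expand[OF that] by simp
    also have "\<dots> = (\<Sum>i\<in>I \<inter> {1..m}. cscale (pairing ip g (u i)) (S (w i)))"
      unfolding T.linear_sum[OF linS] T.linear_scale[OF linS] ..
    also have "\<dots> = (\<Sum>i\<in>I \<inter> {1..m}. cscale (\<theta> i * pairing ip g (u i)) (w i))"
      by (rule sum.cong) (simp_all only: Int_iff eigI cfun.scale_scale mult.commute)
    finally show ?thesis by simp
  qed
  \<comment> \<open>Compares the i-th coordinates in the finite expansion of S g, cut off late
    enough to contain both a basis of a V n around g and the index i.\<close>
  have pS: "pairing ip (S g) (u i) = \<theta> i * pairing ip g (u i)" if i: "i \<in> I" and g: "g \<in> Phi V" for i g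
  proof -
    obtain n where n: "g \<in> V n" using g by (auto simp: Phi_def)
    obtain k where "i \<in> {1..r k}" using IV i by blast
    define m where "m = max (r n) (r k)"
    have im: "i \<in> I \<inter> {1..m}" using i \<open>i \<in> {1..r k}\<close> by (auto simp: m_def)
    have "L i (\<Sum>j\<in>I \<inter> {1..m}. cscale (c j) (w j)) = (\<Sum>j\<in>I \<inter> {1..m}. c j * L i (w j))" for c
      by (rule linear_functional_on_sum[OF subspace_Phi L]) (use wPhi in auto)
    then have "L i (S g) = (\<Sum>j\<in>I \<inter> {1..m}. \<theta> j * pairing ip g (u j) * L i (w j))"
      unfolding expandS[OF n, of m, symmetric, OF max.cobounded1[of "r n" "r k", folded m_def]] by simp
    also have "\<dots> = (\<Sum>j\<in>I \<inter> {1..m}. if j = i then \<theta> i * pairing ip g (u i) else 0)"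
      by (rule sum.cong) (use i dualpair pu wPhi in auto)
    also have "\<dots> = \<theta> i * pairing ip g (u i)" using im by (simp add: sum.delta)
    finally show ?thesis using pu filtered_Phi[OF S g] by simp
  qed
  \<comment> \<open>Transposition reverses the order of factors, which is harmless for powers of a
    single operator.\<close>
  have dual_pow: "(dual N ^^ m) \<mu> \<in> Phi_star ip V \<and> (\<forall>g\<in>Phi V. pairing ip g ((dual N ^^ m) \<mu>) = pairing ip ((N ^^ m) g) \<mu>)"
    if \<mu>: "\<mu> \<in> Phi_star ip V" for m \<mu>
  proof (induction m)
    case (Suc m)
    have "pairing ip g ((dual N ^^ Suc m) \<mu>) = pairing ip ((N ^^ Suc m) g) \<mu>" if g: "g \<in> Phi V" for g
    proof -
      have "(N ^^ Suc m) g = (N ^^ m) (N g)" by (simp add: funpow_swap1)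
      moreover have "(dual N ^^ Suc m) \<mu> = dual N ((dual N ^^ m) \<mu>)" by simp
      ultimately show ?thesis using Suc pairing_dual[OF N _ g] filtered_Phi[OF N g] by metis
    qed
    then show ?case using Suc dual_Phi_star[OF N] by simp
  qed (use \<mu> in simp)
  have 1: "E \<mu> = dual S \<mu> + dual N \<mu>" if \<mu>: "\<mu> \<in> Phi_star ip V" for \<mu>
  proof -
    have "E = restrict (dual T) (Phi_star ip V)"
      unfolding E by (rule ext_unique) (fact T)+
    then have "E \<mu> = dual T \<mu>" using \<mu> by simp
    also have "\<dots> = dual S \<mu> + dual N \<mu>"
    proof (rule Phi_star_eqI)
      fix g assume g: "g \<in> Phi V"
      have "pairing ip (T g) \<mu> = pairing ip (S g + N g) \<mu>" by (simp add: N_def)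
      also have "\<dots> = pairing ip (S g) \<mu> + pairing ip (N g) \<mu>"
        by (rule pairing_add_left[OF \<mu> filtered_Phi[OF S g] filtered_Phi[OF N g]])
      finally show "pairing ip g (dual T \<mu>) = pairing ip g (dual S \<mu> + dual N \<mu>)"
        by (simp add: pairing_dual T(1) S N g \<mu> pairing_add_right dual_Phi_star)
    qed (use \<mu> T(1) S N in \<open>simp_all add: Phi_star_add dual_Phi_star\<close>)
    finally show ?thesis .
  qed
  have 2: "A g = S g + N g" if "g \<in> Phi V" for g using T(2)[OF that] by (simp add: N_def)
  \<comment> \<open>The eigenvalue is conjugated as it passes to the second argument of the pairing;
    this is why \<gamma> is chosen as the conjugate of \<theta>.\<close>
  have 3: "dual S (u i) = cscale_seq (cnj (\<theta> i)) (u i)" if i: "i \<in> I" for i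
  proof (rule Phi_star_eqI)
    show "pairing ip g (dual S (u i)) = pairing ip g (cscale_seq (cnj (\<theta> i)) (u i))" if "g \<in> Phi V" for g
      using pairing_dual[OF S u that] pairing_scale_right[OF u that] pS[OF i that] by simp
  qed (simp_all add: dual_Phi_star[OF S] Phi_star_scale u)
  \<comment> \<open>Paired with v in V n, the partial sum becomes the pairing of \<mu> with the
    finite expansion of S v, which is exact from m = \<open>r n\<close> on.\<close>
  have 4: "limitin (Phi_star_top H ip V)
      (\<lambda>m. \<Sum>i\<in>I \<inter> {1..m}. cscale_seq (cnj (\<theta> i) * cnj (pairing ip (w i) \<mu>)) (u i)) (dual S \<mu>) sequentially"
    if \<mu>: "\<mu> \<in> Phi_star ip V" for \<mu>
  proof (rule limitin_Phi_star_top)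
    show "(\<Sum>i\<in>I \<inter> {1..m}. cscale_seq (cnj (\<theta> i) * cnj (pairing ip (w i) \<mu>)) (u i)) \<in> Phi_star ip V" for m
      by (intro Phi_star_sum Phi_star_scale u)
    fix n
    have "pairing ip v (\<Sum>i\<in>I \<inter> {1..m}. cscale_seq (cnj (\<theta> i) * cnj (pairing ip (w i) \<mu>)) (u i)) =
        pairing ip v (dual S \<mu>)" if m: "r n \<le> m" and v: "v \<in> V n" for m v
    proof -
      have vP: "v \<in> Phi V" by (rule V_in_Phi[OF v])
      have "pairing ip v (\<Sum>i\<in>I \<inter> {1..m}. cscale_seq (cnj (\<theta> i) * cnj (pairing ip (w i) \<mu>)) (u i)) =
          (\<Sum>i\<in>I \<inter> {1..m}. pairing ip v (cscale_seq (cnj (\<theta> i) * cnj (pairing ip (w i) \<mu>)) (u i)))"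
        by (rule pairing_sum_right[OF Phi_star_scale[OF u] vP])
      also have "\<dots> = (\<Sum>i\<in>I \<inter> {1..m}. \<theta> i * pairing ip v (u i) * pairing ip (w i) \<mu>)"
        by (simp add: pairing_scale_right[OF u vP] mult_ac)
      also have "\<dots> = pairing ip (\<Sum>i\<in>I \<inter> {1..m}. cscale (\<theta> i * pairing ip v (u i)) (w i)) \<mu>"
        by (rule linear_functional_on_sum[OF subspace_Phi linear_functional_on_pairing[OF \<mu>], symmetric])
          (use wPhi in auto)
      also have "\<dots> = pairing ip v (dual S \<mu>)"
        unfolding expandS[OF v m] by (rule pairing_dual[OF S \<mu> vP, symmetric])
      finally show ?thesis .
    qed
    then show "\<exists>M. \<forall>m\<ge>M. \<forall>v\<in>V n. pairing ip v (\<Sum>i\<in>I \<inter> {1..m}. cscale_seq (cnj (\<theta> i) * cnj (pairing ip (w i) \<mu>)) (u i)) =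
        pairing ip v (dual S \<mu>)" by blast
  qed (rule dual_Phi_star[OF S \<mu>])
  have 5: "limitin (Phi_top H ip V) (\<lambda>m. \<Sum>i\<in>I \<inter> {1..m}. cscale (cnj (cnj (\<theta> i)) * pairing ip g (u i)) (w i))
      (S g) sequentially" if g: "g \<in> Phi V" for g
  proof (rule limitin_eventually)
    show "S g \<in> topspace (Phi_top H ip V)" using filtered_Phi[OF S g] by simp
    obtain n where "g \<in> V n" using g by (auto simp: Phi_def)
    then show "\<forall>\<^sub>F m in sequentially. (\<Sum>i\<in>I \<inter> {1..m}. cscale (cnj (cnj (\<theta> i)) * pairing ip g (u i)) (w i)) = S g"
      using expandS unfolding eventually_sequentially complex_cnj_cnj by blast
  qed
  have 6: "limitin (Phi_star_top H ip V) (\<lambda>n. (dual N ^^ n) \<mu>) 0 sequentially" if \<mu>: "\<mu> \<in> Phi_star ip V" for \<mu>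
  proof (rule limitin_Phi_star_top)
    fix n
    \<comment> \<open>A single exponent annihilates V n, so the pairings with all its vectors vanish
      from the same index on, although N need not be nilpotent on Phi.\<close>
    obtain m where m: "\<And>x. x \<in> V n \<Longrightarrow> (N ^^ m) x = 0" using nil unfolding N_def by blast
    have "pairing ip v ((dual N ^^ k) \<mu>) = pairing ip v 0" if k: "m \<le> k" and v: "v \<in> V n" for k v
    proof -
      have "(N ^^ k) v = (N ^^ m) ((N ^^ (k - m)) v)"
        using k by (simp flip: comp_apply[of "N ^^ m" "N ^^ (k - m)"] funpow_add)
      also have "\<dots> = 0" by (rule m[OF N_pow_V[OF v]])
      finally have "pairing ip v ((dual N ^^ k) \<mu>) = pairing ip 0 \<mu>"
        using dual_pow[OF \<mu>] V_in_Phi[OF v] by metis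
      moreover have "pairing ip 0 \<mu> = ip 0 (\<mu> 0)"
        by (rule pairing_eq[OF \<mu> cfun.subspace_0[OF subspace_V]])
      ultimately show ?thesis
        using ip_zero_left[OF V_in_H[OF Phi_star_V[OF \<mu>]]] pairing_0_right[OF V_in_Phi[OF v]] by metis
    qed
    then show "\<exists>M. \<forall>m\<ge>M. \<forall>v\<in>V n. pairing ip v ((dual N ^^ m) \<mu>) = pairing ip v 0" by blast
  qed (use dual_pow[OF \<mu>] Phi_star_0 in auto)
  have 7: "\<exists>n. (N ^^ n) g = 0" if g: "g \<in> Phi V" for g
    using g nil unfolding Phi_def N_def by blast
  have 8: "dual S (dual N \<mu>) = dual N (dual S \<mu>)" if \<mu>: "\<mu> \<in> Phi_star ip V" for \<mu>
  proof (rule Phi_star_eqI)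
    show "pairing ip g (dual S (dual N \<mu>)) = pairing ip g (dual N (dual S \<mu>))" if "g \<in> Phi V" for g
      using that \<mu> SN by (simp add: pairing_dual S N dual_Phi_star filtered_Phi)
  qed (simp_all add: dual_Phi_star S N \<mu>)
  show ?thesis
  proof (rule exI[of _ "dual S"], rule exI[of _ "dual N"], rule exI[of _ S], rule exI[of _ N], intro conjI)
    show "\<exists>\<gamma> w u. (\<forall>i\<in>I. w i \<in> Phi V \<and> u i \<in> Phi_star ip V) \<and>
           (\<forall>n. inj_on w {1..r n} \<and> cfun.independent (w ` {1..r n}) \<and>
                cfun.span (w ` {1..r n}) = V n) \<and>
           (\<forall>i\<in>I. dual S (u i) = cscale_seq (\<gamma> i) (u i) \<and> S (w i) = cscale (cnj (\<gamma> i)) (w i)) \<and>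
           (\<forall>i\<in>I. \<forall>j\<in>I. pairing ip (w j) (u i) = (if i = j then 1 else 0)) \<and>
           (\<forall>\<mu>\<in>Phi_star ip V.
              limitin (Phi_star_top H ip V)
                (\<lambda>m. \<Sum>i\<in>I \<inter> {1..m}. cscale_seq (\<gamma> i * cnj (pairing ip (w i) \<mu>)) (u i))
                (dual S \<mu>) sequentially) \<and>
           (\<forall>g\<in>Phi V.
              limitin (Phi_top H ip V)
                (\<lambda>m. \<Sum>i\<in>I \<inter> {1..m}. cscale (cnj (\<gamma> i) * pairing ip g (u i)) (w i))
                (S g) sequentially)"
      by (rule exI[of _ "\<lambda>i. cnj (\<theta> i)"], rule exI[of _ w], rule exI[of _ u], intro conjI ballI allI)
        (assumption | rule wPhi u w 3 dualpair 4 5 | simp only: eigI complex_cnj_cnj)+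
  qed (use 1 2 6 7 8 SN dual_cont_linear_op[OF S] dual_cont_linear_op[OF N]
      filtered_cont_linear_op[OF S] filtered_cont_linear_op[OF N] in blast)+
qed

end

section \<open>Identity theorem for real analytic functions\<close>

text \<open>All derivatives of the sum are carried along as a family G, so that the induction
  replaces the series by its termwise derivative and G by its shift. The coefficient of index n + 1
  is recovered from \<open>diffs b\<close>.\<close>

lemma real_power_series_eq_0:
  fixes G :: "nat \<Rightarrow> real \<Rightarrow> real"
  assumes "K > 0" "\<And>t. \<bar>t\<bar> < K \<Longrightarrow> (\<lambda>n. b n * t ^ n) sums G 0 t"
    and "\<And>m t. \<bar>t\<bar> < K \<Longrightarrow> (G m has_field_derivative G (Suc m) t) (at t)"
    and "\<And>m. G m 0 = 0"
  shows "b n = 0"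
  using assms(2-4)
proof (induction n arbitrary: b G)
  case 0
  have "(\<lambda>n. b n * 0 ^ n) sums G 0 0" using 0(1)[of 0] assms(1) by simp
  then show ?case using powser_sums_zero[of b] sums_unique2 0(3)[of 0] by metis
next
  case (Suc n)
  have "diffs b n = 0"
  proof (rule Suc.IH[of "diffs b" "\<lambda>m. G (Suc m)"])
    fix t :: real assume t: "\<bar>t\<bar> < K"
    show "(\<lambda>n. diffs b n * t ^ n) sums G (Suc 0) t"
      by (rule termdiffs_sums_strong[of K b "G 0"]) (use Suc.prems t in auto)
  qed (use Suc.prems in auto)
  then show ?case by (simp add: diffs_def)
qed

section \<open>Derivatives along lines and functions with vanishing jets\<close>

definition directional :: "real ^ 'd::finite \<Rightarrow> (real ^ 'd \<Rightarrow> complex) \<Rightarrow> real ^ 'd \<Rightarrow> complex" where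
  "directional v h = (\<lambda>x. \<Sum>j\<in>UNIV. of_real (v $ j) * partial j h x)"

definition flat_at :: "(real ^ 'd::finite) set \<Rightarrow> real ^ 'd \<Rightarrow> (real ^ 'd \<Rightarrow> complex) \<Rightarrow> bool" where
  "flat_at \<Omega> a h \<longleftrightarrow> smooth_on \<Omega> h \<and> (\<forall>is. partials is h a = 0)"

lemma partials_zero [simp]: "partials is (\<lambda>x. 0 :: complex) = (\<lambda>x. 0)"
  by (induction "is") (simp_all add: partial_def)

lemma flat_at_zero: "flat_at \<Omega> a (\<lambda>x. 0)"
  by (simp add: flat_at_def smooth_on_def)

text \<open>Flatness is stable under directional derivatives, hence all derivatives at 0 of a flat
  function along a line vanish.\<close>

lemma flat_at_directional:
  assumes o: "open \<Omega>" and a: "a \<in> \<Omega>" and h: "flat_at \<Omega> a h"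
  shows "flat_at \<Omega> a (directional v h)"
proof -
  have 1: "flat_at \<Omega> a (\<lambda>x. of_real (v $ j) * partial j h x)" for j
  proof -
    have s: "smooth_on \<Omega> (partial j h)" using h smooth_on_partial by (auto simp: flat_at_def)
    have "partials is (\<lambda>x. of_real (v $ j) * partial j h x) a = of_real (v $ j) * partials (is @ [j]) h a" for "is"
      using partials_bounded_linear[OF bounded_linear_mult_right o s a] by (simp add: partials_append)
    then show ?thesis
      using h smooth_on_bounded_linear[OF bounded_linear_mult_right o s] by (simp add: flat_at_def)
  qed
  have "flat_at \<Omega> a (\<lambda>x. \<Sum>j\<in>X. of_real (v $ j) * partial j h x)" if "finite X" for X
    using that
  proof (induction X rule: finite_induct)
    case empty
    show ?case using flat_at_zero by simp
  next
    case (insert j X)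
    then show ?case
      using 1[of j] o a by (simp add: flat_at_def smooth_on_add partials_add)
  qed
  then show ?thesis unfolding directional_def by simp
qed

lemma has_derivative_along_line:
  fixes h :: "real ^ 'd::finite \<Rightarrow> complex"
  assumes "h differentiable (at (a + t *\<^sub>R v))"
  shows "((\<lambda>t. h (a + t *\<^sub>R v)) has_vector_derivative directional v h (a + t *\<^sub>R v)) (at t)"
proof -
  let ?D = "frechet_derivative h (at (a + t *\<^sub>R v))"
  have lin: "linear ?D" by (rule linear_frechet_derivative[OF assms])
  have "((\<lambda>t. h (a + t *\<^sub>R v)) has_derivative (\<lambda>s. ?D (s *\<^sub>R v))) (at t)"
    by (rule has_derivative_compose[where f = "\<lambda>t. a + t *\<^sub>R v" and g = h, OF _ has_derivative_frechet[OF assms]])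
      (auto intro!: derivative_eq_intros)
  moreover have "?D (s *\<^sub>R v) = s *\<^sub>R directional v h (a + t *\<^sub>R v)" for s
  proof -
    have "?D v = ?D (\<Sum>j\<in>UNIV. v $ j *\<^sub>R axis j 1)"
      by (simp add: basis_expansion flip: scalar_mult_eq_scaleR)
    also have "\<dots> = directional v h (a + t *\<^sub>R v)"
      by (simp only: linear_sum[OF lin] linear_cmul[OF lin] directional_def partial_def)
        (simp only: scaleR_conv_of_real)
    finally show ?thesis by (simp add: linear_cmul[OF lin])
  qed
  ultimately show ?thesis by (simp add: has_vector_derivative_def)
qed

text \<open>On the line through a with direction v, a monomial of degree n contributes a multiple of
  t^n; unconditional summation allows grouping by degree, and each degree class is finite.\<close>

lemma real_analytic_line_power_series:
  fixes h :: "real ^ 'd::finite \<Rightarrow> complex" and v :: "real ^ 'd"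
  assumes "\<And>x. x \<in> ball a e \<Longrightarrow>
      ((\<lambda>\<alpha>. c \<alpha> * of_real (\<Prod>i\<in>UNIV. (x $ i - a $ i) ^ \<alpha> i)) has_sum h x) UNIV"
  obtains b :: "nat \<Rightarrow> complex" where
    "\<And>t. a + t *\<^sub>R v \<in> ball a e \<Longrightarrow> (\<lambda>n. b n * of_real t ^ n) sums h (a + t *\<^sub>R v)"
proof -
  define B where "B n = {\<alpha> :: 'd \<Rightarrow> nat. sum \<alpha> UNIV = n}" for n
  have finB: "finite (B n)" for n
    by (rule finite_subset[OF _ finite_multi_indices[of n]]) (auto simp: B_def)
  define b where "b n = (\<Sum>\<alpha>\<in>B n. c \<alpha> * of_real (\<Prod>i\<in>UNIV. (v $ i) ^ \<alpha> i))" for n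
  have "(\<lambda>n. b n * of_real t ^ n) sums h (a + t *\<^sub>R v)" if t: "a + t *\<^sub>R v \<in> ball a e" for t
  proof -
    let ?f = "\<lambda>\<alpha>. c \<alpha> * of_real (\<Prod>i\<in>UNIV. (v $ i) ^ \<alpha> i) * of_real t ^ sum \<alpha> UNIV"
    have "?f = (\<lambda>\<alpha>. c \<alpha> * of_real (\<Prod>i\<in>UNIV. ((a + t *\<^sub>R v) $ i - a $ i) ^ \<alpha> i))"
      by (rule ext) (simp add: power_mult_distrib prod.distrib power_sum mult_ac)
    then have hs: "(?f has_sum h (a + t *\<^sub>R v)) UNIV" using assms[OF t] by simp
    \<comment> \<open>The multi-indices are the disjoint union of their degree classes, in the shape
      needed for iterated summation.\<close>
    have bij: "bij_betw snd (Sigma UNIV B) UNIV"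
      by (rule bij_betwI[where g = "\<lambda>\<alpha>. (sum \<alpha> UNIV, \<alpha>)"]) (auto simp: B_def)
    have "((\<lambda>x. ?f (snd x)) has_sum h (a + t *\<^sub>R v)) (Sigma UNIV B)"
      using has_sum_reindex_bij_betw[OF bij, of ?f] hs by (rule iffD2)
    then have "((\<lambda>(n, \<alpha>). ?f \<alpha>) has_sum h (a + t *\<^sub>R v)) (Sigma UNIV B)"
      by (simp only: case_prod_unfold)
    then have "((\<lambda>n. b n * of_real t ^ n) has_sum h (a + t *\<^sub>R v)) UNIV"
    proof (rule has_sum_SigmaD)
      fix n
      have "(?f has_sum (\<Sum>\<alpha>\<in>B n. ?f \<alpha>)) (B n)" by (rule has_sum_finite[OF finB])
      also have "(\<Sum>\<alpha>\<in>B n. ?f \<alpha>) = b n * of_real t ^ n"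
        by (simp add: b_def sum_distrib_right B_def)
      finally show "((\<lambda>\<alpha>. case (n, \<alpha>) of (n, \<alpha>) \<Rightarrow> ?f \<alpha>) has_sum b n * of_real t ^ n) (B n)" by simp
    qed
    then show ?thesis by (rule has_sum_imp_sums)
  qed
  then show ?thesis by (rule that)
qed

lemma real_analytic_onD:
  assumes "real_analytic_on \<Omega> h" "a \<in> \<Omega>"
  shows "\<exists>c e. e > 0 \<and> (\<forall>x\<in>ball a e.
      ((\<lambda>\<alpha>. c \<alpha> * of_real (\<Prod>i\<in>UNIV. (x $ i - a $ i) ^ \<alpha> i)) has_sum h x) UNIV)"
  using assms unfolding real_analytic_on_def by blast

text \<open>Restriction to the line through a and x reduces the claim to one variable, where a power
  series with vanishing derivatives at 0 is 0.\<close>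

lemma real_analytic_flat_imp_zero_near:
  assumes o: "open \<Omega>" and a: "a \<in> \<Omega>" and h: "real_analytic_on \<Omega> h" and flat: "flat_at \<Omega> a h"
  shows "\<exists>e>0. ball a e \<subseteq> \<Omega> \<and> (\<forall>x\<in>ball a e. h x = 0)"
proof -
  from real_analytic_onD[OF h a]
  obtain c e1 where c0: "e1 > 0 \<and> (\<forall>x\<in>ball a e1.
      ((\<lambda>\<alpha>. c \<alpha> * of_real (\<Prod>i\<in>UNIV. (x $ i - a $ i) ^ \<alpha> i)) has_sum h x) UNIV)" by (elim exE)
  note c = conjunct1[OF c0] bspec[OF conjunct2[OF c0]]
  obtain e2 where e2: "e2 > 0" "ball a e2 \<subseteq> \<Omega>" using o a openE by blast
  define e where "e = min e1 e2"
  have e: "e > 0" "ball a e \<subseteq> \<Omega>" using c e2 by (auto simp: e_def)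
  have "h x = 0" if x: "x \<in> ball a e" for x
  proof (cases "x = a")
    case True
    then show ?thesis using flat unfolding flat_at_def by (metis partials_simps(1))
  next
    case False
    define v where "v = x - a"
    have v: "norm v > 0" "norm v < e" using False x by (auto simp: v_def dist_norm norm_minus_commute)
    \<comment> \<open>The point x has parameter 1; K exceeds 1, so the parameter interval includes
      it.\<close>
    define K where "K = e / norm v"
    have K: "K > 1" using v by (simp add: K_def)
    have inb: "a + t *\<^sub>R v \<in> ball a e" if "\<bar>t\<bar> < K" for t
      using that v by (simp add: K_def dist_norm pos_less_divide_eq)
    obtain b where b: "\<And>t. a + t *\<^sub>R v \<in> ball a e \<Longrightarrow> (\<lambda>n. b n * of_real t ^ n) sums h (a + t *\<^sub>R v)"
      by (rule real_analytic_line_power_series[of a e c h v]) (use c(2) in \<open>auto simp: e_def\<close>)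
    have fl: "flat_at \<Omega> a ((directional v ^^ m) h)" for m
      by (induction m) (use flat flat_at_directional[OF o a] in auto)
    \<comment> \<open>Applied below to real and imaginary part, because the one-variable statement
      concerns real series.\<close>
    have zero: "L (b n) = 0" if L: "bounded_linear L" for L :: "complex \<Rightarrow> real" and n
    proof (rule real_power_series_eq_0[of K "\<lambda>n. L (b n)" "\<lambda>m t. L ((directional v ^^ m) h (a + t *\<^sub>R v))"])
      fix t :: real assume t: "\<bar>t\<bar> < K"
      have "(\<lambda>n. L (b n * of_real t ^ n)) sums L (h (a + t *\<^sub>R v))"
        by (rule bounded_linear.sums[OF L b[OF inb[OF t]]])
      moreover have "L (b n * of_real t ^ n) = L (b n) * t ^ n" for n
        using linear_cmul[OF bounded_linear.linear[OF L], of "t ^ n" "b n"]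
        by (simp add: scaleR_conv_of_real mult.commute)
      ultimately show "(\<lambda>n. L (b n) * t ^ n) sums L ((directional v ^^ 0) h (a + t *\<^sub>R v))" by simp
      fix m
      have "(directional v ^^ m) h differentiable at (a + t *\<^sub>R v)"
        using fl[of m] inb[OF t] e(2) smooth_on_differentiable unfolding flat_at_def by blast
      from bounded_linear.has_vector_derivative[OF L has_derivative_along_line[OF this]]
      show "((\<lambda>t. L ((directional v ^^ m) h (a + t *\<^sub>R v))) has_field_derivative
          L ((directional v ^^ Suc m) h (a + t *\<^sub>R v))) (at t)"
        by (simp add: has_real_derivative_iff_has_vector_derivative)
    next
      show "L ((directional v ^^ m) h (a + 0 *\<^sub>R v)) = 0" for m
        using fl[of m] linear_0[OF bounded_linear.linear[OF L]] unfolding flat_at_def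
        by (metis add.right_neutral partials_simps(1) scaleR_zero_left)
    qed (use K in auto)
    have "b n = 0" for n
      using zero[OF bounded_linear_Re] zero[OF bounded_linear_Im] by (simp add: complex_eq_iff)
    then have "(\<lambda>n. 0) sums h (a + 1 *\<^sub>R v)" using b[OF inb, of 1] K by simp
    then show ?thesis using sums_unique2[OF sums_zero] by (fastforce simp: v_def)
  qed
  then show ?thesis using e by blast
qed

text \<open>The points at which all derivatives of h vanish form a closed set by continuity and an
  open set by the local statement; it contains p, so connectedness makes it all of \<Omega>.\<close>

theorem real_analytic_flat_imp_zero:
  assumes o: "open \<Omega>" and conn: "connected \<Omega>" and p: "p \<in> \<Omega>"
    and h: "real_analytic_on \<Omega> h" and flat: "flat_at \<Omega> p h" and x: "x \<in> \<Omega>"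
  shows "h x = 0"
proof -
  have s: "smooth_on \<Omega> h" using flat by (simp add: flat_at_def)
  define Z where "Z = {x \<in> \<Omega>. \<forall>is. partials is h x = 0}"
  have "closedin (top_of_set \<Omega>) Z"
  proof -
    have "continuous_on \<Omega> (partials is h)" for "is"
      using s by (intro continuous_at_imp_continuous_on ballI differentiable_imp_continuous_within)
        (auto simp: smooth_on_def)
    then have "closedin (top_of_set \<Omega>) {x \<in> \<Omega>. partials is h x = 0}" for "is"
      by (rule continuous_closedin_preimage_constant)
    then have "closedin (top_of_set \<Omega>) (\<Inter>is. {x \<in> \<Omega>. partials is h x = 0})"
      by (intro closedin_INT) auto
    also have "(\<Inter>is. {x \<in> \<Omega>. partials is h x = 0}) = Z" by (auto simp: Z_def)
    finally show ?thesis .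
  qed
  moreover have "openin (top_of_set \<Omega>) Z"
    unfolding openin_open_eq[OF o] open_contains_ball
  proof (intro conjI ballI)
    show "Z \<subseteq> \<Omega>" by (auto simp: Z_def)
    fix a assume "a \<in> Z"
    then have a: "a \<in> \<Omega>" "flat_at \<Omega> a h" using s by (auto simp: Z_def flat_at_def)
    obtain e where e: "e > 0" "ball a e \<subseteq> \<Omega>" "\<And>x. x \<in> ball a e \<Longrightarrow> h x = 0"
      using real_analytic_flat_imp_zero_near[OF o a(1) h a(2)] by blast
    have "partials is h y = 0" if "y \<in> ball a e" for "is" y
      using partials_cong_open[OF open_ball that, of h "\<lambda>x. 0"] e(3) by simp
    then show "\<exists>e>0. ball a e \<subseteq> Z" using e by (intro exI[of _ e]) (auto simp: Z_def)
  qed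
  moreover have "p \<in> Z" using p flat by (simp add: Z_def flat_at_def)
  ultimately have "Z = \<Omega>" using conn unfolding connected_clopen by blast
  then have "\<forall>is. partials is h x = 0" using x by (auto simp: Z_def)
  then show ?thesis by (metis partials_simps(1))
qed

lemma subspace_real_analytic_on: "cfun.subspace {h. real_analytic_on \<Omega> h}"
proof (rule cfun.subspaceI)
  show "0 \<in> {h. real_analytic_on \<Omega> h}"
    unfolding mem_Collect_eq real_analytic_on_def
    by (intro ballI exI[of _ "\<lambda>_. 0"] exI[of _ 1]) (auto simp: has_sum_0)
next
  fix g h assume "g \<in> {h. real_analytic_on \<Omega> h}" "h \<in> {h. real_analytic_on \<Omega> h}"
  then have gh: "real_analytic_on \<Omega> g" "real_analytic_on \<Omega> h" by auto
  show "g + h \<in> {h. real_analytic_on \<Omega> h}"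
    unfolding mem_Collect_eq real_analytic_on_def
  proof
    fix a assume a: "a \<in> \<Omega>"
    from real_analytic_onD[OF gh(1) a]
    obtain c e where c0: "e > 0 \<and> (\<forall>x\<in>ball a e.
        ((\<lambda>\<alpha>. c \<alpha> * of_real (\<Prod>i\<in>UNIV. (x $ i - a $ i) ^ \<alpha> i)) has_sum g x) UNIV)" by (elim exE)
    note c = conjunct1[OF c0] bspec[OF conjunct2[OF c0]]
    from real_analytic_onD[OF gh(2) a]
    obtain c' e' where c0': "e' > 0 \<and> (\<forall>x\<in>ball a e'.
        ((\<lambda>\<alpha>. c' \<alpha> * of_real (\<Prod>i\<in>UNIV. (x $ i - a $ i) ^ \<alpha> i)) has_sum h x) UNIV)" by (elim exE)
    note c' = conjunct1[OF c0'] bspec[OF conjunct2[OF c0']]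
    show "\<exists>c. \<exists>e>0. \<forall>x\<in>ball a e.
        ((\<lambda>\<alpha>. c \<alpha> * of_real (\<Prod>i\<in>UNIV. (x $ i - a $ i) ^ \<alpha> i)) has_sum (g + h) x) UNIV"
    proof (intro exI[of _ "\<lambda>\<alpha>. c \<alpha> + c' \<alpha>"] exI[of _ "min e e'"] conjI ballI)
      fix x assume "x \<in> ball a (min e e')"
      then show "((\<lambda>\<alpha>. (c \<alpha> + c' \<alpha>) * of_real (\<Prod>i\<in>UNIV. (x $ i - a $ i) ^ \<alpha> i)) has_sum (g + h) x) UNIV"
        unfolding distrib_right plus_fun_apply by (intro has_sum_add c(2) c'(2)) auto
    qed (use c(1) c'(1) in auto)
  qed
next
  fix d g assume "g \<in> {h. real_analytic_on \<Omega> h}"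
  then have g: "real_analytic_on \<Omega> g" by auto
  show "cscale d g \<in> {h. real_analytic_on \<Omega> h}"
    unfolding mem_Collect_eq real_analytic_on_def
  proof
    fix a assume a: "a \<in> \<Omega>"
    from real_analytic_onD[OF g a]
    obtain c e where c0: "e > 0 \<and> (\<forall>x\<in>ball a e.
        ((\<lambda>\<alpha>. c \<alpha> * of_real (\<Prod>i\<in>UNIV. (x $ i - a $ i) ^ \<alpha> i)) has_sum g x) UNIV)" by (elim exE)
    note c = conjunct1[OF c0] bspec[OF conjunct2[OF c0]]
    show "\<exists>c. \<exists>e>0. \<forall>x\<in>ball a e.
        ((\<lambda>\<alpha>. c \<alpha> * of_real (\<Prod>i\<in>UNIV. (x $ i - a $ i) ^ \<alpha> i)) has_sum (cscale d g) x) UNIV"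
      by (intro exI[of _ "\<lambda>\<alpha>. d * c \<alpha>"] exI[of _ e] conjI ballI c(1))
        (simp only: cscale_def mult.assoc has_sum_cmult_right[OF c(2)])
  qed
qed

section \<open>Jets of kernel functions and the Koopman operator\<close>

lemma partial_comp:
  fixes h :: "real ^ 'd::finite \<Rightarrow> complex" and f :: "real ^ 'd \<Rightarrow> real ^ 'd"
  assumes "f differentiable (at x)" "h differentiable (at (f x))"
  shows "partial i (\<lambda>x. h (f x)) x = (\<Sum>j\<in>UNIV. of_real (partial i f x $ j) * partial j h (f x))"
proof -
  let ?D = "frechet_derivative h (at (f x))"
  have lin: "linear ?D" by (rule linear_frechet_derivative[OF assms(2)])
  have "partial i (\<lambda>x. h (f x)) x = ?D (partial i f x)"
    unfolding partial_def[of i f]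
    by (rule partial_eqI, rule has_derivative_compose[where f = f and g = h])
      (rule has_derivative_frechet assms)+
  also have "\<dots> = ?D (\<Sum>j\<in>UNIV. (partial i f x $ j) *\<^sub>R axis j 1)"
    by (simp add: basis_expansion flip: scalar_mult_eq_scaleR)
  also have "\<dots> = (\<Sum>j\<in>UNIV. of_real (partial i f x $ j) * partial j h (f x))"
    by (simp only: linear_sum[OF lin] linear_cmul[OF lin] partial_def) (simp only: scaleR_conv_of_real)
  finally show ?thesis .
qed

text \<open>The operators \<open>h \<mapsto> \<Sum>\<^sub>j c\<^sub>j \<cdot> (\<partial>\<^bsup>j\<^esup> h \<circ> f)\<close> of order at most \<open>n\<close>. They replace the explicit
  coefficients of Faa di Bruno's formula, of which only the existence matters.\<close>

inductive pullback_op :: "(real ^ 'd::finite) set \<Rightarrow> (real ^ 'd \<Rightarrow> real ^ 'd) \<Rightarrow> nat \<Rightarrow>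
    ((real ^ 'd \<Rightarrow> complex) \<Rightarrow> real ^ 'd \<Rightarrow> complex) \<Rightarrow> bool"
  for \<Omega> f n where
  monomial: "length js \<le> n \<Longrightarrow> smooth_on \<Omega> c \<Longrightarrow> pullback_op \<Omega> f n (\<lambda>h x. c x * partials js h (f x))"
| add: "pullback_op \<Omega> f n F \<Longrightarrow> pullback_op \<Omega> f n G \<Longrightarrow> pullback_op \<Omega> f n (\<lambda>h x. F h x + G h x)"

lemma smooth_on_const: "smooth_on \<Omega> (\<lambda>x. c :: complex)"
proof -
  have "partials is (\<lambda>x. c) = (\<lambda>x. if is = [] then c else 0)" for "is" :: "'a list"
    by (induction "is") (simp_all add: partial_def)
  then show ?thesis by (simp add: smooth_on_def)
qed

lemma pullback_op_sum:
  assumes "finite X" "\<And>j. j \<in> X \<Longrightarrow> pullback_op \<Omega> f n (F j)"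
  shows "pullback_op \<Omega> f n (\<lambda>h x. \<Sum>j\<in>X. F j h x)"
  using assms
proof (induction X rule: finite_induct)
  case empty
  show ?case using monomial[of "[]" n \<Omega> "\<lambda>x. 0" f] smooth_on_const[of \<Omega> 0] by simp
next
  case (insert j X)
  then show ?case using add[of \<Omega> f n "F j" "\<lambda>h x. \<Sum>j\<in>X. F j h x"] by simp
qed

text \<open>The product rule differentiates the coefficient and the chain rule raises the order by
  one. Differentiability is carried along since the rule for sums requires it, and f must map into
  \<Omega> because h is smooth only there.\<close>

lemma pullback_op_partial:
  fixes f :: "real ^ 'd::finite \<Rightarrow> real ^ 'd"
  assumes o: "open \<Omega>" and f: "smooth_on \<Omega> f" "f \<in> \<Omega> \<rightarrow> \<Omega>" and F: "pullback_op \<Omega> f n F"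
  shows "(\<forall>h x. smooth_on \<Omega> h \<longrightarrow> x \<in> \<Omega> \<longrightarrow> F h differentiable (at x)) \<and>
    (\<exists>G. pullback_op \<Omega> f (Suc n) G \<and> (\<forall>h x. smooth_on \<Omega> h \<longrightarrow> x \<in> \<Omega> \<longrightarrow> partial i (F h) x = G h x))"
  using F
proof (induction rule: pullback_op.induct)
  case (monomial js c)
  have d: "c differentiable (at x)" "(\<lambda>x. partials js h (f x)) differentiable (at x)"
    "partial i (\<lambda>x. partials js h (f x)) x =
      (\<Sum>j\<in>UNIV. of_real (partial i f x $ j) * partials (j # js) h (f x))"
    if h: "smooth_on \<Omega> h" and x: "x \<in> \<Omega>" for h :: "real ^ 'd \<Rightarrow> complex" and x
  proof -
    show "c differentiable (at x)" by (rule smooth_on_differentiable[OF monomial(2) x])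
    have fx: "f x \<in> \<Omega>" using f(2) x by auto
    have df: "f differentiable (at x)" "partials js h differentiable (at (f x))"
      using smooth_on_differentiable[OF f(1) x] h fx by (auto simp: smooth_on_def)
    show "(\<lambda>x. partials js h (f x)) differentiable (at x)"
      using differentiable_chain_at[OF df] by (simp add: comp_def)
    show "partial i (\<lambda>x. partials js h (f x)) x =
      (\<Sum>j\<in>UNIV. of_real (partial i f x $ j) * partials (j # js) h (f x))"
      unfolding partials_simps by (rule partial_comp[OF df])
  qed
  define G where "G = (\<lambda>h x. partial i c x * partials js h (f x) +
    (\<Sum>j\<in>UNIV. (c x * of_real (partial i f x $ j)) * partials (j # js) h (f x)))"
  have "pullback_op \<Omega> f (Suc n) G"
    unfolding G_def
  proof (intro pullback_op.add pullback_op_sum pullback_op.monomial)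
    fix j
    have "bounded_linear (\<lambda>v :: real ^ 'd. complex_of_real (v $ j))"
      by (rule bounded_linear_compose[OF bounded_linear_of_real bounded_linear_vec_nth])
    then have "smooth_on \<Omega> (\<lambda>x. complex_of_real (partial i f x $ j))"
      by (rule smooth_on_bounded_linear[OF _ o smooth_on_partial[OF f(1)]])
    then show "smooth_on \<Omega> (\<lambda>x. c x * complex_of_real (partial i f x $ j))"
      by (rule smooth_on_mult[OF o monomial(2)])
  qed (use monomial smooth_on_partial in auto)
  moreover have "partial i (\<lambda>x. c x * partials js h (f x)) x = G h x" if "smooth_on \<Omega> h" "x \<in> \<Omega>" for h x
    unfolding partial_mult[OF d(1,2)[OF that]] d(3)[OF that] G_def by (simp only: sum_distrib_left mult.assoc)
  ultimately show ?case using d(1,2) by (auto intro!: differentiable_mult)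
next
  case (add F G)
  obtain F' G' where *: "pullback_op \<Omega> f (Suc n) F'" "pullback_op \<Omega> f (Suc n) G'"
    "\<forall>h x. smooth_on \<Omega> h \<longrightarrow> x \<in> \<Omega> \<longrightarrow> partial i (F h) x = F' h x"
    "\<forall>h x. smooth_on \<Omega> h \<longrightarrow> x \<in> \<Omega> \<longrightarrow> partial i (G h) x = G' h x"
    using add.IH by blast
  have "pullback_op \<Omega> f (Suc n) (\<lambda>h x. F' h x + G' h x)" by (rule pullback_op.add[OF *(1,2)])
  moreover have "partial i (\<lambda>x. F h x + G h x) x = F' h x + G' h x" if "smooth_on \<Omega> h" "x \<in> \<Omega>" for h x
    using partial_add[of "F h" x "G h" i] add.IH *(3,4) that by simp
  ultimately show ?case using add.IH by (auto intro!: differentiable_add)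
qed

lemma ex_pullback_op_partials:
  fixes f :: "real ^ 'd::finite \<Rightarrow> real ^ 'd"
  assumes o: "open \<Omega>" and f: "smooth_on \<Omega> f" "f \<in> \<Omega> \<rightarrow> \<Omega>"
  shows "\<exists>F. pullback_op \<Omega> f (length is) F \<and>
    (\<forall>h x. smooth_on \<Omega> h \<longrightarrow> x \<in> \<Omega> \<longrightarrow> partials is (\<lambda>x. h (f x)) x = F h x)"
proof (induction "is")
  case Nil
  show ?case
    using monomial[of "[]" 0 \<Omega> "\<lambda>x. 1" f] smooth_on_const[of \<Omega> 1] by (intro exI[of _ "\<lambda>h x. 1 * partials [] h (f x)"]) auto
next
  case (Cons i "is")
  then obtain F where F: "pullback_op \<Omega> f (length is) F"
    "\<And>h x. smooth_on \<Omega> h \<Longrightarrow> x \<in> \<Omega> \<Longrightarrow> partials is (\<lambda>x. h (f x)) x = F h x" by blast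
  obtain G where G: "pullback_op \<Omega> f (Suc (length is)) G"
    "\<And>h x. smooth_on \<Omega> h \<Longrightarrow> x \<in> \<Omega> \<Longrightarrow> partial i (F h) x = G h x"
    using pullback_op_partial[OF o f F(1)] by blast
  have "partials (i # is) (\<lambda>x. h (f x)) x = G h x" if "smooth_on \<Omega> h" "x \<in> \<Omega>" for h x
    using partial_cong_open[OF o that(2) F(2)[OF that(1)], where i = i] G(2)[OF that] by simp
  then show ?case using G(1) by auto
qed

section \<open>Reproducing kernel Hilbert spaces of smooth functions\<close>

locale smooth_rkhs =
  fixes \<Omega> :: "(real ^ 'd::finite) set" and k :: "real ^ 'd \<Rightarrow> real ^ 'd \<Rightarrow> complex"
    and H :: "(real ^ 'd \<Rightarrow> complex) set" and ip :: "(real ^ 'd) inner_fun"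
  assumes open_\<Omega>: "open \<Omega>" and rkhs: "is_rkhs \<Omega> k H ip" and smooth: "continuously_in_smooth \<Omega> H ip"
begin

sublocale inner_function_space H ip
proof
  note r = rkhs[unfolded is_rkhs_def]
  from r show "cfun.subspace H" by (elim conjE)
  from r have "\<forall>g\<in>H. \<forall>h\<in>H. \<forall>l\<in>H. ip (g + h) l = ip g l + ip h l" by (elim conjE)
  then show "ip (g + h) l = ip g l + ip h l" if "g \<in> H" "h \<in> H" "l \<in> H" for g h l using that by blast
  from r have "\<forall>c. \<forall>g\<in>H. \<forall>h\<in>H. ip (cscale c g) h = c * ip g h" by (elim conjE)
  then show "ip (cscale c g) h = c * ip g h" if "g \<in> H" "h \<in> H" for c g h using that by blast
  from r have "\<forall>g\<in>H. \<forall>h\<in>H. ip h g = cnj (ip g h)" by (elim conjE)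
  then show "ip h g = cnj (ip g h)" if "g \<in> H" "h \<in> H" for g h using that by blast
  from r have "\<forall>h\<in>H. h \<noteq> 0 \<longrightarrow> 0 < Re (ip h h)" by (elim conjE)
  then show "0 < Re (ip h h)" if "h \<in> H" "h \<noteq> 0" for h using that by blast
qed

lemma complete: "mcomplete"
  using rkhs unfolding is_rkhs_def by (elim conjE)

lemma smooth_H: "h \<in> H \<Longrightarrow> smooth_on \<Omega> h"
  using smooth by (simp add: continuously_in_smooth_def)

lemma outside:
  assumes "h \<in> H" "x \<notin> \<Omega>"
  shows "h x = 0"
proof -
  have "\<forall>h\<in>H. \<forall>x. x \<notin> \<Omega> \<longrightarrow> h x = 0" using rkhs unfolding is_rkhs_def by (elim conjE)
  then show ?thesis using assms by blast
qed

lemma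
  assumes "x \<in> \<Omega>"
  shows kfun_H: "kfun \<Omega> k x \<in> H" and reproducing: "\<And>h. h \<in> H \<Longrightarrow> ip h (kfun \<Omega> k x) = h x"
proof -
  have "\<forall>x\<in>\<Omega>. kfun \<Omega> k x \<in> H \<and> (\<forall>h\<in>H. ip h (kfun \<Omega> k x) = h x)"
    using rkhs unfolding is_rkhs_def by (elim conjE)
  then show "kfun \<Omega> k x \<in> H" "\<And>h. h \<in> H \<Longrightarrow> ip h (kfun \<Omega> k x) = h x" using assms by blast+
qed

lemma kernel_symmetric: "x \<in> \<Omega> \<Longrightarrow> y \<in> \<Omega> \<Longrightarrow> k x y = cnj (k y x)"
  using reproducing[of y "kfun \<Omega> k x"] reproducing[of x "kfun \<Omega> k y"]
    ip_commute[of "kfun \<Omega> k y" "kfun \<Omega> k x"] kfun_H by (simp add: kfun_def)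

lemma linear_functional_on_partials: "p \<in> \<Omega> \<Longrightarrow> linear_functional_on H (\<lambda>h. partials is h p)"
proof -
  assume p: "p \<in> \<Omega>"
  have "partials is (g + h) p = partials is g p + partials is h p" if "g \<in> H" "h \<in> H" for g h
    using partials_add[OF open_\<Omega> smooth_H[OF that(1)] smooth_H[OF that(2)] p] unfolding plus_fun_def .
  moreover have "partials is (cscale c g) p = c * partials is g p" if "g \<in> H" for c g
    unfolding cscale_def
    by (rule partials_bounded_linear[OF bounded_linear_mult_right open_\<Omega> smooth_H[OF that] p])
  ultimately show ?thesis by (simp add: linear_functional_on_def)
qed

text \<open>Difference quotients in H are avoided. Continuity of the inclusion into smooth functions
  bounds the derivative functional at p, its Riesz representer exists, and the reproducing property
  evaluates that representer as the kernel derivative.\<close>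

lemma kernel_deriv:
  assumes p: "p \<in> \<Omega>"
  shows kernel_deriv_H: "kernel_deriv \<Omega> k \<alpha> p \<in> H"
    and ip_kernel_deriv: "\<And>h. h \<in> H \<Longrightarrow> ip h (kernel_deriv \<Omega> k \<alpha> p) = mpartial \<alpha> h p"
proof -
  obtain "is" where "is": "(mpartial \<alpha> :: (real ^ 'd \<Rightarrow> complex) \<Rightarrow> _) = partials is"
    using ex_mpartial_eq_partials[of \<alpha>] by blast
  have "compact {p} \<and> {p} \<subseteq> \<Omega>" using p by simp
  then obtain C where "\<forall>h\<in>H. \<forall>x\<in>{p}. norm (mpartial \<alpha> h x) \<le> C * hnorm ip h"
    using smooth unfolding continuously_in_smooth_def by blast
  then have C: "cmod (partials is h p) \<le> C * hnorm ip h" if "h \<in> H" for h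
    using that unfolding "is" by simp
  have "\<exists>g\<in>H. \<forall>h\<in>H. ip h g = partials is h p"
    by (rule Riesz[OF complete linear_functional_on_partials[OF p] C])
  then obtain g where g: "g \<in> H" "\<And>h. h \<in> H \<Longrightarrow> ip h g = partials is h p" by blast
  have "kernel_deriv \<Omega> k \<alpha> p y = g y" for y
  proof (cases "y \<in> \<Omega>")
    case False
    then show ?thesis using outside[OF g(1)] by (simp add: kernel_deriv_def)
  next
    case True
    have "kernel_deriv \<Omega> k \<alpha> p y = partials is (\<lambda>x. k x y) p"
      using True by (simp add: kernel_deriv_def "is")
    \<comment> \<open>Hermitian symmetry exchanges the variables, so the derivative in the first
      variable of k becomes the conjugated derivative of a kernel function, an element of H.\<close>
    also have "\<dots> = partials is (\<lambda>x. cnj (kfun \<Omega> k y x)) p"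
      by (rule partials_cong_open[OF open_\<Omega> p], subst kernel_symmetric) (use True in \<open>simp_all add: kfun_def\<close>)
    also have "\<dots> = cnj (partials is (kfun \<Omega> k y) p)"
      by (rule partials_bounded_linear[OF bounded_linear_cnj open_\<Omega> smooth_H[OF kfun_H[OF True]] p])
    also have "\<dots> = ip g (kfun \<Omega> k y)"
      using g(2)[OF kfun_H[OF True]] ip_commute[OF kfun_H[OF True] g(1)] by simp
    also have "\<dots> = g y" by (rule reproducing[OF True g(1)])
    finally show ?thesis .
  qed
  then have "kernel_deriv \<Omega> k \<alpha> p = g" by auto
  then show "kernel_deriv \<Omega> k \<alpha> p \<in> H" "\<And>h. h \<in> H \<Longrightarrow> ip h (kernel_deriv \<Omega> k \<alpha> p) = mpartial \<alpha> h p"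
    using g "is" by simp_all
qed

lemma jet_space_H: "p \<in> \<Omega> \<Longrightarrow> jet_space \<Omega> k p n \<subseteq> H"
  unfolding jet_space_def by (rule cfun.span_minimal[OF _ subspace_H]) (use kernel_deriv_H in auto)

lemma subspace_jet_space: "cfun.subspace (jet_space \<Omega> k p n)"
  unfolding jet_space_def by (rule cfun.subspace_span)

lemma jet_space_mono: "m \<le> n \<Longrightarrow> jet_space \<Omega> k p m \<subseteq> jet_space \<Omega> k p n"
  unfolding jet_space_def by (rule cfun.span_mono) auto

lemma partials_in_jet_space:
  assumes p: "p \<in> \<Omega>" and "length is \<le> n"
  shows "\<exists>v\<in>jet_space \<Omega> k p n. \<forall>h\<in>H. ip h v = partials is h p"
proof
  show "kernel_deriv \<Omega> k (count_list is) p \<in> jet_space \<Omega> k p n"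
    unfolding jet_space_def using assms(2)
    by (intro cfun.span_base CollectI exI[of _ "count_list is"]) (simp add: sum_count_list)
  show "\<forall>h\<in>H. ip h (kernel_deriv \<Omega> k (count_list is) p) = partials is h p"
    using ip_kernel_deriv[OF p] mpartial_eq_partials[OF open_\<Omega> p smooth_H] by simp
qed

text \<open>The fixed-point equation is decisive: the derivatives of h are evaluated at f p = p and
  are therefore represented by jets at the same point. Coefficients are conjugated on their way into
  the second argument.\<close>

lemma pullback_op_in_jet_space:
  assumes F: "pullback_op \<Omega> f n F" and p: "p \<in> \<Omega>" "f p = p"
  shows "\<exists>v\<in>jet_space \<Omega> k p n. \<forall>h\<in>H. ip h v = F h p"
  using F
proof (induction rule: pullback_op.induct)
  case (monomial js c)
  then obtain v where v: "v \<in> jet_space \<Omega> k p n" "\<forall>h\<in>H. ip h v = partials js h p"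
    using partials_in_jet_space[OF p(1)] by blast
  then have "v \<in> H" using jet_space_H[OF p(1)] by blast
  then have "\<forall>h\<in>H. ip h (cscale (cnj (c p)) v) = c p * partials js h (f p)"
    using v(2) p(2) by (simp add: ip_scale_right)
  then show ?case using cfun.subspace_scale[OF subspace_jet_space v(1)] by blast
next
  case (add F G)
  then obtain v w where vw: "v \<in> jet_space \<Omega> k p n" "\<forall>h\<in>H. ip h v = F h p"
    "w \<in> jet_space \<Omega> k p n" "\<forall>h\<in>H. ip h w = G h p" by blast
  then have "v \<in> H" "w \<in> H" using jet_space_H[OF p(1)] by blast+
  then have "\<forall>h\<in>H. ip h (v + w) = F h p + G h p"
    using vw by (simp add: ip_add_right)
  then show ?case using cfun.subspace_add[OF subspace_jet_space vw(1,3)] by blast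
qed

lemma jet_sum_eq_span:
  assumes "finite \<Lambda>"
  shows "jet_sum \<Omega> k \<Lambda> n = cfun.span (\<Union>p\<in>\<Lambda>. (\<lambda>\<alpha>. kernel_deriv \<Omega> k \<alpha> p) ` {\<alpha>. sum \<alpha> UNIV \<le> n})"
    (is "_ = cfun.span ?F")
proof
  have js: "jet_space \<Omega> k p n = cfun.span ((\<lambda>\<alpha>. kernel_deriv \<Omega> k \<alpha> p) ` {\<alpha>. sum \<alpha> UNIV \<le> n})" for p
    unfolding jet_space_def by (rule arg_cong[where f = cfun.span]) auto
  have "jet_space \<Omega> k p n \<subseteq> cfun.span ?F" if "p \<in> \<Lambda>" for p
    unfolding js by (rule cfun.span_mono) (use that in blast)
  then show "jet_sum \<Omega> k \<Lambda> n \<subseteq> cfun.span ?F"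
    unfolding jet_sum_def by (auto intro!: cfun.span_sum)
  have single: "v \<in> jet_sum \<Omega> k \<Lambda> n" if v: "v \<in> jet_space \<Omega> k p n" and p: "p \<in> \<Lambda>" for v p
  proof -
    have "v = (\<Sum>q\<in>\<Lambda>. if q = p then v else 0)" using assms p by (simp add: sum.delta)
    moreover have "\<forall>q\<in>\<Lambda>. (if q = p then v else 0) \<in> jet_space \<Omega> k q n"
      using v cfun.subspace_0[OF subspace_jet_space] by auto
    ultimately show ?thesis unfolding jet_sum_def mem_Collect_eq by (intro exI conjI)
  qed
  have "cfun.subspace (jet_sum \<Omega> k \<Lambda> n)"
  proof (rule cfun.subspaceI)
    show "0 \<in> jet_sum \<Omega> k \<Lambda> n"
      unfolding jet_sum_def mem_Collect_eq
      by (rule exI[of _ "\<lambda>_. 0"]) (use cfun.subspace_0[OF subspace_jet_space] in simp)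
    fix g h assume "g \<in> jet_sum \<Omega> k \<Lambda> n" "h \<in> jet_sum \<Omega> k \<Lambda> n"
    then obtain v w where v: "g = (\<Sum>p\<in>\<Lambda>. v p)" "\<forall>p\<in>\<Lambda>. v p \<in> jet_space \<Omega> k p n"
      and w: "h = (\<Sum>p\<in>\<Lambda>. w p)" "\<forall>p\<in>\<Lambda>. w p \<in> jet_space \<Omega> k p n"
      unfolding jet_sum_def by blast
    show "g + h \<in> jet_sum \<Omega> k \<Lambda> n"
      unfolding jet_sum_def mem_Collect_eq v w sum.distrib[symmetric]
      by (rule exI[of _ "\<lambda>p. v p + w p"]) (use v w cfun.subspace_add[OF subspace_jet_space] in simp)
  next
    fix c g assume "g \<in> jet_sum \<Omega> k \<Lambda> n"
    then obtain v where v: "g = (\<Sum>p\<in>\<Lambda>. v p)" "\<forall>p\<in>\<Lambda>. v p \<in> jet_space \<Omega> k p n"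
      unfolding jet_sum_def by blast
    show "cscale c g \<in> jet_sum \<Omega> k \<Lambda> n"
      unfolding jet_sum_def mem_Collect_eq v cfun.scale_sum_right
      by (rule exI[of _ "\<lambda>p. cscale c (v p)"]) (use v cfun.subspace_scale[OF subspace_jet_space] in simp)
  qed
  moreover have "?F \<subseteq> jet_sum \<Omega> k \<Lambda> n"
  proof
    fix v assume "v \<in> ?F"
    then obtain p \<alpha> where "p \<in> \<Lambda>" "sum \<alpha> UNIV \<le> n" "v = kernel_deriv \<Omega> k \<alpha> p" by blast
    then show "v \<in> jet_sum \<Omega> k \<Lambda> n"
      by (intro single[of v p]) (auto simp: js intro!: cfun.span_base)
  qed
  ultimately show "cfun.span ?F \<subseteq> jet_sum \<Omega> k \<Lambda> n" using cfun.span_minimal by blast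
qed

lemma rigged_jet_sum:
  assumes "finite \<Lambda>" "\<Lambda> \<subseteq> \<Omega>"
  shows "rigged H ip (jet_sum \<Omega> k \<Lambda>)"
proof (intro rigged.intro rigged_axioms.intro inner_function_space_axioms)
  fix n
  let ?F = "\<lambda>n. \<Union>p\<in>\<Lambda>. (\<lambda>\<alpha>. kernel_deriv \<Omega> k \<alpha> p) ` {\<alpha>. sum \<alpha> UNIV \<le> n}"
  have "finite (?F n)" by (intro finite_UN_I finite_imageI finite_multi_indices assms(1))
  moreover have "?F n \<subseteq> H" using assms(2) by (auto intro: kernel_deriv_H)
  ultimately show "\<exists>F. finite F \<and> F \<subseteq> H \<and> jet_sum \<Omega> k \<Lambda> n = cfun.span F"
    by (intro exI[of _ "?F n"] conjI jet_sum_eq_span[OF assms(1)])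
  have "?F n \<subseteq> ?F (Suc n)" by (intro UN_mono image_mono) auto
  then show "jet_sum \<Omega> k \<Lambda> n \<subseteq> jet_sum \<Omega> k \<Lambda> (Suc n)"
    unfolding jet_sum_eq_span[OF assms(1)] by (rule cfun.span_mono)
qed

section \<open>The adjoint of the Koopman operator on jets\<close>

context
  fixes f :: "real ^ 'd \<Rightarrow> real ^ 'd"
  assumes f_maps: "f \<in> \<Omega> \<rightarrow> \<Omega>" and f_smooth: "smooth_on \<Omega> f"
    and dense: "densely_defined H ip (koopman_dom \<Omega> H f)"
begin

abbreviation adjoint_value :: "(real ^ 'd \<Rightarrow> complex) \<Rightarrow> (real ^ 'd \<Rightarrow> complex) \<Rightarrow> bool" where
  "adjoint_value \<equiv> is_adjoint_value H ip (koopman_dom \<Omega> H f) (koopman \<Omega> f)"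

lemma koopman_dom_H: "h \<in> koopman_dom \<Omega> H f \<Longrightarrow> h \<in> H \<and> koopman \<Omega> f h \<in> H"
  by (simp add: koopman_dom_def)

text \<open>The difference of two adjoint values is orthogonal to a dense subspace and hence
  zero.\<close>

lemma adjoint_value_unique:
  assumes "adjoint_value g g'" "adjoint_value g g''"
  shows "g' = g''"
proof -
  define d where "d = g' - g''"
  have H: "g' \<in> H" "g'' \<in> H" "d \<in> H" using assms by (auto simp: is_adjoint_value_def d_def)
  have orth: "ip h d = 0" if "h \<in> koopman_dom \<Omega> H f" for h
    using assms that H koopman_dom_H[OF that] by (simp add: is_adjoint_value_def d_def ip_diff_right)
  have "hnorm ip d = 0"
  proof (rule ccontr)
    assume "hnorm ip d \<noteq> 0"
    then have n: "hnorm ip d > 0" using hnorm_nonneg[OF H(3)] by linarith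
    have "d \<in> mtopology closure_of (koopman_dom \<Omega> H f)"
      using dense H(3) by (simp add: densely_defined_def htop_def)
    \<comment> \<open>A domain element closer to d than d is to 0. As d is orthogonal to h,
      Cauchy-Schwarz for d - h and d bounds the squared norm of d strictly by itself.\<close>
    then obtain h where h: "h \<in> koopman_dom \<Omega> H f" "h \<in> mball d (hnorm ip d)"
      using n unfolding metric_closure_of by blast
    then have hH: "h \<in> H" "hnorm ip (d - h) < hnorm ip d" using koopman_dom_H H by (auto simp: hdist_def)
    have "(hnorm ip d)\<^sup>2 = cmod (ip d d)" using ip_self[OF H(3)] by (simp only: norm_of_real) simp
    also have "ip d d = ip (d - h) d" using orth[OF h(1)] H hH by (simp add: ip_diff_left)
    also have "cmod (ip (d - h) d) \<le> hnorm ip (d - h) * hnorm ip d"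
      by (rule Cauchy_Schwarz) (use H hH in auto)
    also have "\<dots> < hnorm ip d * hnorm ip d" using hH(2) n by simp
    finally show False by (simp add: power2_eq_square)
  qed
  then show ?thesis using hnorm_eq_0[OF H(3)] by (simp add: d_def)
qed

lemma koopman_adj_eqI: "adjoint_value g g' \<Longrightarrow> koopman_adj \<Omega> H ip f g = g'"
  unfolding koopman_adj_def by (rule the_equality) (use adjoint_value_unique in blast)+

lemma adjoint_value_add:
  "adjoint_value g g' \<Longrightarrow> adjoint_value h h' \<Longrightarrow> g \<in> H \<Longrightarrow> h \<in> H \<Longrightarrow> adjoint_value (g + h) (g' + h')"
  using koopman_dom_H by (simp add: is_adjoint_value_def ip_add_right)

lemma adjoint_value_scale:
  "adjoint_value g g' \<Longrightarrow> g \<in> H \<Longrightarrow> adjoint_value (cscale c g) (cscale c g')"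
  using koopman_dom_H by (simp add: is_adjoint_value_def ip_scale_right)

lemma adjoint_value_zero: "adjoint_value 0 0"
  using koopman_dom_H by (simp add: is_adjoint_value_def)

text \<open>On generators the adjoint value is explicit: the representer of h |-> (derivative of h o
  f at p), which a pullback operator of no larger order provides. Linear combinations
  follow.\<close>

lemma jet_space_adjoint:
  assumes p: "p \<in> \<Omega>" "f p = p" and g: "g \<in> jet_space \<Omega> k p n"
  shows "\<exists>g'\<in>jet_space \<Omega> k p n. adjoint_value g g'"
proof -
  have "g \<in> H \<and> (\<exists>g'\<in>jet_space \<Omega> k p n. adjoint_value g g')"
    using g unfolding jet_space_def
  proof (induction rule: cfun.span_induct_alt)
    case base
    show ?case using adjoint_value_zero cfun.span_zero H_closed(1) by blast
  next
    case (step c b y)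
    then obtain \<alpha> where \<alpha>: "b = kernel_deriv \<Omega> k \<alpha> p" "sum \<alpha> UNIV \<le> n" by blast
    obtain "is" where "is": "length is = sum \<alpha> UNIV" "(mpartial \<alpha> :: (real ^ 'd \<Rightarrow> complex) \<Rightarrow> _) = partials is"
      using ex_mpartial_eq_partials[of \<alpha>] by blast
    obtain F where F: "pullback_op \<Omega> f (length is) F"
      "\<And>h x. smooth_on \<Omega> h \<Longrightarrow> x \<in> \<Omega> \<Longrightarrow> partials is (\<lambda>x. h (f x)) x = F h x"
      using ex_pullback_op_partials[OF open_\<Omega> f_smooth f_maps] by blast
    obtain v where v: "v \<in> jet_space \<Omega> k p (length is)" "\<And>h. h \<in> H \<Longrightarrow> ip h v = F h p"
      using pullback_op_in_jet_space[OF F(1) p] by blast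
    have vn: "v \<in> jet_space \<Omega> k p n" using v(1) jet_space_mono[of "length is" n p] \<alpha>(2) "is"(1) by auto
    have vH: "v \<in> H" using vn jet_space_H[OF p(1)] by blast
    have bH: "b \<in> H" using \<alpha>(1) kernel_deriv_H[OF p(1)] by simp
    have "adjoint_value b v"
      unfolding is_adjoint_value_def
    proof (intro conjI ballI vH)
      fix h assume h: "h \<in> koopman_dom \<Omega> H f"
      have hH: "h \<in> H" "koopman \<Omega> f h \<in> H" using koopman_dom_H[OF h] by auto
      have "ip (koopman \<Omega> f h) b = partials is (koopman \<Omega> f h) p"
        using ip_kernel_deriv[OF p(1) hH(2)] \<alpha>(1) "is"(2) by simp
      also have "\<dots> = partials is (\<lambda>x. h (f x)) p"
        by (rule partials_cong_open[OF open_\<Omega> p(1)]) (simp add: koopman_def)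
      also have "\<dots> = ip h v" using F(2)[OF smooth_H[OF hH(1)] p(1)] v(2)[OF hH(1)] by simp
      finally show "ip (koopman \<Omega> f h) b = ip h v" .
    qed
    moreover obtain y' where y': "y' \<in> jet_space \<Omega> k p n" "adjoint_value y y'"
      using step unfolding jet_space_def by blast
    ultimately have "adjoint_value (cscale c b + y) (cscale c v + y')"
      using step bH by (intro adjoint_value_add adjoint_value_scale H_closed) auto
    moreover have "cscale c v + y' \<in> jet_space \<Omega> k p n"
      by (intro cfun.subspace_add[OF subspace_jet_space] cfun.subspace_scale[OF subspace_jet_space] vn y')
    ultimately show ?case using step bH H_closed(2,3) unfolding jet_space_def by blast
  qed
  then show ?thesis by blast
qed

lemma jet_sum_adjoint:
  assumes L: "finite \<Lambda>" "\<Lambda> \<subseteq> \<Omega>" "\<And>p. p \<in> \<Lambda> \<Longrightarrow> f p = p" and g: "g \<in> jet_sum \<Omega> k \<Lambda> n"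
  shows "\<exists>g'\<in>jet_sum \<Omega> k \<Lambda> n. adjoint_value g g'"
proof -
  obtain v where v: "g = (\<Sum>p\<in>\<Lambda>. v p)" "\<forall>p\<in>\<Lambda>. v p \<in> jet_space \<Omega> k p n"
    using g unfolding jet_sum_def by blast
  have "\<forall>p\<in>\<Lambda>. \<exists>g'. g' \<in> jet_space \<Omega> k p n \<and> adjoint_value (v p) g'"
    using jet_space_adjoint L v(2) by blast
  then obtain v' where v': "\<forall>p\<in>\<Lambda>. v' p \<in> jet_space \<Omega> k p n \<and> adjoint_value (v p) (v' p)"
    using bchoice by meson
  have vH: "v p \<in> H" if "p \<in> \<Lambda>" for p using v(2) that jet_space_H L(2) by blast
  have "adjoint_value (\<Sum>p\<in>X. v p) (\<Sum>p\<in>X. v' p)" if "finite X" "X \<subseteq> \<Lambda>" for X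
    using that
  proof (induction X rule: finite_induct)
    case empty
    show ?case unfolding sum.empty by (rule adjoint_value_zero)
  next
    case (insert p X)
    show ?case
      unfolding sum.insert[OF insert.hyps]
      by (rule adjoint_value_add) (use insert v' vH in \<open>auto intro!: cfun.subspace_sum[OF subspace_H]\<close>)
  qed
  then have "adjoint_value g (\<Sum>p\<in>\<Lambda>. v' p)" using L(1) v(1) by blast
  moreover have "(\<Sum>p\<in>\<Lambda>. v' p) \<in> jet_sum \<Omega> k \<Lambda> n" unfolding jet_sum_def using v' by blast
  ultimately show ?thesis by blast
qed

end

end

section \<open>Dimension of the rigged space\<close>

lemma (in rigged) finite_dim_Phi:
  assumes "\<And>n. cfun.dim (V n) < i"
  shows "\<exists>B. finite B \<and> B \<subseteq> Phi V \<and> Phi V \<subseteq> cfun.span B"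
proof -
  obtain B where B: "B \<subseteq> Phi V" "cfun.independent B" "Phi V \<subseteq> cfun.span B"
    using cfun.maximal_independent_subset[of "Phi V"] by blast
  have "finite B"
  proof (rule ccontr)
    assume "infinite B"
    then obtain B0 where B0: "B0 \<subseteq> B" "finite B0" "card B0 = i"
      using infinite_arbitrarily_large by blast
    \<comment> \<open>A finite subset of an increasing union lies in one V n, so i independent
      vectors of Phi would give some V n dimension at least i.\<close>
    have "\<exists>n. X \<subseteq> V n" if "finite X" "X \<subseteq> Phi V" for X
      using that
    proof (induction X rule: finite_induct)
      case (insert x X)
      then obtain m n where mn: "x \<in> V m" "X \<subseteq> V n" by (auto simp: Phi_def)
      have "V m \<subseteq> V (max m n)" "V n \<subseteq> V (max m n)" by (intro V_mono max.cobounded1 max.cobounded2)+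
      then have "insert x X \<subseteq> V (max m n)" using mn by blast
      then show ?case ..
    qed simp
    then obtain n where n: "B0 \<subseteq> V n" using B0(1,2) B(1) by (meson order_trans)
    have "cfun.independent B0" by (rule cfun.independent_mono[OF B(2) B0(1)])
    then obtain B1 where B1: "B0 \<subseteq> B1" "B1 \<subseteq> V n" "cfun.independent B1" "V n \<subseteq> cfun.span B1"
      by (rule cfun.maximal_independent_subset_extend[OF n])
    obtain F where F: "finite F" "V n = cfun.span F" using V_finite_span by blast
    have "finite B1" using cfun.independent_span_bound[OF F(1) B1(3)] B1(2) F(2) by simp
    then have "i \<le> card B1" using B0(3) card_mono[OF _ B1(1)] by simp
    then show False using cfun.basis_card_eq_dim[OF B1(2,4,3)] assms[of n] by simp
  qed
  then show ?thesis using B by blast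
qed

context smooth_rkhs
begin

lemma jet_space_subset_jet_sum:
  assumes "finite \<Lambda>" "p \<in> \<Lambda>"
  shows "jet_space \<Omega> k p n \<subseteq> jet_sum \<Omega> k \<Lambda> n"
  unfolding jet_sum_eq_span[OF assms(1)] jet_space_def by (rule cfun.span_mono) (use assms(2) in auto)

text \<open>If the jets at \<open>p\<close> span a finite-dimensional space, then finitely many kernel functions have the
  same jets at \<open>p\<close> as all of them, and by analyticity they span all kernel functions. Only the
  kernel functions, and not all elements of \<open>H\<close>, are known to be analytic.\<close>

lemma finite_dim_if_jets_finite_dim:
  assumes conn: "connected \<Omega>" and analytic: "\<And>x. x \<in> \<Omega> \<Longrightarrow> real_analytic_on \<Omega> (kfun \<Omega> k x)"
    and \<Lambda>: "finite \<Lambda>" "\<Lambda> \<subseteq> \<Omega>" "p \<in> \<Lambda>"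
    and B: "finite B" "B \<subseteq> H" "Phi (jet_sum \<Omega> k \<Lambda>) \<subseteq> cfun.span B"
  shows "\<exists>B. finite B \<and> cfun.span B = H"
proof -
  let ?K = "kfun \<Omega> k"
  have p: "p \<in> \<Omega>" using \<Lambda> by blast
  have spanH: "cfun.span B \<subseteq> H" by (rule cfun.span_minimal[OF B(2) subspace_H])
  have "\<exists>u\<in>cfun.span B. \<forall>v\<in>cfun.span B. ip v u = ip v (?K x)" if "x \<in> \<Omega>" for x
    by (rule finite_Riesz[OF B(1,2) linear_functional_on_ip[OF kfun_H[OF that] spanH]])
  then have "\<forall>x\<in>\<Omega>. \<exists>u. u \<in> cfun.span B \<and> (\<forall>v\<in>cfun.span B. ip v u = ip v (?K x))" by blast
  \<comment> \<open>\<pi> x is the orthogonal projection of the kernel function at x onto the span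
    of B, which contains all jets at p.\<close>
  from bchoice[OF this] obtain \<pi> where \<pi>: "\<And>x. x \<in> \<Omega> \<Longrightarrow> \<pi> x \<in> cfun.span B"
    "\<And>x v. x \<in> \<Omega> \<Longrightarrow> v \<in> cfun.span B \<Longrightarrow> ip v (\<pi> x) = ip v (?K x)" by blast
  obtain B' where B': "B' \<subseteq> \<pi> ` \<Omega>" "cfun.independent B'" "\<pi> ` \<Omega> \<subseteq> cfun.span B'"
    using cfun.maximal_independent_subset[of "\<pi> ` \<Omega>"] by blast
  have finB': "finite B'"
    using cfun.independent_span_bound[OF B(1) B'(2)] B'(1) \<pi>(1) by blast
  have "\<forall>b\<in>B'. \<exists>x. x \<in> \<Omega> \<and> \<pi> x = b" using B'(1) by blast
  \<comment> \<open>The finitely many points whose projected kernel functions form a basis of all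
    projections.\<close>
  from bchoice[OF this] obtain y where y: "\<And>b. b \<in> B' \<Longrightarrow> y b \<in> \<Omega>" "\<And>b. b \<in> B' \<Longrightarrow> \<pi> (y b) = b" by blast
  define G where "G = (\<lambda>b. ?K (y b)) ` B'"
  have GH: "finite G" "G \<subseteq> H" using finB' y(1) kfun_H by (auto simp: G_def)
  have KG: "?K x \<in> cfun.span G" if x: "x \<in> \<Omega>" for x
  proof -
    have "\<pi> x \<in> cfun.span B'" using B'(3) x by blast
    then obtain c where c: "\<pi> x = (\<Sum>b\<in>B'. cscale (c b) b)"
      using cfun.span_finite[OF finB'] by auto
    \<comment> \<open>The coefficients that reproduce the projection of the kernel function at x,
      used with unprojected kernel functions. The difference h is orthogonal to every jet at p,
      hence flat there.\<close>
    define g where "g = (\<Sum>b\<in>B'. cscale (c b) (?K (y b)))"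
    define h where "h = ?K x - g"
    have KH: "?K (y b) \<in> H" if "b \<in> B'" for b by (rule kfun_H[OF y(1)[OF that]])
    have gH: "g \<in> H" unfolding g_def by (intro cfun.subspace_sum[OF subspace_H] H_closed(3) KH)
    have hH: "h \<in> H" unfolding h_def by (rule H_closed(4)[OF kfun_H[OF x] gH])
    have orth: "ip v h = 0" if v: "v \<in> cfun.span B" for v
    proof -
      have vH: "v \<in> H" using v spanH by blast
      have bH: "b \<in> H" if "b \<in> B'" for b using y[OF that] \<pi>(1) spanH by force
      have "ip v g = (\<Sum>b\<in>B'. ip v (cscale (c b) (?K (y b))))"
        unfolding g_def by (rule ip_sum_right[OF H_closed(3)[OF KH] vH])
      also have "\<dots> = (\<Sum>b\<in>B'. ip v (cscale (c b) b))"
      proof (rule sum.cong[OF refl])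
        fix b assume b: "b \<in> B'"
        have "ip v (?K (y b)) = ip v b" using \<pi>(2)[OF y(1)[OF b] v] y(2)[OF b] by simp
        then show "ip v (cscale (c b) (?K (y b))) = ip v (cscale (c b) b)"
          by (simp only: ip_scale_right[OF KH[OF b] vH] ip_scale_right[OF bH[OF b] vH])
      qed
      also have "\<dots> = ip v (\<pi> x)"
        unfolding c by (rule ip_sum_right[OF H_closed(3)[OF bH] vH, symmetric])
      also have "\<dots> = ip v (?K x)" by (rule \<pi>(2)[OF x v])
      finally show ?thesis unfolding h_def ip_diff_right[OF kfun_H[OF x] gH vH] by simp
    qed
    have "partials is h p = 0" for "is"
    proof -
      obtain v where v: "v \<in> jet_space \<Omega> k p (length is)" "\<forall>h\<in>H. ip h v = partials is h p"
        using partials_in_jet_space[OF p order_refl] by blast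
      have "v \<in> Phi (jet_sum \<Omega> k \<Lambda>)"
        using v(1) jet_space_subset_jet_sum[OF \<Lambda>(1,3)] unfolding Phi_def by blast
      then have vB: "v \<in> cfun.span B" using B(3) by blast
      then have "ip h v = 0" using ip_commute[OF _ hH, of v] orth[OF vB] spanH by auto
      then show ?thesis using v(2) hH by simp
    qed
    then have flat: "flat_at \<Omega> p h" using smooth_H[OF hH] by (simp add: flat_at_def)
    have "?K x \<in> {h. real_analytic_on \<Omega> h}" "g \<in> {h. real_analytic_on \<Omega> h}"
      unfolding g_def using analytic x y(1)
      by (auto intro!: cfun.subspace_sum[OF subspace_real_analytic_on]
          cfun.subspace_scale[OF subspace_real_analytic_on] simp del: mem_Collect_eq)
    then have "h \<in> {h. real_analytic_on \<Omega> h}"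
      unfolding h_def by (rule cfun.subspace_diff[OF subspace_real_analytic_on])
    then have "h z = 0" for z
      using real_analytic_flat_imp_zero[OF open_\<Omega> conn p _ flat] outside[OF hH] by (cases "z \<in> \<Omega>") auto
    then have Kg: "?K x = g" unfolding h_def by (auto simp: fun_eq_iff)
    show ?thesis
      unfolding Kg g_def
      by (rule cfun.span_sum, rule cfun.span_scale, rule cfun.span_base) (simp add: G_def)
  qed
  have sGH: "cfun.span G \<subseteq> H" by (rule cfun.span_minimal[OF GH(2) subspace_H])
  \<comment> \<open>The projection of g onto the span of G has the same inner products with all
    kernel functions as g, hence the same values.\<close>
  moreover have "H \<subseteq> cfun.span G"
  proof
    fix g assume g: "g \<in> H"
    obtain u where u: "u \<in> cfun.span G" "\<And>v. v \<in> cfun.span G \<Longrightarrow> ip v u = ip v g"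
      using finite_Riesz[OF GH linear_functional_on_ip[OF g sGH]] by blast
    have uH: "u \<in> H" using u(1) sGH by blast
    have "u x = g x" for x
    proof (cases "x \<in> \<Omega>")
      case True
      have "ip (?K x) u = ip (?K x) g" by (rule u(2)[OF KG[OF True]])
      then have "ip u (?K x) = ip g (?K x)"
        using ip_commute[OF kfun_H[OF True] uH] ip_commute[OF kfun_H[OF True] g] by simp
      then show ?thesis using reproducing[OF True] uH g by simp
    qed (simp add: outside[OF uH] outside[OF g])
    then have "u = g" by auto
    then show "g \<in> cfun.span G" using u(1) by simp
  qed
  ultimately show ?thesis using GH(1) by blast
qed

end

text \<open>\<open>I\<close> collects the indices up to some \<open>r n\<close>; it is finite when H
  is finite-dimensional or \<Lambda> is empty. The conjugate around the pairing with \<mu> makes the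
  first series linear in \<mu>, and the inclusion in \<open>koopman_adj_dom\<close> guarantees that
  the values of \<open>koopman_adj\<close> on Phi are genuine adjoint values.\<close>

theorem theorem4p8:
  fixes \<Omega> :: "(real ^ 'd::finite) set"
    and k :: "real ^ 'd \<Rightarrow> real ^ 'd \<Rightarrow> complex"
    and H :: "(real ^ 'd \<Rightarrow> complex) set"
    and ip :: "(real ^ 'd) inner_fun"
    and f :: "real ^ 'd \<Rightarrow> real ^ 'd"
    and \<Lambda> :: "(real ^ 'd) set"
    and V :: "nat \<Rightarrow> (real ^ 'd \<Rightarrow> complex) set"
    and r :: "nat \<Rightarrow> nat"
    and I :: "nat set"
  assumes "open \<Omega>" and "connected \<Omega>"
    and "pos_def_kernel \<Omega> k"
    and "continuous_on (\<Omega> \<times> \<Omega>) (\<lambda>(x, y). k x y)"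
    and "\<And>x. x \<in> \<Omega> \<Longrightarrow> real_analytic_on \<Omega> (kfun \<Omega> k x)"
    and "is_rkhs \<Omega> k H ip"
    and "continuously_in_smooth \<Omega> H ip"
    and "f \<in> \<Omega> \<rightarrow> \<Omega>" and "smooth_on \<Omega> f"
    and "densely_defined H ip (koopman_dom \<Omega> H f)"
    and "finite \<Lambda>" and "\<Lambda> \<subseteq> \<Omega>" and "\<And>p. p \<in> \<Lambda> \<Longrightarrow> f p = p"
  defines "V \<equiv> jet_sum \<Omega> k \<Lambda>"
    and "r \<equiv> (\<lambda>n. cfun.dim (V n))"
    and "I \<equiv> {i. 1 \<le> i \<and> (\<exists>n. i \<le> r n)}"
  shows
    "(\<Lambda> \<noteq> {} \<and> \<not> (\<exists>B. finite B \<and> cfun.span B = H) \<longrightarrow> I = {1..}) \<and>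
     (\<exists>Sx Nx S N.
        cont_linear_op cscale_seq (Phi_star_top H ip V) Sx \<and>
        cont_linear_op cscale_seq (Phi_star_top H ip V) Nx \<and>
        cont_linear_op cscale (Phi_top H ip V) S \<and>
        cont_linear_op cscale (Phi_top H ip V) N \<and>
        (\<forall>\<mu>\<in>Phi_star ip V. koopman_ext \<Omega> H ip f V \<mu> = Sx \<mu> + Nx \<mu>) \<and>
        Phi V \<subseteq> koopman_adj_dom \<Omega> H ip f \<and>
        (\<forall>g\<in>Phi V. koopman_adj \<Omega> H ip f g = S g + N g) \<and>
        (\<exists>(\<gamma> :: nat \<Rightarrow> complex) w u.
           (\<forall>i\<in>I. w i \<in> Phi V \<and> u i \<in> Phi_star ip V) \<and>
           (\<forall>n. inj_on w {1..r n} \<and> cfun.independent (w ` {1..r n}) \<and>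
                cfun.span (w ` {1..r n}) = V n) \<and>
           (\<forall>i\<in>I. Sx (u i) = cscale_seq (\<gamma> i) (u i) \<and> S (w i) = cscale (cnj (\<gamma> i)) (w i)) \<and>
           (\<forall>i\<in>I. \<forall>j\<in>I. pairing ip (w j) (u i) = (if i = j then 1 else 0)) \<and>
           (\<forall>\<mu>\<in>Phi_star ip V.
              limitin (Phi_star_top H ip V)
                (\<lambda>m. \<Sum>i\<in>I \<inter> {1..m}. cscale_seq (\<gamma> i * cnj (pairing ip (w i) \<mu>)) (u i))
                (Sx \<mu>) sequentially) \<and>
           (\<forall>g\<in>Phi V.
              limitin (Phi_top H ip V)
                (\<lambda>m. \<Sum>i\<in>I \<inter> {1..m}. cscale (cnj (\<gamma> i) * pairing ip g (u i)) (w i))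
                (S g) sequentially)) \<and>
        (\<forall>\<mu>\<in>Phi_star ip V.
           limitin (Phi_star_top H ip V) (\<lambda>n. (Nx ^^ n) \<mu>) 0 sequentially) \<and>
        (\<forall>g\<in>Phi V. \<exists>n. (N ^^ n) g = 0) \<and>
        (\<forall>g\<in>Phi V. S (N g) = N (S g)) \<and>
        (\<forall>\<mu>\<in>Phi_star ip V. Sx (Nx \<mu>) = Nx (Sx \<mu>)))"
proof -
  interpret smooth_rkhs \<Omega> k H ip
    by (rule smooth_rkhs.intro) (fact assms)+
  interpret rigged H ip V
    unfolding V_def by (rule rigged_jet_sum[OF assms(11,12)])
  let ?A = "koopman_adj \<Omega> H ip f"
  note dense = assms(8,9,10)
  have adj: "\<exists>g'\<in>V n. is_adjoint_value H ip (koopman_dom \<Omega> H f) (koopman \<Omega> f) g g'" if "g \<in> V n" for g n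
    using jet_sum_adjoint[OF dense assms(11-13)] that unfolding V_def by blast
  have adj_eq: "is_adjoint_value H ip (koopman_dom \<Omega> H f) (koopman \<Omega> f) g (?A g) \<and> ?A g \<in> V n" if "g \<in> V n" for g n
    using adj[OF that] koopman_adj_eqI[OF dense] by auto
  have adjPhi: "is_adjoint_value H ip (koopman_dom \<Omega> H f) (koopman \<Omega> f) g (?A g)" if "g \<in> Phi V" for g
    using that adj_eq unfolding Phi_def by blast
  have lin: "clinear_on cscale (Phi V) ?A"
    unfolding clinear_on_def
    using koopman_adj_eqI[OF dense] adjoint_value_add[OF dense] adjoint_value_scale[OF dense] adjPhi Phi_in_H
    by simp
  have dom: "Phi V \<subseteq> koopman_adj_dom \<Omega> H ip f"
    using adjPhi Phi_in_H unfolding koopman_adj_dom_def by blast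
  have I: "I = {1..}" if ne: "\<Lambda> \<noteq> {}" and inf: "\<not> (\<exists>B. finite B \<and> cfun.span B = H)"
  proof (rule ccontr)
    assume "I \<noteq> {1..}"
    \<comment> \<open>A positive integer missing from I exceeds every \<open>r n\<close>, so it
      bounds all dimensions.\<close>
    then obtain i where "\<And>n. \<not> i \<le> r n" unfolding I_def by auto
    then have "\<exists>B. finite B \<and> B \<subseteq> Phi V \<and> Phi V \<subseteq> cfun.span B"
      by (intro finite_dim_Phi[of i]) (simp add: r_def not_le)
    then obtain B where B: "finite B" "B \<subseteq> H" "Phi V \<subseteq> cfun.span B" using Phi_in_H by blast
    obtain p where "p \<in> \<Lambda>" using ne by blast
    from finite_dim_if_jets_finite_dim[OF assms(2,5,11,12) this B(1,2) B(3)[unfolded V_def]] inf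
    show False by blast
  qed
  have "\<forall>n. \<forall>g\<in>V n. ?A g \<in> V n" using adj_eq by blast
  note dec = ex_rigged_Jordan_decomposition[OF lin this koopman_ext_def]
  show ?thesis
  proof (rule conjI, goal_cases)
    case 1
    show ?case using I by blast
  next
    case 2
    show ?case
      \<comment> \<open>The witnesses are those of the abstract decomposition; the domain inclusion
        is the only conjunct to be added under the quantifiers.\<close>
      using dec unfolding I_def r_def
      by (elim ex_forward, elim conjE, intro conjI) (rule dom | assumption)+
  qed
qed

end
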